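(* Let $(P_-,P_+)$ be a pair of polygons with symplectic billiard map $\phi$, phase space $\mathcal{P}$, maximal phase space $\mathcal{P}_{\max}$, set of critical points $C\subset P_-\sqcup P_+$ and $C$-grid $C^\#$. (I) If every limit point of $C$ is a vertex of $P_-\sqcup P_+$, then every symplectic billiard orbit on $\mathcal{P}$ is periodic. (II) If $C$ is closed (in $P_-\sqcup P_+$), then every orbit on $\mathcal{P}\setminus C^\#$ is periodic. Then, in particular, almost every orbit on $\mathcal{P}_{\max}$ is periodic. (III) If $C$ is finite, then every symplectic billiard orbit on $\mathcal{P}$ is periodic and the maximal period is bounded from above by $4\,|C\cap P_-|\,|C\cap P_+|$. In the single table setting $P=P_-=P_+$ (counting only the critical points of $P$), the maximal period is bounded from above by $2(|C|^2-|C|)$.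
   Context: Polygons. Let $v_1,\dots,v_n\in\mathbb{R}^2$ be pairwise distinct (indices read cyclically) such that any two distinct open segments $v_iv_{i+1}$, $v_jv_{j+1}$ do not intersect, no open segment $v_jv_{j+1}$ contains any $v_i$, and no three consecutive $v_i,v_{i+1},v_{i+2}$ are collinear. The union $P$ of the closed segments $\overline{v_iv_{i+1}}$ is a polygon (not necessarily convex) with vertex set $V=\{v_1,\dots,v_n\}$ and (open) edges $v_iv_{i+1}$. $\mathrm{int}(P)$ is the bounded component of $\mathbb{R}^2\setminus P$. For points $a,b$, $ab$ denotes the open segment between them. For $x\in P\setminus V$, $T_xP\subset\mathbb{R}^2$ is the linear line parallel to the edge containing $x$. Pairs. $(P_-,P_+)$ is a pair of polygons (possibly equal) with vertex sets $V_-,V_+$; $P_-\sqcup P_+$ is the formal disjoint union. The notation $P_\pm,P_\mp$ indicates a choice of sign and its opposite. A pair $(x,y)\in P_\pm\times P_\mp$ satisfies condition A if $y\notin V_\mp$ and there is exactly one $z\in P_\pm\cap\{x+t: t\in T_yP_\mp, t\neq 0\}$ with $xz\subset\mathrm{int}(P_\pm)$. Let $\mathcal{P}_{\max}$ be the set of $(x,y)\in(P_-\times P_+)\sqcup(P_+\times P_-)$ satisfying condition A. The symplectic billiard map is $\phi:\mathcal{P}_{\max}\to(P_-\times P_+)\sqcup(P_+\times P_-)$, $\phi(x,y)=(y,z)$ with this $z$. Phase space. Let $\sigma(x,y)=(y,x)$, $N_0=(P_-\times V_+)\sqcup(P_+\times V_-)$, $N_{i+1}=\phi^{-1}(N_i)$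 (preimage) for $i\ge 0$, and $N=\bigcup_{i\ge0}N_i\cup\sigma(\bigcup_{i\ge0}N_i)$. The phase space is $\mathcal{P}=\mathcal{P}_{\max}\setminus N$; $\phi$ restricts to a bijection of $\mathcal{P}$. The orbit of $(x_0,x_1)\in\mathcal{P}$ is $(\phi^k(x_0,x_1))_{k\in\mathbb{Z}}$; it is periodic if $\phi^n(x_0,x_1)=(x_0,x_1)$ for some $n\ge1$, and the least such $n$ is its period. "Almost every" refers to the product of arc-length measures; $N$ is a null set. Critical points. $C=\bigcup_{i\ge0}\pi_2(N_{2i})\subset P_-\sqcup P_+$, where $\pi_2$ is the projection to the second factor. $C^\#=((C\cap P_-)\times P_+)\cup((C\cap P_+)\times P_-)\cup(P_-\times(C\cap P_+))\cup(P_+\times(C\cap P_-))$. Single table setting. Here $P_-=P_+=P$, the $\pm$ labels are forgotten, and $\phi$ is regarded as a map on the corresponding phase space in $P\times P$ (with $\phi(x,y)=(y,z)$ by the same rule); periods are periods of this map, and $C$ is regarded as a subset of $P$ (the two copies of $C$ in $P_-$ and $P_+$ being identified and counted once). *)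

theory Defs
  imports "HOL-Analysis.Analysis"
begin

section \<open>Polygons\<close>

text \<open>A polygon is given by the cyclic list of its vertices; \<open>vtx vs i\<close> reads the index modulo
  the number of vertices.\<close>

type_synonym point = "real ^ 2"

definition vtx :: "point list \<Rightarrow> nat \<Rightarrow> point" where
  "vtx vs i = vs ! (i mod length vs)"

definition edge :: "point list \<Rightarrow> nat \<Rightarrow> point set" where
  "edge vs i = open_segment (vtx vs i) (vtx vs (Suc i))"

definition curve :: "point list \<Rightarrow> point set" where
  "curve vs = (\<Union>i<length vs. closed_segment (vtx vs i) (vtx vs (Suc i)))"

text \<open>For a nonempty list, the non-collinearity condition already forces at least three vertices;
  the first conjunct only rules out the empty list in addition.\<close>

definition is_polygon :: "point list \<Rightarrow> bool" where
  "is_polygon vs \<longleftrightarrow>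
     3 \<le> length vs \<and> distinct vs \<and>
     (\<forall>i<length vs. \<forall>j<length vs. i \<noteq> j \<longrightarrow> edge vs i \<inter> edge vs j = {}) \<and>
     (\<forall>j<length vs. edge vs j \<inter> set vs = {}) \<and>
     (\<forall>i<length vs. \<not> collinear {vtx vs i, vtx vs (Suc i), vtx vs (Suc (Suc i))})"

text \<open>The constant \<^const>\<open>inside\<close> yields the union of all bounded components of the complement.
  For a polygon there is exactly one (Jordan curve theorem).\<close>

abbreviation interior_region :: "point list \<Rightarrow> point set" where
  "interior_region vs \<equiv> inside (curve vs)"

text \<open>Meaningful for points of the curve other than vertices, which lie on a unique edge.\<close>

definition tangent :: "point list \<Rightarrow> point \<Rightarrow> point set" where
  "tangent vs y = (\<Union>i\<in>{i. i < length vs \<and> y \<in> edge vs i}. span {vtx vs (Suc i) - vtx vs i})"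

section \<open>The symplectic billiard map\<close>

text \<open>\<open>x\<close> lies on the polygon \<open>vs\<close> and \<open>y\<close> on the other polygon \<open>ws\<close>.\<close>

definition targets :: "point list \<Rightarrow> point list \<Rightarrow> point \<Rightarrow> point \<Rightarrow> point set" where
  "targets vs ws x y =
     {z \<in> curve vs \<inter> {x + t | t. t \<in> tangent ws y \<and> t \<noteq> 0}.
        open_segment x z \<subseteq> interior_region vs}"

definition condition_A :: "point list \<Rightarrow> point list \<Rightarrow> point \<Rightarrow> point \<Rightarrow> bool" where
  "condition_A vs ws x y \<longleftrightarrow> y \<notin> set ws \<and> (\<exists>!z. z \<in> targets vs ws x y)"

definition next_point :: "point list \<Rightarrow> point list \<Rightarrow> point \<Rightarrow> point \<Rightarrow> point" where
  "next_point vs ws x y = (THE z. z \<in> targets vs ws x y)"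

text \<open>A pair of polygons is a function \<open>T\<close> on the signs, encoded as Booleans: \<open>T False\<close> is
  \<open>P\<^sub>-\<close> and \<open>T True\<close> is \<open>P\<^sub>+\<close>, and negation is the change of sign. Points of the formal
  disjoint union are points tagged with a sign. Since \<^typ>\<open>bool\<close> carries the discrete topology,
  the product topology on tagged points is that of a disjoint union.\<close>

type_synonym table_pair = "bool \<Rightarrow> point list"
type_synonym tagged = "bool \<times> point"

definition table :: "table_pair \<Rightarrow> bool \<Rightarrow> tagged set" where
  "table T s = {s} \<times> curve (T s)"

definition tables :: "table_pair \<Rightarrow> tagged set" where
  "tables T = (\<Union>s. table T s)"

definition vertices :: "table_pair \<Rightarrow> tagged set" where
  "vertices T = {(s, x) | s x. x \<in> set (T s)}"

definition pair_space :: "table_pair \<Rightarrow> (tagged \<times> tagged) set" where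
  "pair_space T = (\<Union>s. table T s \<times> table T (\<not> s))"

definition Pmax :: "table_pair \<Rightarrow> (tagged \<times> tagged) set" where
  "Pmax T = {((s, x), (s', y)) | s x s' y.
     ((s, x), (s', y)) \<in> pair_space T \<and> condition_A (T s) (T s') x y}"

text \<open>The billiard map is partial with domain \<^const>\<open>Pmax\<close>; the values of the total function
  below elsewhere are irrelevant.\<close>

definition phi :: "table_pair \<Rightarrow> tagged \<times> tagged \<Rightarrow> tagged \<times> tagged" where
  "phi T = (\<lambda>((s, x), (s', y)). ((s', y), (s, next_point (T s) (T s') x y)))"

primrec N :: "table_pair \<Rightarrow> nat \<Rightarrow> (tagged \<times> tagged) set" where
  "N T 0 = {(p, q). (p, q) \<in> pair_space T \<and> q \<in> vertices T}"
| "N T (Suc i) = {r \<in> Pmax T. phi T r \<in> N T i}"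

definition singular :: "table_pair \<Rightarrow> (tagged \<times> tagged) set" where
  "singular T = (\<Union>i. N T i) \<union> prod.swap ` (\<Union>i. N T i)"

definition phase_space :: "table_pair \<Rightarrow> (tagged \<times> tagged) set" where
  "phase_space T = Pmax T - singular T"

definition critical :: "table_pair \<Rightarrow> tagged set" where
  "critical T = (\<Union>i. snd ` N T (2 * i))"

definition C_grid :: "table_pair \<Rightarrow> (tagged \<times> tagged) set" where
  "C_grid T = (\<Union>s. (critical T \<inter> table T s) \<times> table T (\<not> s)) \<union>
              (\<Union>s. table T s \<times> (critical T \<inter> table T (\<not> s)))"

definition periodic_at :: "('a \<Rightarrow> 'a) \<Rightarrow> 'a \<Rightarrow> bool" where
  "periodic_at f p \<longleftrightarrow> (\<exists>n\<ge>1. (f ^^ n) p = p)"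

text \<open>Only meaningful together with \<^const>\<open>periodic_at\<close>.\<close>

definition period :: "('a \<Rightarrow> 'a) \<Rightarrow> 'a \<Rightarrow> nat" where
  "period f p = (LEAST n. 1 \<le> n \<and> (f ^^ n) p = p)"

section \<open>Arc length\<close>

text \<open>The edges are parametrised affinely on the unit interval, with density the edge length; see
  \<open>emeasure_arc_length\<close> below.\<close>

definition arc_length :: "point list \<Rightarrow> point measure" where
  "arc_length vs =
     distr
       (density (count_space {..<length vs} \<Otimes>\<^sub>M restrict_space lborel {0..1})
          (\<lambda>(i, t). ennreal (dist (vtx vs i) (vtx vs (Suc i)))))
       borel
       (\<lambda>(i, t::real). (1 - t) *\<^sub>R vtx vs i + t *\<^sub>R vtx vs (Suc i))"

lemma emeasure_arc_length:
  assumes A: "A \<in> sets borel"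
  shows "emeasure (arc_length vs) A =
    (\<Sum>i<length vs. ennreal (dist (vtx vs i) (vtx vs (Suc i))) *
       emeasure lborel {t \<in> {0..1}. (1 - t) *\<^sub>R vtx vs i + t *\<^sub>R vtx vs (Suc i) \<in> A})"
proof -
  define n where "n = length vs"
  define L where "L = (restrict_space lborel {0..1} :: real measure)"
  define M where "M = count_space {..<n} \<Otimes>\<^sub>M L"
  define d where "d = (\<lambda>(i, t::real). ennreal (dist (vtx vs i) (vtx vs (Suc i))))"
  define g where "g = (\<lambda>(i, t::real). (1 - t) *\<^sub>R vtx vs i + t *\<^sub>R vtx vs (Suc i))"
  have g_sec: "(\<lambda>t. g (i, t)) \<in> borel_measurable L" for i
    unfolding g_def L_def by (auto intro!: measurable_restrict_space1)
  have g[measurable]: "g \<in> borel_measurable M"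
    unfolding M_def by (rule measurable_pair_measure_countable1) (auto intro: g_sec)
  have d[measurable]: "d \<in> borel_measurable M"
    unfolding M_def by (rule measurable_pair_measure_countable1) (auto simp: d_def)
  have S[measurable]: "g -` A \<inter> space M \<in> sets M"
    using g A by (rule measurable_sets)
  have h: "(\<lambda>p. d p * indicator (g -` A \<inter> space M) p) \<in> borel_measurable M"
    by measurable
  interpret L: finite_measure L
    unfolding L_def
    by (rule finite_measureI) (simp add: emeasure_restrict_space space_restrict_space)
  have "emeasure (arc_length vs) A = emeasure (density M d) (g -` A \<inter> space M)"
    unfolding arc_length_def d_def g_def M_def L_def n_def
    by (subst emeasure_distr)
      (use A g in \<open>auto simp: g_def M_def L_def n_def\<close>)
  also have "\<dots> = (\<integral>\<^sup>+ p. d p * indicator (g -` A \<inter> space M) p \<partial>M)"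
    by (rule emeasure_density) measurable
  also have "\<dots> = (\<integral>\<^sup>+ i. (\<integral>\<^sup>+ t. d (i, t) * indicator (g -` A \<inter> space M) (i, t) \<partial>L)
                        \<partial>count_space {..<n})"
    unfolding M_def
    by (rule L.nn_integral_fst[symmetric]) (use h in \<open>simp add: M_def\<close>)
  also have "\<dots> = (\<Sum>i<n. \<integral>\<^sup>+ t. d (i, t) * indicator (g -` A \<inter> space M) (i, t) \<partial>L)"
    by (simp add: nn_integral_count_space_finite)
  also have "\<dots> = (\<Sum>i<n. ennreal (dist (vtx vs i) (vtx vs (Suc i))) *
       emeasure lborel {t \<in> {0..1}. g (i, t) \<in> A})"
  proof (rule sum.cong[OF refl])
    fix i assume i: "i \<in> {..<n}"
    have S: "(\<lambda>t. g (i, t)) -` A \<inter> space L \<in> sets L"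
      using g_sec A by (rule measurable_sets)
    have "(\<integral>\<^sup>+ t. d (i, t) * indicator (g -` A \<inter> space M) (i, t) \<partial>L) =
        (\<integral>\<^sup>+ t. ennreal (dist (vtx vs i) (vtx vs (Suc i))) *
           indicator ((\<lambda>t. g (i, t)) -` A \<inter> space L) t \<partial>L)"
      using i by (intro nn_integral_cong) (auto simp: d_def M_def space_pair_measure indicator_def)
    also have "\<dots> = ennreal (dist (vtx vs i) (vtx vs (Suc i))) *
        emeasure L ((\<lambda>t. g (i, t)) -` A \<inter> space L)"
      using S by (rule nn_integral_cmult_indicator)
    also have "emeasure L ((\<lambda>t. g (i, t)) -` A \<inter> space L) =
        emeasure lborel ((\<lambda>t. g (i, t)) -` A \<inter> space L)"
      unfolding L_def by (rule emeasure_restrict_space) (auto simp: space_restrict_space)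
    also have "(\<lambda>t. g (i, t)) -` A \<inter> space L = {t \<in> {0..1}. g (i, t) \<in> A}"
      by (auto simp: L_def space_restrict_space)
    finally show "(\<integral>\<^sup>+ t. d (i, t) * indicator (g -` A \<inter> space M) (i, t) \<partial>L) =
        ennreal (dist (vtx vs i) (vtx vs (Suc i))) * emeasure lborel {t \<in> {0..1}. g (i, t) \<in> A}" .
  qed
  finally show ?thesis by (simp add: g_def n_def)
qed

section \<open>The single table setting\<close>

text \<open>For the constant pair, the signs are forgotten by applying \<^const>\<open>snd\<close> to tagged points. In
  particular, \<open>critical_single\<close> identifies the two copies of each critical point.\<close>

definition phi_single :: "point list \<Rightarrow> point \<times> point \<Rightarrow> point \<times> point" where
  "phi_single vs = (\<lambda>(x, y). (y, next_point vs vs x y))"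

definition phase_single :: "point list \<Rightarrow> (point \<times> point) set" where
  "phase_single vs = map_prod snd snd ` phase_space (\<lambda>_. vs)"

definition critical_single :: "point list \<Rightarrow> point set" where
  "critical_single vs = snd ` critical (\<lambda>_. vs)"

end

theory Submission
  imports Defs
begin

text \<open>
  The move from \<open>x\<^sub>k\<close> to \<open>x\<^sub>k\<^sub>+\<^sub>2\<close> depends on \<open>x\<^sub>k\<^sub>+\<^sub>1\<close> only through the direction of its edge. Hence the
  orbits sharing the sequence of edges (the itinerary) of a given orbit form a rectangle, and along
  them the even and the odd points move affinely and independently. The billiard map preserves the
  area form, so that the rectangles visited by an orbit all have the same positive area as soon as one
  of them is nondegenerate, and they are equal or disjoint. So the itinerary is eventually periodic,
  and then an affine self-map of a bounded interval, whose square must be the identity, closes the orbit.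

  A point whose itinerary deviates from that of a neighbour is separated from it by a critical
  point. If the entries of a phase point are not limit points of critical points, its rectangle is
  therefore nondegenerate. If there are finitely many critical points, each rectangle is determined
  by a pair of them, its corner, and counting corners bounds the period.
\<close>

section \<open>Planar polygons\<close>

text \<open>The constants come from parity and from one possible flip. An orbit can be closed only
  along an even itinerary period, because the recursion links points two steps apart, and a second
  turn is needed when the affine return map reverses an interval. Corners with their sign number at
  most twice the product of the two critical counts; the second turn gives the factor 4. In a single
  table consecutive corners lie on transversal edges, hence differ, which removes the diagonal
  pairs. An odd itinerary period there costs a further factor 2. It is regained by showing that no
  visited corner is also visited with its entries exchanged. A phase point may itself have critical
  entries, since criticality can come from a different partner. So only parameters other than that
  of the orbit are tested against the critical set, and corners are taken strictly to the left of
  the orbit. For the measure statement the critical set is replaced by a countable set: all points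
  that some finite choice of edge directions sends to a vertex.\<close>

definition cross2 :: "point \<Rightarrow> point \<Rightarrow> real" where
  "cross2 a b = a $ 1 * b $ 2 - a $ 2 * b $ 1"

lemma cross2_simps [simp]:
  "cross2 a a = 0" "cross2 0 a = 0" "cross2 a 0 = 0"
  "cross2 (c *\<^sub>R a) b = c * cross2 a b" "cross2 a (c *\<^sub>R b) = c * cross2 a b"
  "cross2 a (b + b') = cross2 a b + cross2 a b'" "cross2 a (b - b') = cross2 a b - cross2 a b'"
  "cross2 (a + a') b = cross2 a b + cross2 a' b" "cross2 (a - a') b = cross2 a b - cross2 a' b"
  "cross2 (- a) b = - cross2 a b" "cross2 a (- b) = - cross2 a b"
  by (simp_all add: cross2_def algebra_simps)

lemma cross2_commute: "cross2 b a = - cross2 a b"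
  by (simp add: cross2_def)

lemma vec2_eq_iff: "a = b \<longleftrightarrow> a $ 1 = b $ 1 \<and> a $ 2 = b $ 2" for a b :: point
  by (simp add: vec_eq_iff forall_2)

lemma cross2_eq_0_iff:
  assumes "d \<noteq> 0"
  shows "cross2 d z = 0 \<longleftrightarrow> (\<exists>c. z = c *\<^sub>R d)"
proof
  assume *: "cross2 d z = 0"
  from assms consider "d $ 1 \<noteq> 0" | "d $ 2 \<noteq> 0" by (auto simp: vec2_eq_iff)
  then show "\<exists>c. z = c *\<^sub>R d"
  proof cases
    case 1
    with * have "z = (z $ 1 / d $ 1) *\<^sub>R d" by (simp add: vec2_eq_iff cross2_def field_simps)
    then show ?thesis ..
  next
    case 2
    with * have "z = (z $ 2 / d $ 2) *\<^sub>R d" by (simp add: vec2_eq_iff cross2_def field_simps)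
    then show ?thesis ..
  qed
qed auto

lemma continuous_on_cross2 [continuous_intros]:
  "continuous_on S f \<Longrightarrow> continuous_on S g \<Longrightarrow> continuous_on S (\<lambda>x. cross2 (f x) (g x))"
  unfolding cross2_def by (intro continuous_intros)

section \<open>Edges, vertices and the affine parameter of an edge\<close>

definition dir :: "point list \<Rightarrow> nat \<Rightarrow> point" where
  "dir vs i = vtx vs (Suc i) - vtx vs i"

text \<open>The unit interval parametrises every edge, whatever its length, so one bound serves for
  all parameters along an orbit.\<close>

definition edge_pt :: "point list \<Rightarrow> nat \<Rightarrow> real \<Rightarrow> point" where
  "edge_pt vs i t = vtx vs i + t *\<^sub>R dir vs i"

lemma closed_edge_eq:
  "closed_segment (vtx vs i) (vtx vs (Suc i)) = edge_pt vs i ` {0..1}"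
  by (force simp: in_segment edge_pt_def dir_def algebra_simps)

lemma edge_pt_0 [simp]: "edge_pt vs i 0 = vtx vs i"
  and edge_pt_1 [simp]: "edge_pt vs i 1 = vtx vs (Suc i)"
  by (simp_all add: edge_pt_def dir_def)

lemma edge_pt_diff: "edge_pt vs i s - edge_pt vs i t = (s - t) *\<^sub>R dir vs i"
  by (simp add: edge_pt_def algebra_simps)

context
  fixes vs :: "point list"
  assumes P: "is_polygon vs"
begin

lemma length_ge3: "3 \<le> length vs" and distinct_vertices: "distinct vs"
  using P by (auto simp: is_polygon_def)

lemma vtx_in: "vtx vs i \<in> set vs"
  using length_ge3 by (auto simp: vtx_def intro!: nth_mem mod_less_divisor)

lemma vtx_eq_iff: "i < length vs \<Longrightarrow> j < length vs \<Longrightarrow> vtx vs i = vtx vs j \<longleftrightarrow> i = j"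
  using distinct_vertices by (simp add: vtx_def nth_eq_iff_index_eq)

lemma vtx_length: "vtx vs (length vs) = vtx vs 0"
  by (simp add: vtx_def)

lemma vtx_Suc_neq: "vtx vs i \<noteq> vtx vs (Suc i)"
proof -
  have "i mod length vs \<noteq> Suc i mod length vs"
    using length_ge3 by (auto simp: mod_Suc)
  moreover have "0 < length vs" using length_ge3 by linarith
  ultimately show ?thesis
    unfolding vtx_def using distinct_vertices nth_eq_iff_index_eq mod_less_divisor by metis
qed

lemma dir_nonzero: "dir vs i \<noteq> 0"
  using vtx_Suc_neq[of i] by (simp add: dir_def)

lemma edge_eq: "edge vs i = edge_pt vs i ` {0<..<1}"
  using vtx_Suc_neq[of i] by (force simp: edge_def in_segment edge_pt_def dir_def algebra_simps)

lemma edge_pt_inj: "edge_pt vs i s = edge_pt vs i t \<longleftrightarrow> s = t"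
  using dir_nonzero[of i] by (simp add: edge_pt_def)

lemma edge_pt_in_edge: "edge_pt vs i t \<in> edge vs i \<longleftrightarrow> 0 < t \<and> t < 1"
  by (auto simp: edge_eq edge_pt_inj)

lemma edgeE:
  assumes "x \<in> edge vs i"
  obtains t where "0 < t" "t < 1" "x = edge_pt vs i t"
  using assms by (auto simp: edge_eq)

lemma edge_unique: "x \<in> edge vs i \<Longrightarrow> x \<in> edge vs j \<Longrightarrow> i < length vs \<Longrightarrow> j < length vs \<Longrightarrow> i = j"
  using P unfolding is_polygon_def by blast

lemma edge_not_vertex: "x \<in> edge vs i \<Longrightarrow> i < length vs \<Longrightarrow> x \<notin> set vs"
  using P unfolding is_polygon_def by blast

lemma closed_edge_eq_edge:
  "closed_segment (vtx vs i) (vtx vs (Suc i)) = edge vs i \<union> {vtx vs i, vtx vs (Suc i)}"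
  by (auto simp: edge_def open_segment_def)

lemma vertex_ex: "x \<in> set vs \<Longrightarrow> \<exists>i<length vs. x = vtx vs i"
  by (metis in_set_conv_nth vtx_def mod_less)

lemma curve_eq: "curve vs = set vs \<union> (\<Union>i<length vs. edge vs i)"
  unfolding curve_def closed_edge_eq_edge using vtx_in vertex_ex by auto

lemma curve_edgeE:
  assumes "x \<in> curve vs" "x \<notin> set vs"
  obtains i where "i < length vs" "x \<in> edge vs i"
  using assms curve_eq by auto

lemma edge_in_curve: "x \<in> edge vs i \<Longrightarrow> i < length vs \<Longrightarrow> x \<in> curve vs"
  using curve_eq by auto

lemma vertex_in_curve: "x \<in> set vs \<Longrightarrow> x \<in> curve vs"
  using curve_eq by auto

lemma edge_not_other_closed:
  assumes "x \<in> edge vs i" "i < length vs" "j < length vs" "i \<noteq> j"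
  shows "x \<notin> closed_segment (vtx vs j) (vtx vs (Suc j))"
  unfolding closed_edge_eq_edge
  using assms edge_unique edge_not_vertex vtx_in by blast

section \<open>The polygon as a Jordan curve\<close>

lemma closed_edges_Int:
  assumes "i < length vs" "j < length vs" "i \<noteq> j"
  shows "closed_segment (vtx vs i) (vtx vs (Suc i)) \<inter> closed_segment (vtx vs j) (vtx vs (Suc j))
    \<subseteq> {vtx vs i, vtx vs (Suc i)} \<inter> {vtx vs j, vtx vs (Suc j)}"
  using edge_not_other_closed[of _ i j] edge_not_other_closed[of _ j i] assms
  unfolding closed_edge_eq_edge by blast

primrec poly_path :: "nat \<Rightarrow> real \<Rightarrow> point" where
  "poly_path 0 = linepath (vtx vs 0) (vtx vs 1)"
| "poly_path (Suc k) = poly_path k +++ linepath (vtx vs (Suc k)) (vtx vs (Suc (Suc k)))"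

lemma poly_path_ends:
  "pathstart (poly_path k) = vtx vs 0" "pathfinish (poly_path k) = vtx vs (Suc k)"
  by (induction k) auto

lemma path_image_poly_path:
  "path_image (poly_path k) = (\<Union>i\<le>k. closed_segment (vtx vs i) (vtx vs (Suc i)))"
proof (induction k)
  case (Suc k)
  then show ?case
    by (simp add: path_image_join poly_path_ends atMost_Suc Un_commute)
qed simp

text \<open>As long as the closing edge is missing, a new edge meets the earlier ones only in its
  starting vertex: its end vertex has not occurred yet.\<close>

lemma arc_poly_path: "Suc k < length vs \<Longrightarrow> arc (poly_path k)"
proof (induction k)
  case 0
  then show ?case using vtx_Suc_neq[of 0] by (simp add: arc_linepath)
next
  case (Suc k)
  have "closed_segment (vtx vs i) (vtx vs (Suc i)) \<inter>
      closed_segment (vtx vs (Suc k)) (vtx vs (Suc (Suc k))) \<subseteq> {vtx vs (Suc k)}" if "i \<le> k" for i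
    using closed_edges_Int[of i "Suc k"] Suc.prems that
      vtx_eq_iff[of i "Suc (Suc k)"] vtx_eq_iff[of "Suc i" "Suc (Suc k)"] by auto
  then have "path_image (poly_path k) \<inter>
      path_image (linepath (vtx vs (Suc k)) (vtx vs (Suc (Suc k)))) \<subseteq> {vtx vs (Suc k)}"
    by (auto simp: path_image_poly_path)
  then show ?case
    using Suc vtx_Suc_neq[of "Suc k"]
    by (auto intro!: arc_join simp: arc_linepath poly_path_ends)
qed

text \<open>This is the form in which the Jordan-Brouwer theorems apply in \<open>point\<close>;
  simple closed paths yield the complex circle, which is then transferred.\<close>

lemma curve_homeomorphic_sphere: "curve vs homeomorphic sphere (0::point) 1"
proof -
  \<comment> \<open>Edge \<open>Suc m\<close> is the last one. It closes the arc through the edges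
    up to \<open>m\<close> and meets it in both of its ends.\<close>
  define m where "m = length vs - 2"
  have m: "length vs = Suc (Suc m)" using length_ge3 by (simp add: m_def)
  have loop: "vtx vs (Suc (Suc m)) = vtx vs 0" using vtx_length m by simp
  have im: "path_image (poly_path (Suc m)) = curve vs"
    unfolding path_image_poly_path curve_def m by (simp add: lessThan_Suc_atMost)
  have "closed_segment (vtx vs i) (vtx vs (Suc i)) \<inter>
      closed_segment (vtx vs (Suc m)) (vtx vs (Suc (Suc m))) \<subseteq> {vtx vs 0, vtx vs (Suc m)}"
    if "i \<le> m" for i
    using closed_edges_Int[of i "Suc m"] m that loop by auto
  then have sub: "path_image (poly_path m) \<inter>
      path_image (linepath (vtx vs (Suc m)) (vtx vs (Suc (Suc m)))) \<subseteq> {vtx vs 0, vtx vs (Suc m)}"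
    unfolding path_image_poly_path path_image_linepath by blast
  have "simple_path (poly_path (Suc m))"
    unfolding poly_path.simps
    using arc_poly_path[of m] m sub loop vtx_Suc_neq[of "Suc m"]
    by (intro simple_path_join_loop) (auto simp: arc_linepath poly_path_ends)
  then have "curve vs homeomorphic sphere (0::complex) 1"
    using homeomorphic_simple_path_image_circle[of "poly_path (Suc m)" 1 0] im loop
    by (simp add: poly_path_ends)
  also have "sphere (0::complex) 1 homeomorphic sphere (0::point) 1"
    by (rule homeomorphic_spheres_gen) auto
  finally show ?thesis .
qed

lemma compact_curve: "compact (curve vs)"
  unfolding curve_def by auto

lemma closed_curve: "closed (curve vs)" and bounded_curve: "bounded (curve vs)"
  using compact_curve compact_imp_closed compact_imp_bounded by auto

lemma open_regions: "open (inside (curve vs))" "open (outside (curve vs))"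
  using closed_curve open_inside open_outside by auto

text \<open>By Jordan-Brouwer every component of the complement has the whole curve as its frontier.
  The inside is nonempty because the complement is disconnected while the outside alone is
  connected.\<close>

lemma curve_accessible:
  assumes "x \<in> curve vs" "0 < r"
  shows "ball x r \<inter> inside (curve vs) \<noteq> {}" "ball x r \<inter> outside (curve vs) \<noteq> {}"
proof -
  have out: "connected (outside (curve vs))" "outside (curve vs) \<noteq> {}"
    using bounded_curve by (auto intro!: connected_outside outside_bounded_nonempty)
  have "\<not> connected (- curve vs)"
    using Jordan_Brouwer_separation[OF curve_homeomorphic_sphere] by simp
  then have "inside (curve vs) \<noteq> {}"
    using out inside_Un_outside[of "curve vs"] by force
  then obtain p where p: "p \<in> inside (curve vs)" by blast
  define K where "K = connected_component_set (- curve vs) p"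
  have K: "K \<in> components (- curve vs)" "K \<subseteq> inside (curve vs)"
    using p inside_same_component[of "curve vs" p]
    by (auto simp: K_def components_def inside_def)
  have "frontier K = curve vs"
    using K Jordan_Brouwer_frontier[OF curve_homeomorphic_sphere] by simp
  with assms have "ball x r \<inter> K \<noteq> {}"
    by (metis frontier_straddle disjoint_iff mem_ball dist_commute)
  with K show "ball x r \<inter> inside (curve vs) \<noteq> {}" by blast
  have "outside (curve vs) \<in> components (- curve vs)"
    using out outside_in_components by blast
  then have "frontier (outside (curve vs)) = curve vs"
    using Jordan_Brouwer_frontier[OF curve_homeomorphic_sphere] by simp
  with assms show "ball x r \<inter> outside (curve vs) \<noteq> {}"
    by (metis frontier_straddle disjoint_iff mem_ball dist_commute)
qed

section \<open>The two sides of an edge\<close>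

lemma connected_inside_or_outside:
  assumes "connected S" "S \<inter> curve vs = {}"
  shows "S \<subseteq> inside (curve vs) \<or> S \<subseteq> outside (curve vs)"
  using connectedD[OF assms(1) open_regions] assms(2) inside_Un_outside[of "curve vs"]
    inside_Int_outside[of "curve vs"] by blast

text \<open>The other closed edges form a closed set missing \<open>x\<close>, so near
  \<open>x\<close> the polygon is just the line of its own edge.\<close>

lemma edge_ball:
  assumes "x \<in> edge vs i" "i < length vs"
  obtains r where "0 < r"
    "\<And>p. p \<in> ball x r \<Longrightarrow> p \<in> curve vs \<longleftrightarrow> cross2 (dir vs i) (p - x) = 0"
    "\<And>p. p \<in> ball x r \<Longrightarrow> cross2 (dir vs i) (p - x) = 0 \<Longrightarrow> p \<in> edge vs i"
proof -
  define F where "F = (\<Union>j\<in>{..<length vs} - {i}. closed_segment (vtx vs j) (vtx vs (Suc j)))"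
  have "closed F" unfolding F_def by auto
  moreover have "x \<notin> F" using edge_not_other_closed assms by (auto simp: F_def)
  ultimately obtain r1 where r1: "0 < r1" "ball x r1 \<inter> F = {}"
    by (metis open_Compl ComplI open_contains_ball disjoint_eq_subset_Compl)
  obtain t where t: "0 < t" "t < 1" "x = edge_pt vs i t" using assms edgeE by blast
  \<comment> \<open>The second bound is the distance from \<open>x\<close> to the nearer end of its
    edge; it keeps points of the line inside the open edge.\<close>
  define r where "r = min r1 (min t (1 - t) * norm (dir vs i))"
  have "0 < r" using r1 t dir_nonzero by (simp add: r_def)
  have on: "p \<in> edge vs i" if p: "p \<in> ball x r" "cross2 (dir vs i) (p - x) = 0" for p
  proof -
    obtain c where c: "p - x = c *\<^sub>R dir vs i"
      using p cross2_eq_0_iff[OF dir_nonzero] by blast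
    then have "p = edge_pt vs i (t + c)"
      using t by (simp add: edge_pt_def algebra_simps)
    moreover have "\<bar>c\<bar> * norm (dir vs i) < min t (1 - t) * norm (dir vs i)"
      using p c by (simp add: r_def dist_norm norm_minus_commute)
    then have "\<bar>c\<bar> < min t (1 - t)" using dir_nonzero by simp
    ultimately show ?thesis by (auto simp: edge_pt_in_edge)
  qed
  moreover have "cross2 (dir vs i) (p - x) = 0" if p: "p \<in> ball x r" "p \<in> curve vs" for p
  proof -
    have "p \<notin> F" using p r1 by (auto simp: r_def)
    then have "p \<in> closed_segment (vtx vs i) (vtx vs (Suc i))"
      using p by (auto simp: F_def curve_def)
    then obtain s where "p = edge_pt vs i s" by (auto simp: closed_edge_eq)
    then show ?thesis using t by (simp add: edge_pt_diff)
  qed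
  ultimately show ?thesis
    using that[OF \<open>0 < r\<close>] edge_in_curve assms by blast
qed

lemma convex_half_plane: "convex {p. 0 < c * cross2 d (p - x)}"
proof -
  have "{p. 0 < c * cross2 d (p - x)} = {p. (vector [- c * d $ 2, c * d $ 1] :: point) \<bullet> p > c * cross2 d x}"
    by (auto simp: cross2_def inner_vec_def sum_2 algebra_simps)
  then show ?thesis by (simp add: convex_halfspace_gt)
qed

text \<open>Each open half disc is connected and misses the curve, so it lies in one region. Both
  regions accumulate at \<open>x\<close>, hence the halves lie in different ones; the sign of
  \<open>c\<close> tells which is which.\<close>

lemma half_disc_cases:
  assumes "x \<in> edge vs i" "i < length vs"
  obtains r c :: real where "0 < r" "c \<noteq> 0"
    "\<And>p. p \<in> ball x r \<Longrightarrow> 0 < c * cross2 (dir vs i) (p - x) \<Longrightarrow> p \<in> inside (curve vs)"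
    "\<And>p. p \<in> ball x r \<Longrightarrow> c * cross2 (dir vs i) (p - x) < 0 \<Longrightarrow> p \<in> outside (curve vs)"
proof -
  obtain r where r: "0 < r"
    and on: "\<And>p. p \<in> ball x r \<Longrightarrow> p \<in> curve vs \<longleftrightarrow> cross2 (dir vs i) (p - x) = 0"
    using edge_ball[OF assms] by metis
  define H where "H c = ball x r \<inter> {p. 0 < c * cross2 (dir vs i) (p - x)}" for c :: real
  have H: "H c \<subseteq> inside (curve vs) \<or> H c \<subseteq> outside (curve vs)" for c
  proof (rule connected_inside_or_outside)
    show "connected (H c)"
      unfolding H_def by (intro convex_connected convex_Int convex_ball convex_half_plane)
    show "H c \<inter> curve vs = {}" using on by (auto simp: H_def)
  qed
  have x: "x \<in> curve vs" using assms edge_in_curve by blast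
  have cov: "p \<in> H 1 \<or> p \<in> H (-1)" if "p \<in> ball x r" "p \<notin> curve vs" for p
    using on[OF that(1)] that by (auto simp: H_def)
  obtain p q where pq: "p \<in> ball x r" "p \<in> inside (curve vs)" "q \<in> ball x r" "q \<in> outside (curve vs)"
    using curve_accessible[OF x r] by blast
  then have "p \<in> H 1 \<or> p \<in> H (-1)" "q \<in> H 1 \<or> q \<in> H (-1)"
    using cov inside_no_overlap[of "curve vs"] outside_no_overlap[of "curve vs"] by blast+
  then consider "H 1 \<subseteq> inside (curve vs)" "H (-1) \<subseteq> outside (curve vs)"
    | "H (-1) \<subseteq> inside (curve vs)" "H 1 \<subseteq> outside (curve vs)"
    using pq H[of 1] H[of "-1"] inside_Int_outside[of "curve vs"] by blast
  then show ?thesis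
  proof cases
    case 1
    then show ?thesis using that[of r 1] r by (force simp: H_def)
  next
    case 2
    then show ?thesis using that[of r "-1"] r by (force simp: H_def)
  qed
qed

lemma two_sided:
  assumes "x \<in> edge vs i" "i < length vs" "cross2 d (dir vs i) \<noteq> 0"
  obtains r c :: real where "0 < r" "c = 1 \<or> c = - 1"
    "\<And>t. 0 < t \<Longrightarrow> t < r \<Longrightarrow> x + (c * t) *\<^sub>R d \<in> inside (curve vs)"
    "\<And>t. 0 < t \<Longrightarrow> t < r \<Longrightarrow> x - (c * t) *\<^sub>R d \<in> outside (curve vs)"
proof -
  obtain r c where r: "0 < r" "c \<noteq> 0"
    and ins: "\<And>p. p \<in> ball x r \<Longrightarrow> 0 < c * cross2 (dir vs i) (p - x) \<Longrightarrow> p \<in> inside (curve vs)"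
    and out: "\<And>p. p \<in> ball x r \<Longrightarrow> c * cross2 (dir vs i) (p - x) < 0 \<Longrightarrow> p \<in> outside (curve vs)"
    using half_disc_cases[OF assms(1,2)] by metis
  define b where "b = cross2 (dir vs i) d"
  \<comment> \<open>The sign that turns \<open>d\<close> towards the inner half disc.\<close>
  define c' where "c' = sgn (c * b)"
  have b: "b \<noteq> 0" using assms(3) cross2_commute[of d] by (simp add: b_def)
  have d: "d \<noteq> 0" using assms by auto
  have c': "c' = 1 \<or> c' = -1" using b r by (auto simp: c'_def sgn_real_def)
  have pos: "0 < c * c' * b"
    using b r by (auto simp: c'_def sgn_real_def mult_less_0_iff zero_less_mult_iff)
  have near: "x + (c' * t) *\<^sub>R d \<in> ball x r" "x - (c' * t) *\<^sub>R d \<in> ball x r"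
    if "0 < t" "t < r / norm d" for t
    using that c' d by (auto simp: dist_norm field_simps)
  show ?thesis
  proof (rule that[of "r / norm d" c'])
    fix t assume t: "0 < t" "t < r / norm d"
    have "0 < c * cross2 (dir vs i) ((x + (c' * t) *\<^sub>R d) - x)"
      using mult_pos_pos[OF pos t(1)] by (simp add: b_def mult_ac)
    then show "x + (c' * t) *\<^sub>R d \<in> inside (curve vs)" using ins near t by blast
    have "c * cross2 (dir vs i) ((x - (c' * t) *\<^sub>R d) - x) < 0"
      using mult_pos_pos[OF pos t(1)] by (simp add: b_def mult_ac)
    then show "x - (c' * t) *\<^sub>R d \<in> outside (curve vs)" using out near t by blast
  qed (use r d c' in auto)
qed

end

section \<open>Chords\<close>

text \<open>Symmetric in its two ends, which is what makes the dynamics reversible. That the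
  displacement is nonzero is expressed by \<open>x \<noteq> z\<close>.\<close>

definition chord :: "point list \<Rightarrow> point \<Rightarrow> point \<Rightarrow> point \<Rightarrow> bool" where
  "chord vs d x z \<longleftrightarrow> x \<in> curve vs \<and> z \<in> curve vs \<and> x \<noteq> z \<and> (\<exists>c. z = x + c *\<^sub>R d) \<and>
     open_segment x z \<subseteq> inside (curve vs)"

lemma chord_sym: "chord vs d x z \<Longrightarrow> chord vs d z x"
proof -
  assume ch: "chord vs d x z"
  then obtain c where "z = x + c *\<^sub>R d" by (auto simp: chord_def)
  then have "x = z + (- c) *\<^sub>R d" by simp
  with ch show "chord vs d z x" unfolding chord_def by (metis open_segment_commute)
qed

lemma chord_cross: "chord vs d x z \<Longrightarrow> cross2 d (z - x) = 0"
  by (auto simp: chord_def)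

lemma chord_curve: "chord vs d x z \<Longrightarrow> x \<in> curve vs" "chord vs d x z \<Longrightarrow> z \<in> curve vs"
  by (auto simp: chord_def)

context
  fixes vs :: "point list"
  assumes P: "is_polygon vs"
begin

text \<open>A chord parallel to the edge of \<open>x\<close> would start along the line of that
  edge, which near \<open>x\<close> belongs to the curve and not to the inside.\<close>

lemma chord_transversal:
  assumes "chord vs d x z" "x \<in> edge vs i" "i < length vs"
  shows "cross2 d (dir vs i) \<noteq> 0"
proof
  assume 0: "cross2 d (dir vs i) = 0"
  obtain c where z: "z = x + c *\<^sub>R d" "x \<noteq> z" and ins: "open_segment x z \<subseteq> inside (curve vs)"
    using assms by (auto simp: chord_def)
  obtain r where r: "0 < r"
    "\<And>p. p \<in> ball x r \<Longrightarrow> p \<in> curve vs \<longleftrightarrow> cross2 (dir vs i) (p - x) = 0"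
    using edge_ball[OF P assms(2,3)] by metis
  define u where "u = min (1/2) (r / (2 * dist x z))"
  have u: "0 < u" "u < 1" "u * dist x z < r"
  proof -
    have pos: "0 < dist x z" using z by simp
    show "0 < u" "u < 1" using r z pos by (auto simp: u_def)
    have "u * dist x z \<le> r / (2 * dist x z) * dist x z"
      using pos by (intro mult_right_mono) (auto simp: u_def)
    also have "\<dots> < r" using pos r by simp
    finally show "u * dist x z < r" .
  qed
  define p where "p = x + (u * c) *\<^sub>R d"
  have "p = (1 - u) *\<^sub>R x + u *\<^sub>R z" by (simp add: p_def z algebra_simps)
  then have "p \<in> open_segment x z" using u z by (auto simp: in_segment)
  then have "p \<notin> curve vs" using ins inside_no_overlap[of "curve vs"] by blast
  moreover have "p \<in> ball x r"
    using u z by (simp add: p_def dist_norm abs_mult)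
  moreover have "cross2 (dir vs i) (p - x) = 0"
    using 0 cross2_commute[of d] by (simp add: p_def)
  ultimately show False using r by blast
qed

text \<open>Both chords leave \<open>x\<close> on the inner side, hence along the same ray; the
  longer one would contain the end of the shorter one, a point of the curve.\<close>

lemma chord_unique:
  assumes "chord vs d x z" "chord vs d x z'" "x \<in> edge vs i" "i < length vs"
  shows "z = z'"
proof -
  obtain r c where r: "0 < r" and c: "c = 1 \<or> c = - 1"
    and out: "\<And>t. 0 < t \<Longrightarrow> t < r \<Longrightarrow> x - (c * t) *\<^sub>R d \<in> outside (curve vs)"
    using two_sided[OF P assms(3,4) chord_transversal[OF assms(1,3,4)]] by metis
  have pos: "0 < c * a" if "chord vs d x (x + a *\<^sub>R d)" for a
  proof (rule ccontr)
    assume "\<not> 0 < c * a"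
    moreover have a: "a \<noteq> 0" using that by (auto simp: chord_def)
    ultimately have neg: "a = - c * \<bar>a\<bar>" using c by (auto simp: zero_less_mult_iff)
    define u where "u = min (1/2) (r / (2 * \<bar>a\<bar>))"
    have u: "0 < u" "u < 1" using r a by (auto simp: u_def)
    have "u * \<bar>a\<bar> \<le> r / (2 * \<bar>a\<bar>) * \<bar>a\<bar>"
      by (intro mult_right_mono) (auto simp: u_def)
    also have "\<dots> < r" using a r by simp
    finally have "x - (c * (u * \<bar>a\<bar>)) *\<^sub>R d \<in> outside (curve vs)"
      using u a by (intro out) auto
    then have out': "x - (c * (u * \<bar>a\<bar>)) *\<^sub>R d \<in> outside (curve vs)" .
    have eq: "u * a = - (c * (u * \<bar>a\<bar>))" by (subst (1) neg) simp
    have "x - (c * (u * \<bar>a\<bar>)) *\<^sub>R d = x + (u * a) *\<^sub>R d" by (simp only: eq) simp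
    also have "\<dots> = (1 - u) *\<^sub>R x + u *\<^sub>R (x + a *\<^sub>R d)" by (simp add: algebra_simps)
    also have "\<dots> \<in> inside (curve vs)"
      using that u by (force simp: chord_def in_segment)
    finally show False using out' inside_Int_outside by blast
  qed
  obtain a b where ab: "z = x + a *\<^sub>R d" "z' = x + b *\<^sub>R d"
    using assms by (auto simp: chord_def)
  have sgn: "0 < c * a" "0 < c * b" using pos assms ab by auto
  have le: "\<bar>b\<bar> \<le> \<bar>a\<bar>" if ch: "chord vs d x (x + a *\<^sub>R d)" "chord vs d x (x + b *\<^sub>R d)" for a b
  proof (rule ccontr)
    assume less: "\<not> \<bar>b\<bar> \<le> \<bar>a\<bar>"
    have "0 < c * a" "0 < c * b" using pos ch by auto
    with less c have "0 < a / b" "a / b < 1" by (auto simp: field_simps)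
    moreover have "x + a *\<^sub>R d = (1 - a / b) *\<^sub>R x + (a / b) *\<^sub>R (x + b *\<^sub>R d)"
      using less by (simp add: algebra_simps)
    ultimately have "x + a *\<^sub>R d \<in> open_segment x (x + b *\<^sub>R d)"
      using ch by (auto simp: in_segment chord_def)
    then show False
      using ch inside_no_overlap[of "curve vs"] unfolding chord_def by blast
  qed
  have "\<bar>a\<bar> = \<bar>b\<bar>" using le[of a b] le[of b a] assms ab by auto
  with sgn c have "a = b" by auto
  with ab show ?thesis by simp
qed

text \<open>Follow the inward ray up to its first hit with the curve. There is one because the
  inside is bounded.\<close>

lemma chord_ex:
  assumes "x \<in> edge vs i" "i < length vs" "cross2 d (dir vs i) \<noteq> 0"
  obtains z where "chord vs d x z"
proof -
  obtain r c where r: "0 < r" and c: "c = 1 \<or> c = - 1"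
    and ins: "\<And>t. 0 < t \<Longrightarrow> t < r \<Longrightarrow> x + (c * t) *\<^sub>R d \<in> inside (curve vs)"
    using two_sided[OF P assms] by metis
  define g where "g t = x + (c * t) *\<^sub>R d" for t
  have d: "d \<noteq> 0" using assms by auto
  have cont: "continuous_on S g" for S unfolding g_def by (intro continuous_intros)
  have conn: "g ` S \<subseteq> inside (curve vs)" if "connected S" "r / 2 \<in> S" "g ` S \<inter> curve vs = {}" for S
  proof -
    have "connected (g ` S)" using that cont connected_continuous_image by blast
    with connected_inside_or_outside[OF P] that
    have "g ` S \<subseteq> inside (curve vs) \<or> g ` S \<subseteq> outside (curve vs)" by blast
    moreover have "g (r/2) \<in> inside (curve vs)" unfolding g_def using r by (intro ins) auto
    ultimately show ?thesis using that(2) inside_Int_outside[of "curve vs"] by blast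
  qed
  \<comment> \<open>Starting at \<open>r / 2\<close>, which is known to be inside, keeps
    \<open>x\<close> itself out of \<open>S\<close> without spoiling closedness.\<close>
  define S where "S = {t. r / 2 \<le> t \<and> g t \<in> curve vs}"
  have "S \<noteq> {}"
  proof
    assume "S = {}"
    then have "g ` {r/2..} \<subseteq> inside (curve vs)"
      by (intro conn) (auto simp: S_def)
    moreover obtain B where B: "\<And>p. p \<in> inside (curve vs) \<Longrightarrow> norm p \<le> B"
      using bounded_inside[OF bounded_curve[OF P]] by (auto simp: bounded_iff)
    \<comment> \<open>So far along the ray that \<open>norm (g t)\<close> must exceed the bound
      \<open>B\<close> of the inside.\<close>
    define t where "t = r / 2 + (\<bar>B\<bar> + norm x + 1) / norm d"
    have t: "r / 2 \<le> t" using d by (simp add: t_def)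
    then have "g t \<in> g ` {r/2..}" by simp
    ultimately have "norm (g t) \<le> B" using B by blast
    moreover have "norm ((c * t) *\<^sub>R d) \<le> norm (g t) + norm x"
      unfolding g_def by (metis add_diff_cancel_left' norm_triangle_ineq4)
    moreover have "norm ((c * t) *\<^sub>R d) = r / 2 * norm d + (\<bar>B\<bar> + norm x + 1)"
    proof -
      have "norm ((c * t) *\<^sub>R d) = t * norm d" using c r t by (auto simp: abs_mult)
      also have "\<dots> = r / 2 * norm d + (\<bar>B\<bar> + norm x + 1)"
        using d by (simp add: t_def field_simps)
      finally show ?thesis .
    qed
    moreover have "0 \<le> r / 2 * norm d" using r by simp
    ultimately show False by linarith
  qed
  moreover have "closed S"
  proof -
    have "S = {r/2..} \<inter> g -` curve vs" by (auto simp: S_def)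
    then show ?thesis
      using closed_curve[OF P] cont continuous_closed_preimage[of "{r/2..}" g "curve vs"] by simp
  qed
  moreover have bdd: "bdd_below S" by (rule bdd_belowI[of _ "r / 2"]) (simp add: S_def)
  ultimately have "Inf S \<in> S" using closed_contains_Inf by blast
  define t0 where "t0 = Inf S"
  have t0: "r / 2 \<le> t0" "g t0 \<in> curve vs" using \<open>Inf S \<in> S\<close> by (auto simp: t0_def S_def)
  have before: "t \<notin> S" if "t < t0" for t
    using that cInf_lower[OF _ bdd] unfolding t0_def by force
  have inside_before: "g t \<in> inside (curve vs)" if "0 < t" "t < t0" for t
  proof (cases "t < r")
    case True
    then show ?thesis using that ins by (simp add: g_def)
  next
    case False
    with that r have "g ` {r/2..t} \<subseteq> inside (curve vs)"
      using before by (intro conn) (auto simp: S_def)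
    then show ?thesis using False r by auto
  qed
  have "chord vs d x (g t0)"
    unfolding chord_def
  proof (intro conjI)
    show "x \<in> curve vs" using assms edge_in_curve[OF P] by blast
    show "g t0 \<in> curve vs" by fact
    show "x \<noteq> g t0" using c d r t0 by (auto simp: g_def)
    show "\<exists>c. g t0 = x + c *\<^sub>R d" by (auto simp: g_def)
    show "open_segment x (g t0) \<subseteq> inside (curve vs)"
    proof
      fix p assume "p \<in> open_segment x (g t0)"
      then obtain u where u: "0 < u" "u < 1" "p = (1 - u) *\<^sub>R x + u *\<^sub>R g t0"
        by (auto simp: in_segment)
      then have "p = g (u * t0)" by (simp add: g_def algebra_simps)
      moreover have "0 < t0" using r t0 by linarith
      ultimately show "p \<in> inside (curve vs)" using inside_before u by simp
    qed
  qed
  then show ?thesis by (rule that)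
qed

text \<open>The line of a chord is transversal to the edge and therefore meets it only once.\<close>

lemma chord_edges_neq:
  assumes "chord vs d x z" "x \<in> edge vs i" "z \<in> edge vs i" "i < length vs"
  shows False
proof -
  have tr: "cross2 d (dir vs i) \<noteq> 0" using chord_transversal assms by blast
  obtain s t where "x = edge_pt vs i s" "z = edge_pt vs i t"
    using edgeE[OF P] assms by metis
  then have "cross2 d (z - x) = (t - s) * cross2 d (dir vs i)" by (simp add: edge_pt_diff)
  with tr chord_cross[OF assms(1)] have "s = t" by simp
  with \<open>x = _\<close> \<open>z = _\<close> assms(1) show False by (simp add: chord_def)
qed

text \<open>Away from the two edges carrying its ends, a chord has positive distance to the polygon,
  so it can be moved parallel to itself.\<close>

lemma chord_stable:
  assumes ch: "chord vs d x z" and x: "x \<in> edge vs i" "i < length vs"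
    and z: "z \<in> edge vs j" "j < length vs"
  shows "\<forall>\<^sub>F x' in at x within edge vs i. \<exists>z'\<in>edge vs j. chord vs d x' z'"
proof -
  define F where "F = (\<Union>k\<in>{..<length vs} - {i, j}. closed_segment (vtx vs k) (vtx vs (Suc k)))"
  have tri: "cross2 d (dir vs i) \<noteq> 0" using chord_transversal ch x by blast
  have trj: "cross2 d (dir vs j) \<noteq> 0" using chord_transversal chord_sym[OF ch] z by blast
  have ins: "open_segment x z \<subseteq> inside (curve vs)" "x \<noteq> z" using ch by (auto simp: chord_def)
  have Fc: "F \<subseteq> curve vs" by (auto simp: F_def curve_def)
  have "closed_segment x z \<inter> F = {}"
  proof -
    have "open_segment x z \<inter> F = {}" using ins Fc inside_no_overlap by blast
    moreover have "x \<notin> F" "z \<notin> F"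
      using edge_not_other_closed[OF P x] edge_not_other_closed[OF P z] by (auto simp: F_def)
    ultimately show ?thesis by (auto simp: closed_segment_eq_open)
  qed
  moreover have "closed F" by (auto simp: F_def)
  ultimately obtain \<delta> where \<delta>: "0 < \<delta>" "\<And>p q. p \<in> closed_segment x z \<Longrightarrow> q \<in> F \<Longrightarrow> \<delta> \<le> dist p q"
    using separate_compact_closed[of "closed_segment x z" F] by auto
  \<comment> \<open>\<open>Z p\<close> is the point where the line through \<open>p\<close> in
    direction \<open>d\<close> meets the line of edge \<open>j\<close>.\<close>
  define Z where "Z p = p + (cross2 (z - p) (dir vs j) / cross2 d (dir vs j)) *\<^sub>R d" for p
  have "(cross2 (z - x) (dir vs j) / cross2 d (dir vs j)) *\<^sub>R d = z - x"
  proof -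
    obtain c where "z = x + c *\<^sub>R d" using ch by (auto simp: chord_def)
    then show ?thesis using trj by simp
  qed
  then have Zx: "Z x = z" by (simp add: Z_def)
  have Zc: "cross2 (dir vs j) (Z p - z) = 0" for p
    using trj cross2_commute[of "dir vs j"] by (simp add: Z_def field_simps)
  have Zlim: "(Z \<longlongrightarrow> z) (at x within edge vs i)"
  proof -
    have "continuous_on UNIV Z" unfolding Z_def by (intro continuous_intros) (use trj in auto)
    then have "continuous (at x within edge vs i) Z"
      by (simp add: continuous_on_eq_continuous_at continuous_at_imp_continuous_at_within)
    then show ?thesis using Zx by (simp add: continuous_within)
  qed
  have idlim: "((\<lambda>p. p) \<longlongrightarrow> x) (at x within edge vs i)" by (rule tendsto_ident_at)
  obtain r where r: "0 < r"
    "\<And>p. p \<in> ball z r \<Longrightarrow> cross2 (dir vs j) (p - z) = 0 \<Longrightarrow> p \<in> edge vs j"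
    using edge_ball[OF P z] by metis
  have "(1 - 1/2) *\<^sub>R x + (1/2) *\<^sub>R z \<in> open_segment x z"
    unfolding in_segment using ins by (intro conjI exI[of _ "1/2"]) auto
  then have mid: "(1 - 1/2) *\<^sub>R x + (1/2) *\<^sub>R z \<in> inside (curve vs)" using ins by blast
  have "((\<lambda>p. (1 - 1/2) *\<^sub>R p + (1/2) *\<^sub>R Z p) \<longlongrightarrow> (1 - 1/2) *\<^sub>R x + (1/2) *\<^sub>R z) (at x within edge vs i)"
    by (intro tendsto_intros idlim Zlim)
  \<comment> \<open>Once the moved segment is known to miss the curve, its midpoint decides in which
    region it lies.\<close>
  then have ev1: "\<forall>\<^sub>F p in at x within edge vs i. (1 - 1/2) *\<^sub>R p + (1/2) *\<^sub>R Z p \<in> inside (curve vs)"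
    using topological_tendstoD[OF _ open_regions(1)[OF P]] mid by blast
  have ev2: "\<forall>\<^sub>F p in at x within edge vs i. dist (Z p) z < min r \<delta>"
    using tendstoD[OF Zlim, of "min r \<delta>"] r \<delta> by simp
  have ev3: "\<forall>\<^sub>F p in at x within edge vs i. dist p x < \<delta>"
    using tendstoD[OF idlim \<delta>(1)] .
  have ev4: "\<forall>\<^sub>F p in at x within edge vs i. p \<in> edge vs i" by (simp add: eventually_at_filter)
  from ev1 ev2 ev3 ev4 show ?thesis
  proof eventually_elim
    case (elim p)
    have Zj: "Z p \<in> edge vs j" using r(2) Zc elim by (simp add: dist_commute)
    have ne: "i \<noteq> j"
    proof
      assume "i = j"
      with z have "z \<in> edge vs i" by simp
      with chord_edges_neq[OF ch x(1) _ x(2)] show False .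
    qed
    have pZ: "p \<noteq> Z p"
    proof
      assume "p = Z p"
      with Zj have "p \<in> edge vs j" by simp
      from edge_unique[OF P elim(4) this x(2) z(2)] ne show False by simp
    qed
    define c where "c = cross2 (z - p) (dir vs j) / cross2 d (dir vs j)"
    have Zp: "Z p = p + c *\<^sub>R d" by (simp add: Z_def c_def)
    have c: "c \<noteq> 0" using pZ Zp by auto
    \<comment> \<open>Edges \<open>i\<close> and \<open>j\<close> are excluded by transversality, as
      the segment has already met their lines at its ends; all other edges stay at distance at least
      \<delta> from the original chord.\<close>
    have off: "q \<notin> curve vs" if q: "q \<in> open_segment p (Z p)" for q
    proof
      obtain u where u: "0 < u" "u < 1" "q = (1 - u) *\<^sub>R p + u *\<^sub>R Z p"
        using q unfolding in_segment(2) by blast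
      assume "q \<in> curve vs"
      then obtain k where k: "k < length vs" "q \<in> closed_segment (vtx vs k) (vtx vs (Suc k))"
        by (auto simp: curve_def)
      then obtain s where s: "q = edge_pt vs k s" by (auto simp: closed_edge_eq)
      consider "k = i" | "k = j" | "k \<noteq> i" "k \<noteq> j" by blast
      then show False
      proof cases
        case 1
        obtain s' where "p = edge_pt vs i s'" using elim edgeE[OF P] by metis
        then have 0: "cross2 (q - p) (dir vs i) = 0" unfolding s 1 by (simp only: edge_pt_diff) simp
        have "q - p = (u * c) *\<^sub>R d" using u Zp by (simp add: algebra_simps)
        with 0 have "(u * c) * cross2 d (dir vs i) = 0" by (simp only: cross2_simps)
        then show False using u c tri by simp
      next
        case 2
        obtain s' where "Z p = edge_pt vs j s'" using Zj edgeE[OF P] by metis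
        then have 0: "cross2 (q - Z p) (dir vs j) = 0" unfolding s 2 by (simp only: edge_pt_diff) simp
        have "q - Z p = ((u - 1) * c) *\<^sub>R d" using u Zp by (simp add: algebra_simps)
        with 0 have "((u - 1) * c) * cross2 d (dir vs j) = 0" by (simp only: cross2_simps)
        then show False using u c trj by simp
      next
        case 3
        then have qF: "q \<in> F" using k by (auto simp: F_def)
        define q' where "q' = (1 - u) *\<^sub>R x + u *\<^sub>R z"
        have "q' \<in> closed_segment x z" unfolding q'_def in_segment(1) using u(1,2) by (intro exI[of _ u]) simp
        then have far: "\<delta> \<le> dist q' q" using \<delta> qF by blast
        have "q' - q = (1 - u) *\<^sub>R (x - p) + u *\<^sub>R (z - Z p)"
          using u by (simp add: q'_def algebra_simps)
        then have "dist q' q \<le> (1 - u) * dist p x + u * dist (Z p) z"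
          using u norm_triangle_ineq[of "(1 - u) *\<^sub>R (x - p)" "u *\<^sub>R (z - Z p)"]
          by (simp add: dist_norm norm_minus_commute)
        also have "\<dots> < (1 - u) * \<delta> + u * \<delta>"
          using u elim by (intro add_strict_mono mult_strict_left_mono) auto
        finally show False using far by (simp add: algebra_simps)
      qed
    qed
    have "open_segment p (Z p) \<subseteq> inside (curve vs) \<or> open_segment p (Z p) \<subseteq> outside (curve vs)"
      using off by (intro connected_inside_or_outside[OF P] convex_connected[OF convex_open_segment]) blast
    moreover have "(1 - 1/2) *\<^sub>R p + (1/2) *\<^sub>R Z p \<in> open_segment p (Z p)"
      unfolding in_segment using pZ by (intro conjI exI[of _ "1/2"]) auto
    ultimately have "open_segment p (Z p) \<subseteq> inside (curve vs)"
      using elim(1) inside_Int_outside[of "curve vs"] by blast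
    moreover have "p \<in> curve vs" "Z p \<in> curve vs"
      using elim(4) Zj x z edge_in_curve[OF P] by blast+
    ultimately have "chord vs d p (Z p)"
      unfolding chord_def using pZ Zp by blast
    with Zj show ?case by blast
  qed
qed

end

section \<open>The billiard map in terms of chords\<close>

lemma targets_iff_chord:
  assumes "is_polygon ws" "y \<in> edge ws e" "e < length ws" "x \<in> curve vs"
  shows "z \<in> targets vs ws x y \<longleftrightarrow> chord vs (dir ws e) x z"
proof -
  have "i \<in> {i. i < length ws \<and> y \<in> edge ws i} \<longleftrightarrow> i \<in> {e}" for i
    using edge_unique[OF assms(1), of y i e] assms(2,3) by (cases "i = e") auto
  then have "{i. i < length ws \<and> y \<in> edge ws i} = {e}" by (rule set_eqI)
  then have "tangent ws y = span {dir ws e}" by (simp add: tangent_def dir_def)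
  then have tangent: "v \<in> tangent ws y \<longleftrightarrow> (\<exists>c. v = c *\<^sub>R dir ws e)" for v
    by (auto simp: span_singleton)
  have "z \<in> {x + t | t. t \<in> tangent ws y \<and> t \<noteq> 0} \<longleftrightarrow> x \<noteq> z \<and> z - x \<in> tangent ws y"
  proof
    assume "x \<noteq> z \<and> z - x \<in> tangent ws y"
    then show "z \<in> {x + t | t. t \<in> tangent ws y \<and> t \<noteq> 0}"
      by (intro CollectI exI[of _ "z - x"]) auto
  qed auto
  also have "z - x \<in> tangent ws y \<longleftrightarrow> (\<exists>c. z = x + c *\<^sub>R dir ws e)"
    unfolding tangent by (simp add: algebra_simps)
  finally show ?thesis using assms(4) unfolding targets_def chord_def by simp
qed

text \<open>Away from vertices a transversal direction has exactly one chord, so condition A reduces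
  to a determinant that depends on the two edges only.\<close>

lemma condition_A_iff:
  assumes "is_polygon vs" "is_polygon ws" "x \<in> edge vs i" "i < length vs" "y \<in> edge ws e" "e < length ws"
  shows "condition_A vs ws x y \<longleftrightarrow> cross2 (dir ws e) (dir vs i) \<noteq> 0"
proof -
  note t = targets_iff_chord[OF assms(2,5,6) edge_in_curve[OF assms(1,3,4)]]
  show ?thesis
    unfolding condition_A_def t
  proof
    assume "y \<notin> set ws \<and> (\<exists>!z. chord vs (dir ws e) x z)"
    then show "cross2 (dir ws e) (dir vs i) \<noteq> 0"
      using chord_transversal[OF assms(1) _ assms(3,4)] by blast
  next
    assume "cross2 (dir ws e) (dir vs i) \<noteq> 0"
    then obtain z where "chord vs (dir ws e) x z" using chord_ex[OF assms(1,3,4)] by blast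
    then show "y \<notin> set ws \<and> (\<exists>!z. chord vs (dir ws e) x z)"
      using chord_unique[OF assms(1) _ _ assms(3,4)] edge_not_vertex[OF assms(2,5,6)] by blast
  qed
qed

lemma chord_next_point:
  assumes "is_polygon ws" "condition_A vs ws x y" "x \<in> curve vs" "y \<in> edge ws e" "e < length ws"
  shows "chord vs (dir ws e) x (next_point vs ws x y)"
proof -
  have "\<exists>!z. z \<in> targets vs ws x y" using assms(2) by (simp add: condition_A_def)
  from theI'[OF this] have "next_point vs ws x y \<in> targets vs ws x y" by (simp add: next_point_def)
  then show ?thesis using targets_iff_chord[OF assms(1,4,5,3)] by simp
qed

lemma next_point_eq:
  assumes "is_polygon vs" "is_polygon ws" "x \<in> edge vs i" "i < length vs" "y \<in> edge ws e" "e < length ws"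
    "chord vs (dir ws e) x z"
  shows "next_point vs ws x y = z"
  unfolding next_point_def
proof (rule the_equality)
  note t = targets_iff_chord[OF assms(2,5,6) edge_in_curve[OF assms(1,3,4)]]
  show "z \<in> targets vs ws x y" using t assms(7) by simp
  show "z' = z" if "z' \<in> targets vs ws x y" for z'
    using that t chord_unique[OF assms(1) _ assms(7,3,4)] by simp
qed

section \<open>Itineraries\<close>

text \<open>Indexing tables by time lets orbits be shifted by any number of steps without tracking
  signs. Period two also covers the constant sequence of a single table.\<close>

definition alternating :: "(nat \<Rightarrow> point list) \<Rightarrow> bool" where
  "alternating U \<longleftrightarrow> (\<forall>k. is_polygon (U k) \<and> U (Suc (Suc k)) = U k)"

definition orbit_in :: "(nat \<Rightarrow> point list) \<Rightarrow> (nat \<Rightarrow> nat) \<Rightarrow> (nat \<Rightarrow> point) \<Rightarrow> bool" where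
  "orbit_in U e x \<longleftrightarrow> (\<forall>k. e k < length (U k) \<and> x k \<in> edge (U k) (e k) \<and>
     chord (U k) (dir (U (Suc k)) (e (Suc k))) (x k) (x (Suc (Suc k))))"

abbreviation (input) shift :: "nat \<Rightarrow> (nat \<Rightarrow> 'a) \<Rightarrow> nat \<Rightarrow> 'a" where
  "shift j f \<equiv> \<lambda>k. f (j + k)"

lemma alternating_shift: "alternating U \<Longrightarrow> alternating (shift j U)"
  by (simp add: alternating_def)

lemma alternating_polygon: "alternating U \<Longrightarrow> is_polygon (U k)"
  by (simp add: alternating_def)

lemma alternating_add_even: "alternating U \<Longrightarrow> even n \<Longrightarrow> U (k + n) = U k"
proof (induction n rule: less_induct)
  case (less n)
  then show ?case
    by (cases n rule: nat.exhaust; cases "n - 1") (auto simp: alternating_def)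
qed

lemma alternating_shift_even: "alternating U \<Longrightarrow> even j \<Longrightarrow> shift j U = U"
  using alternating_add_even[of U j] by (simp add: add.commute fun_eq_iff)

lemma orbit_inD:
  assumes "orbit_in U e x"
  shows "e k < length (U k)" "x k \<in> edge (U k) (e k)"
    "chord (U k) (dir (U (Suc k)) (e (Suc k))) (x k) (x (Suc (Suc k)))"
  using assms by (auto simp: orbit_in_def)

lemma orbit_in_shift: "orbit_in U e x \<Longrightarrow> orbit_in (shift j U) (shift j e) (shift j x)"
  by (simp add: orbit_in_def)

text \<open>Points of different parity interact only through their edges, which the itinerary fixes.
  The sequence \<open>y\<close> starts at time 1, whence the index \<open>k - 1\<close>.\<close>

lemma orbit_in_interleave_Suc:
  assumes "orbit_in U e x" "orbit_in (shift 1 U) (shift 1 e) y"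
  shows "orbit_in U e (\<lambda>k. if even k then x k else y (k - 1))"
  unfolding orbit_in_def
proof
  fix k
  show "e k < length (U k) \<and>
    (if even k then x k else y (k - 1)) \<in> edge (U k) (e k) \<and>
    chord (U k) (dir (U (Suc k)) (e (Suc k))) (if even k then x k else y (k - 1))
      (if even (Suc (Suc k)) then x (Suc (Suc k)) else y (Suc (Suc k) - 1))"
    using orbit_inD[OF assms(1), of k] orbit_inD[OF assms(2), of "k - 1"]
    by (cases k) auto
qed

text \<open>A point determines its edge, so agreement of two consecutive points forces the edges to
  agree, then the direction of the next chord and its end.\<close>

lemma orbit_in_agree:
  assumes U: "alternating U" and x: "orbit_in U e x" and y: "orbit_in U f y"
    and start: "x 0 = y 0" "x 1 = y 1"
  shows "x k = y k" "e k = f k"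
proof -
  note P = alternating_polygon[OF U]
  have same_edge: "e k = f k" if "x k = y k" for k
    using edge_unique[OF P[of k], of "x k" "e k" "f k"] orbit_inD[OF x] orbit_inD[OF y] that by metis
  have "x k = y k \<and> x (Suc k) = y (Suc k)"
  proof (induction k)
    case 0
    then show ?case using start by simp
  next
    case (Suc k)
    then have "e (Suc k) = f (Suc k)" using same_edge by blast
    with Suc orbit_inD(3)[OF y, of k]
    have "chord (U k) (dir (U (Suc k)) (e (Suc k))) (x k) (y (Suc (Suc k)))" by simp
    with orbit_inD[OF x, of k] have "x (Suc (Suc k)) = y (Suc (Suc k))"
      using chord_unique[OF P] by blast
    with Suc show ?case by simp
  qed
  then show "x k = y k" "e k = f k" using same_edge by auto
qed

text \<open>This is the fact that a palindromic itinerary with a centre contradicts in the single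
  table setting.\<close>

lemma orbit_in_edge_neq:
  assumes "alternating U" "orbit_in U e x"
  shows "e (Suc (Suc k)) \<noteq> e k"
proof
  assume *: "e (Suc (Suc k)) = e k"
  have "U (Suc (Suc k)) = U k" using assms(1) by (simp add: alternating_def)
  with * orbit_inD(2)[OF assms(2), of "Suc (Suc k)"] have "x (Suc (Suc k)) \<in> edge (U k) (e k)" by simp
  with orbit_inD[OF assms(2), of k] show False
    using chord_edges_neq[OF alternating_polygon[OF assms(1)]] by blast
qed

lemma orbit_in_params:
  assumes "alternating U" "orbit_in U e x"
  obtains t where "\<And>k. 0 < t k" "\<And>k. t k < 1" "\<And>k. x k = edge_pt (U k) (e k) (t k)"
proof -
  have "\<exists>t. 0 < t \<and> t < 1 \<and> x k = edge_pt (U k) (e k) t" for k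
    using edgeE[OF alternating_polygon[OF assms(1)] orbit_inD(2)[OF assms(2)]] by metis
  then show ?thesis using that by metis
qed

text \<open>The density of the invariant area form with respect to the edge parameters at times
  \<open>k\<close> and \<open>k + 1\<close>.\<close>

definition angle :: "(nat \<Rightarrow> point list) \<Rightarrow> (nat \<Rightarrow> nat) \<Rightarrow> nat \<Rightarrow> real" where
  "angle U e k = cross2 (dir (U k) (e k)) (dir (U (Suc k)) (e (Suc k)))"

lemma angle_nonzero:
  assumes "alternating U" "orbit_in U e x"
  shows "angle U e k \<noteq> 0"
  using chord_transversal[OF alternating_polygon[OF assms(1)] orbit_inD(3,2,1)[OF assms(2)]]
  by (simp add: angle_def cross2_commute[of "dir (U k) (e k)"])

lemma angle_add_even:
  assumes "alternating U" "even n" "\<And>k. e (k + n) = e k"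
  shows "angle U e (k + n) = angle U e k"
  using alternating_add_even[OF assms(1,2), of k] alternating_add_even[OF assms(1,2), of "Suc k"]
    assms(3)[of k] assms(3)[of "Suc k"] by (simp add: angle_def)

definition billiard_rec :: "(nat \<Rightarrow> real) \<Rightarrow> (nat \<Rightarrow> real) \<Rightarrow> bool" where
  "billiard_rec w d \<longleftrightarrow> (\<forall>k. d (Suc (Suc k)) * w (Suc k) = - (d k * w k))"

text \<open>The recursion expresses that \<open>x\<^sub>k\<^sub>+\<^sub>2 - x\<^sub>k\<close> is parallel to the edge of \<open>x\<^sub>k\<^sub>+\<^sub>1\<close>.\<close>

lemma orbit_diff_rec:
  assumes U: "alternating U" and x: "orbit_in U e x" and y: "orbit_in U e y"
    and t: "\<And>k. x k = edge_pt (U k) (e k) (t k)" and s: "\<And>k. y k = edge_pt (U k) (e k) (s k)"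
  shows "billiard_rec (angle U e) (\<lambda>k. s k - t k)"
  unfolding billiard_rec_def
proof
  fix k
  let ?d = "\<lambda>k. dir (U k) (e k)"
  have *: "y k - x k = (s k - t k) *\<^sub>R ?d k" for k by (simp add: s t edge_pt_diff)
  have "cross2 (?d (Suc k)) ((y (Suc (Suc k)) - x (Suc (Suc k))) - (y k - x k)) = 0"
    using chord_cross[OF orbit_inD(3)[OF x, of k]] chord_cross[OF orbit_inD(3)[OF y, of k]] by simp
  then show "(s (Suc (Suc k)) - t (Suc (Suc k))) * angle U e (Suc k) = - ((s k - t k) * angle U e k)"
    unfolding * by (simp add: angle_def cross2_commute[of "?d (Suc k)" "?d k"])
qed

subsection \<open>The linear recursion\<close>

lemma step2_invariant:
  fixes f :: "nat \<Rightarrow> 'a"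
  assumes "\<And>k. f (Suc (Suc k)) = f k" "even n"
  shows "f (k + n) = f k"
proof -
  have "f (k + 2 * m) = f k" for m by (induction m) (simp_all add: assms(1))
  with assms(2) show ?thesis by (auto elim!: evenE)
qed

text \<open>The conserved quantity is the area of the rectangle spanned by two orbits with the same
  itinerary; its signed version changes sign at every step.\<close>

lemma rec_energy:
  assumes "billiard_rec w d"
  shows "\<bar>d k * d (Suc k) * w k\<bar> = \<bar>d 0 * d 1 * w 0\<bar>"
proof (induction k)
  case (Suc k)
  have "d (Suc k) * d (Suc (Suc k)) * w (Suc k) = - (d k * d (Suc k) * w k)"
    using assms by (simp add: billiard_rec_def mult_ac)
  with Suc show ?case by simp
qed simp

lemma rec_nonzero:
  assumes "billiard_rec w d" "d 0 \<noteq> 0" "d 1 \<noteq> 0" "\<And>k. w k \<noteq> 0"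
  shows "d k \<noteq> 0"
proof -
  have "\<bar>d k * d (Suc k) * w k\<bar> \<noteq> 0"
    unfolding rec_energy[OF assms(1)] using assms(2-4) by simp
  then show ?thesis by auto
qed

text \<open>The area is fixed, while the other side and the angle are bounded above, so no side of
  the rectangle can shrink.\<close>

lemma rec_lower_bound:
  assumes "billiard_rec w d" "d 0 \<noteq> 0" "d 1 \<noteq> 0" "\<And>k. w k \<noteq> 0"
    "\<And>k. \<bar>w k\<bar> \<le> W" "\<And>k. \<bar>d k\<bar> \<le> B"
  obtains \<eta> :: real where "0 < \<eta>" "\<And>k. \<eta> \<le> \<bar>d k\<bar>"
proof
  have pos: "0 < B" "0 < W"
    using assms(2) assms(4)[of 0] assms(5)[of 0] assms(6)[of 0] by auto
  show "0 < \<bar>d 0 * d 1 * w 0\<bar> / (B * W)" using pos assms by simp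
  fix k
  have "\<bar>d 0 * d 1 * w 0\<bar> = \<bar>d k\<bar> * (\<bar>d (Suc k)\<bar> * \<bar>w k\<bar>)"
    using rec_energy[OF assms(1), of k] by (simp add: abs_mult)
  also have "\<dots> \<le> \<bar>d k\<bar> * (B * W)"
    using assms(5,6) pos by (intro mult_left_mono mult_mono) auto
  finally show "\<bar>d 0 * d 1 * w 0\<bar> / (B * W) \<le> \<bar>d k\<bar>"
    using pos by (simp add: divide_le_eq)
qed

text \<open>Each parity class obeys a first-order linear recursion, and its multipliers depend on
  \<open>w\<close> only; hence any two solutions are proportional along it.\<close>

lemma rec_ratio:
  assumes "billiard_rec w d" "billiard_rec w c" "\<And>k. d k \<noteq> 0" "\<And>k. w k \<noteq> 0"
  shows "c (Suc (Suc k)) / d (Suc (Suc k)) = c k / d k"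
proof -
  have "c (Suc (Suc k)) * d k * w (Suc k) = - (c k * w k) * d k"
    using assms(2) by (simp add: billiard_rec_def mult_ac)
  also have "\<dots> = c k * (d (Suc (Suc k)) * w (Suc k))"
    using assms(1) by (simp add: billiard_rec_def mult_ac)
  finally have "c (Suc (Suc k)) * d k = c k * d (Suc (Suc k))"
    using assms(4)[of "Suc k"] by simp
  then show ?thesis using assms(3) by (simp add: field_simps)
qed

lemma abs_le_1_of_bounded_powers:
  fixes r :: real
  assumes "\<And>m. \<bar>r ^ m * d\<bar> \<le> B" "d \<noteq> 0"
  shows "\<bar>r\<bar> \<le> 1"
proof (rule ccontr)
  assume "\<not> \<bar>r\<bar> \<le> 1"
  then obtain m where "B / \<bar>d\<bar> < \<bar>r\<bar> ^ m" using real_arch_pow[of "\<bar>r\<bar>"] by force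
  then have "B < \<bar>r ^ m * d\<bar>" using assms(2) by (simp add: divide_less_eq abs_mult power_abs)
  with assms(1)[of m] show False by simp
qed

text \<open>The bounded solution \<open>d\<close> forces every holonomy factor \<open>d (k + n) / d k\<close> to be \<open>\<plusminus>1\<close>,
  and a bounded sequence cannot drift; the factor \<open>-1\<close> costs a second turn.\<close>

lemma rec_periodic:
  fixes t d w :: "nat \<Rightarrow> real"
  assumes d: "billiard_rec w d" and c: "billiard_rec w (\<lambda>k. t (k + n) - t k)"
    and w: "\<And>k. w k \<noteq> 0" "\<And>k. w (k + n) = w k" and n: "even n"
    and d0: "d 0 \<noteq> 0" "d 1 \<noteq> 0" and bd: "\<And>k. \<bar>d k\<bar> \<le> B" "\<And>k. \<bar>t k\<bar> \<le> B"
  shows "t (k + 2 * n) = t k"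
proof -
  note d_nz = rec_nonzero[OF d d0 w(1)]
  define r where "r k = d (k + n) / d k" for k
  have dn: "billiard_rec w (\<lambda>k. d (k + n))"
    unfolding billiard_rec_def
  proof
    fix k
    show "d (Suc (Suc k) + n) * w (Suc k) = - (d (k + n) * w k)"
      using d[unfolded billiard_rec_def, rule_format, of "k + n"] w(2)[of k] w(2)[of "Suc k"] by simp
  qed
  have r2: "r (k + m) = r k" if "even m" for k m
    using step2_invariant[of r m k] rec_ratio[OF d dn d_nz w(1)] that by (simp add: r_def)
  have rd: "d (k + n) = r k * d k" for k using d_nz by (simp add: r_def)
  have pow: "d (k + m * n) = r k ^ m * d k" for k m
  proof (induction m)
    case (Suc m)
    have "d (k + Suc m * n) = r (k + m * n) * d (k + m * n)"
      using rd[of "k + m * n"] by (simp add: algebra_simps)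
    also have "r (k + m * n) = r k" using n by (intro r2) simp
    finally show ?case using Suc by simp
  qed simp
  have le1: "\<bar>r k\<bar> \<le> 1" for k
    using bd(1) d_nz pow[symmetric] by (intro abs_le_1_of_bounded_powers[of _ "d k" B]) auto
  \<comment> \<open>Conservation of area balances the two parities: neither factor can contract,
    because the other one cannot expand.\<close>
  have "\<bar>r k * r (Suc k)\<bar> = 1" for k
  proof -
    have "\<bar>d (k + n) * d (Suc k + n) * w (k + n)\<bar> = \<bar>d k * d (Suc k) * w k\<bar>"
      using rec_energy[OF d, of k] rec_energy[OF d, of "k + n"] by simp
    then show ?thesis unfolding rd w(2) using d_nz w(1) by (simp add: abs_mult)
  qed
  then have r1: "\<bar>r k\<bar> = 1" for k
    using le1[of k] le1[of "Suc k"] mult_left_le[of "\<bar>r (Suc k)\<bar>" "\<bar>r k\<bar>"]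
    by (metis abs_ge_zero abs_mult antisym)
  define \<Delta> where "\<Delta> k = t (k + n) - t k" for k
  have \<Delta>: "\<Delta> (k + n) = r k * \<Delta> k" for k
  proof -
    have "\<Delta> (k + n) / d (k + n) = \<Delta> k / d k"
      using step2_invariant[of "\<lambda>k. \<Delta> k / d k" n k] rec_ratio[OF d c d_nz w(1)] n
      by (simp add: \<Delta>_def)
    then show ?thesis unfolding rd using d_nz[of k] d_nz[of "k + n"] rd[of k] by (simp add: field_simps)
  qed
  consider "r k = 1" | "r k = - 1" using r1[of k] by linarith
  then have "\<Delta> (k + n) + \<Delta> k = 0"
  proof cases
    case 1
    have "\<Delta> (k + m * n) = \<Delta> k" for m
    proof (induction m)
      case (Suc m)
      have "r (k + m * n) = 1" using 1 n r2[of "m * n" k] by simp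
      with Suc \<Delta>[of "k + m * n"] show ?case by (simp add: algebra_simps)
    qed simp
    then have "t (k + m * n) = t k + m * \<Delta> k" for m
    proof (induction m)
      case (Suc m)
      then show ?case using \<Delta>_def[of "k + m * n"] by (simp add: algebra_simps)
    qed simp
    moreover have "\<bar>t (k + m * n) - t k\<bar> \<le> 2 * B" for m
      using bd(2)[of k] bd(2)[of "k + m * n"] by linarith
    ultimately have lin: "real m * \<bar>\<Delta> k\<bar> \<le> 2 * B" for m by (simp add: abs_mult)
    have "\<Delta> k = 0"
    proof (rule ccontr)
      assume "\<Delta> k \<noteq> 0"
      then obtain m where "2 * B < real m * \<bar>\<Delta> k\<bar>" using reals_Archimedean3[of "\<bar>\<Delta> k\<bar>"] by auto
      with lin[of m] show False by simp
    qed
    with \<Delta>[of k] show ?thesis by simp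
  next
    case 2
    with \<Delta>[of k] show ?thesis by simp
  qed
  then show ?thesis by (simp add: \<Delta>_def mult_2 add_ac)
qed

text \<open>The second orbit \<open>y\<close> differs from \<open>x\<close> in both coordinates and
  so supplies the bounded nonvanishing solution; comparing \<open>x\<close> with its own shift by
  \<open>n\<close> supplies the displacement to be killed.\<close>

lemma orbit_periodic_of_itinerary_periodic:
  assumes U: "alternating U" and x: "orbit_in U e x" and y: "orbit_in U e y"
    and ne: "x 0 \<noteq> y 0" "x 1 \<noteq> y 1" and n: "even n" and e: "\<And>k. e (j + k + n) = e (j + k)"
  shows "x (j + k + 2 * n) = x (j + k)"
proof -
  obtain t where t: "\<And>k. 0 < t k" "\<And>k. t k < 1" "\<And>k. x k = edge_pt (U k) (e k) (t k)"
    using orbit_in_params[OF U x] by blast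
  obtain s where s: "\<And>k. 0 < s k" "\<And>k. s k < 1" "\<And>k. y k = edge_pt (U k) (e k) (s k)"
    using orbit_in_params[OF U y] by blast
  have nz: "s k - t k \<noteq> 0" for k
  proof (rule rec_nonzero[OF orbit_diff_rec[OF U x y t(3) s(3)]])
    show "s 0 - t 0 \<noteq> 0" "s 1 - t 1 \<noteq> 0" using ne t(3) s(3) by auto
    show "angle U e k \<noteq> 0" for k using angle_nonzero[OF U x] .
  qed
  let ?U = "shift j U" and ?e = "shift j e"
  have U': "alternating ?U" using alternating_shift[OF U] .
  have x': "orbit_in ?U ?e (shift j x)" and y': "orbit_in ?U ?e (shift j y)"
    using orbit_in_shift x y by auto
  have "?U (k + n) = ?U k" for k using alternating_add_even[OF U' n] .
  then have Un: "U (j + (k + n)) = U (j + k)" for k .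
  \<comment> \<open>Tables and edges repeat after \<open>n\<close> steps, so the delayed orbit has
    the same itinerary and the difference recursion applies to it.\<close>
  have x'': "orbit_in ?U ?e (\<lambda>k. x (j + (k + n)))"
    using orbit_in_shift[OF x', of n] Un e by (simp add: add_ac)
  have "t (j + (k + 2 * n)) = t (j + k)"
  proof (rule rec_periodic[where w = "angle ?U ?e" and d = "\<lambda>k. s (j + k) - t (j + k)" and B = 1])
    show "billiard_rec (angle ?U ?e) (\<lambda>k. s (j + k) - t (j + k))"
      using orbit_diff_rec[OF U' x' y', of "shift j t" "shift j s"] t s by simp
    show "billiard_rec (angle ?U ?e) (\<lambda>k. t (j + (k + n)) - t (j + k))"
      using orbit_diff_rec[OF U' x' x'', of "shift j t" "\<lambda>k. t (j + (k + n))"] t(3) Un e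
      by (simp add: add.assoc)
    show "angle ?U ?e k \<noteq> 0" for k using angle_nonzero[OF U' x'] .
    show "angle ?U ?e (k + n) = angle ?U ?e k" for k
      using angle_add_even[OF U' n, of ?e] e by (simp add: add.assoc)
    show "s (j + 0) - t (j + 0) \<noteq> 0" "s (j + 1) - t (j + 1) \<noteq> 0" using nz by auto
    show "\<bar>s (j + k) - t (j + k)\<bar> \<le> 1" "\<bar>t (j + k)\<bar> \<le> 1" for k
      using t[of "j + k"] s[of "j + k"] by auto
  qed (use n in auto)
  moreover have "e (j + k + 2 * n) = e (j + k)" "U (j + k + 2 * n) = U (j + k)"
    using e[of "k + n"] e[of k] alternating_add_even[OF U, of "2 * n" "j + k"]
    by (auto simp: add.assoc mult_2)
  ultimately show ?thesis using t(3)[of "j + k + 2 * n"] t(3)[of "j + k"] by (simp add: add.assoc)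
qed

section \<open>Orbits with a common itinerary\<close>

text \<open>The first factor of the rectangle of an itinerary. Shifting tables and itinerary by one
  step gives the second factor.\<close>

definition admissible :: "(nat \<Rightarrow> point list) \<Rightarrow> (nat \<Rightarrow> nat) \<Rightarrow> real \<Rightarrow> bool" where
  "admissible U e \<tau> \<longleftrightarrow> (\<exists>y. orbit_in U e y \<and> y 0 = edge_pt (U 0) (e 0) \<tau>)"

lemma orbit_in_combine:
  assumes "admissible U e \<tau>" "admissible (shift 1 U) (shift 1 e) \<sigma>"
  obtains z where "orbit_in U e z" "z 0 = edge_pt (U 0) (e 0) \<tau>" "z 1 = edge_pt (U 1) (e 1) \<sigma>"
proof -
  obtain y where y: "orbit_in U e y" "y 0 = edge_pt (U 0) (e 0) \<tau>"
    using assms(1) by (auto simp: admissible_def)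
  obtain y' where y': "orbit_in (shift 1 U) (shift 1 e) y'" "y' 0 = edge_pt (U 1) (e 1) \<sigma>"
    using assms(2) by (auto simp: admissible_def)
  show ?thesis
    by (rule that[OF orbit_in_interleave_Suc[OF y(1) y'(1)]]) (use y y' in auto)
qed

text \<open>The orbit starting at a common point of two rectangles realises both itineraries, and a
  starting pair has only one.\<close>

lemma itinerary_eq:
  assumes "alternating U" "admissible U e \<tau>" "admissible (shift 1 U) (shift 1 e) \<sigma>"
    "admissible U f \<tau>" "admissible (shift 1 U) (shift 1 f) \<sigma>" "e 0 = f 0" "e 1 = f 1"
  shows "e k = f k"
proof -
  obtain y where y: "orbit_in U e y" "y 0 = edge_pt (U 0) (e 0) \<tau>" "y 1 = edge_pt (U 1) (e 1) \<sigma>"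
    using orbit_in_combine assms(2,3) by blast
  obtain z where z: "orbit_in U f z" "z 0 = edge_pt (U 0) (f 0) \<tau>" "z 1 = edge_pt (U 1) (f 1) \<sigma>"
    using orbit_in_combine assms(4,5) by blast
  show ?thesis using orbit_in_agree(2)[OF assms(1) y(1) z(1)] y z assms(6,7) by simp
qed

section \<open>Moving a parameter interval along an itinerary\<close>

lemma chord_stable_dist:
  assumes P: "is_polygon vs" and ch: "chord vs d x z" and x: "x \<in> edge vs i" "i < length vs"
    and z: "z \<in> edge vs j" "j < length vs"
  obtains r where "0 < r"
    "\<And>p. p \<in> edge vs i \<Longrightarrow> dist p x < r \<Longrightarrow> \<exists>q\<in>edge vs j. chord vs d p q"
proof -
  obtain r where r: "0 < r"
    "\<And>p. p \<in> edge vs i \<Longrightarrow> p \<noteq> x \<Longrightarrow> dist p x < r \<Longrightarrow> \<exists>q\<in>edge vs j. chord vs d p q"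
    using chord_stable[OF P ch x z] unfolding eventually_at by blast
  show ?thesis
  proof (rule that[OF r(1)])
    fix p assume "p \<in> edge vs i" "dist p x < r"
    then show "\<exists>q\<in>edge vs j. chord vs d p q" using r(2)[of p] ch z(1) by blast
  qed
qed

text \<open>As long as no point of the connected parameter set \<open>J\<close> is sent to a vertex, the edge that
  is hit depends locally constantly on the parameter.\<close>

lemma chord_same_edge:
  assumes P: "is_polygon vs" and i: "i < length vs" and J: "connected J" and t0: "t0 \<in> J"
    and p: "continuous_on J p" "\<And>s. s \<in> J \<Longrightarrow> p s \<in> edge vs i"
    and q: "\<And>s. s \<in> J \<Longrightarrow> chord vs d (p s) (q s)" "\<And>s. s \<in> J \<Longrightarrow> q s \<notin> set vs"
    and j: "j < length vs" "q t0 \<in> edge vs j" and s: "s \<in> J"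
  shows "q s \<in> edge vs j"
proof -
  have "\<exists>k. k < length vs \<and> q s \<in> edge vs k" if "s \<in> J" for s
    using curve_edgeE[OF P chord_curve(2)[OF q(1)[OF that]] q(2)[OF that]] by metis
  then obtain f where f: "\<And>s. s \<in> J \<Longrightarrow> f s < length vs \<and> q s \<in> edge vs (f s)"
    by metis
  have "f s = f t0"
  proof (rule connected_local_const[OF J s t0], intro ballI)
    fix a assume a: "a \<in> J"
    obtain r where r: "0 < r"
      "\<And>b. b \<in> edge vs i \<Longrightarrow> dist b (p a) < r \<Longrightarrow> \<exists>c\<in>edge vs (f a). chord vs d b c"
      using chord_stable_dist[OF P q(1)[OF a] p(2)[OF a] i] f[OF a] by metis
    have "(p \<longlongrightarrow> p a) (at a within J)" using p(1) a by (simp add: continuous_on_def)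
    then have "\<forall>\<^sub>F b in at a within J. dist (p b) (p a) < r" using r(1) by (rule tendstoD)
    moreover have "\<forall>\<^sub>F b in at a within J. b \<in> J" by (simp add: eventually_at_filter)
    ultimately show "\<forall>\<^sub>F b in at a within J. f a = f b"
    proof eventually_elim
      case (elim b)
      obtain c where c: "c \<in> edge vs (f a)" "chord vs d (p b) c"
        using r(2)[OF p(2)[OF elim(2)] elim(1)] by blast
      have "q b = c" using chord_unique[OF P q(1)[OF elim(2)] c(2) p(2)[OF elim(2)] i] .
      then show ?case using edge_unique[OF P c(1)] f[OF elim(2)] f[OF a] by simp
    qed
  qed
  moreover have "f t0 = j" using edge_unique[OF P _ j(2) _ j(1)] f[OF t0] by simp
  ultimately show ?thesis using f[OF s] by simp
qed

text \<open>Parallelism with \<open>d\<close> is one linear equation in the two parameters;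
  transversality at the far edge allows solving it.\<close>

lemma chord_param:
  assumes "chord vs d (edge_pt vs i s) (edge_pt vs j t)" "cross2 d (dir vs j) \<noteq> 0"
  shows "t = (cross2 d (vtx vs i - vtx vs j) + s * cross2 d (dir vs i)) / cross2 d (dir vs j)"
  using chord_cross[OF assms(1)] assms(2) by (simp add: edge_pt_def field_simps)

lemma affine_quotient: "(c + (a + b * s) * k) / D = (c + a * k) / D + b * k / D * s"
  for a b c D k s :: real
  by (simp add: add_divide_distrib algebra_simps)

text \<open>All parameters of \<open>J\<close> are pushed forward at once along the directions
  prescribed by \<open>e\<close>. If none meets a vertex, they keep hitting the edges of the
  reference orbit. Only even times move; \<open>u i\<close> sits at time \<open>2 * i\<close>, and
  the odd points stay those of \<open>x\<close>. The parameter \<open>t0\<close> is exempt from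
  \<open>avoid\<close> because the reference orbit misses the vertices anyway.\<close>

lemma admissible_of_no_vertex:
  assumes U: "alternating U" and x: "orbit_in U e x"
    and J: "connected J" "J \<subseteq> {0<..<1}" "t0 \<in> J" "x 0 = edge_pt (U 0) (e 0) t0"
    and avoid: "\<And>s m u. s \<in> J \<Longrightarrow> s \<noteq> t0 \<Longrightarrow> u 0 = edge_pt (U 0) (e 0) s \<Longrightarrow>
      (\<And>i. i \<le> m \<Longrightarrow> u i \<in> edge (U 0) (e (2 * i)) \<and>
         chord (U 0) (dir (U 1) (e (2 * i + 1))) (u i) (u (Suc i))) \<Longrightarrow> u (Suc m) \<notin> set (U 0)"
    and s: "s \<in> J"
  shows "admissible U e s"
proof -
  note P = alternating_polygon[OF U]
  have U_even: "U (2 * i) = U 0" and U_odd: "U (Suc (2 * i)) = U 1" for i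
    using alternating_add_even[OF U, of "2 * i" 0] alternating_add_even[OF U, of "2 * i" 1] by auto
  have e_len: "e (2 * i) < length (U 0)" for i using orbit_inD(1)[OF x, of "2 * i"] U_even by simp
  define d where "d i = dir (U 1) (e (2 * i + 1))" for i
  have x_edge: "x (2 * i) \<in> edge (U 0) (e (2 * i))" for i using orbit_inD(2)[OF x, of "2 * i"] U_even by simp
  have x_chord: "chord (U 0) (d i) (x (2 * i)) (x (2 * Suc i))" for i
    using orbit_inD(3)[OF x, of "2 * i"] U_even U_odd by (simp add: d_def)
  have tr: "cross2 (d i) (dir (U 0) (e (2 * i))) \<noteq> 0" for i
    using chord_transversal[OF P x_chord x_edge e_len] .
  have tr': "cross2 (d i) (dir (U 0) (e (2 * Suc i))) \<noteq> 0" for i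
    using chord_transversal[OF P chord_sym[OF x_chord] x_edge e_len] .
  \<comment> \<open>The choice is meaningful only while the point lies on the prescribed edge, where
    transversality provides a chord.\<close>
  define u where "u s = rec_nat (edge_pt (U 0) (e 0) s) (\<lambda>i p. SOME z. chord (U 0) (d i) p z)" for s
  have u0: "u s 0 = edge_pt (U 0) (e 0) s" for s by (simp add: u_def)
  have uS: "u s (Suc i) = (SOME z. chord (U 0) (d i) (u s i) z)" for s i by (simp add: u_def)
  have step: "chord (U 0) (d i) (u s i) (u s (Suc i))" if "u s i \<in> edge (U 0) (e (2 * i))" for s i
    unfolding uS using chord_ex[OF P that e_len tr] someI_ex by metis
  have ut0: "u t0 i = x (2 * i)" for i
  proof (induction i)
    case 0
    then show ?case using u0 J by simp
  next
    case (Suc i)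
    have "chord (U 0) (d i) (x (2 * i)) (u t0 (Suc i))" using step[of t0 i] Suc x_edge by simp
    then show ?case using chord_unique[OF P _ x_chord x_edge e_len] by blast
  qed
  \<comment> \<open>The whole history is carried along because \<open>avoid\<close> asks for it; the
    affine form provides the continuity needed to apply \<open>chord_same_edge\<close> once
    more.\<close>
  have main: "(\<forall>j\<le>i. \<forall>s\<in>J. u s j \<in> edge (U 0) (e (2 * j))) \<and>
      (\<exists>a b. \<forall>s\<in>J. u s i = edge_pt (U 0) (e (2 * i)) (a + b * s))" for i
  proof (induction i)
    case 0
    have "\<forall>s\<in>J. u s 0 \<in> edge (U 0) (e 0)"
      using J(2) by (auto simp: u0 edge_pt_in_edge[OF P])
    moreover have "\<forall>s\<in>J. u s 0 = edge_pt (U 0) (e 0) (0 + 1 * s)" by (simp add: u0)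
    ultimately show ?case by (metis le_zero_eq mult_0_right)
  next
    case (Suc i)
    then obtain a b where ab: "\<And>s. s \<in> J \<Longrightarrow> u s i = edge_pt (U 0) (e (2 * i)) (a + b * s)" by blast
    have before: "u s j \<in> edge (U 0) (e (2 * j))" if "j \<le> i" "s \<in> J" for j s using Suc that by blast
    have no_vertex: "u s (Suc i) \<notin> set (U 0)" if "s \<in> J" for s
    proof (cases "s = t0")
      case True
      show ?thesis unfolding True ut0 using edge_not_vertex[OF P x_edge e_len] .
    next
      case False
      have "u s j \<in> edge (U 0) (e (2 * j)) \<and>
          chord (U 0) (dir (U 1) (e (2 * j + 1))) (u s j) (u s (Suc j))" if "j \<le> i" for j
        using before[OF that \<open>s \<in> J\<close>] step by (simp add: d_def)
      then show ?thesis by (rule avoid[where u = "u s" and m = i, OF that False u0])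
    qed
    have new: "u s (Suc i) \<in> edge (U 0) (e (2 * Suc i))" if "s \<in> J" for s
    proof (rule chord_same_edge[OF P e_len J(1) J(3) _ _ _ _ e_len _ that, where p = "\<lambda>s. u s i" and d = "d i"])
      have "continuous_on J (\<lambda>s. edge_pt (U 0) (e (2 * i)) (a + b * s))"
        unfolding edge_pt_def by (intro continuous_intros)
      then show "continuous_on J (\<lambda>s. u s i)" using ab by (simp cong: continuous_on_cong)
      show "u s i \<in> edge (U 0) (e (2 * i))" if "s \<in> J" for s using before that by simp
      show "chord (U 0) (d i) (u s i) (u s (Suc i))" if "s \<in> J" for s using step before that by simp
      show "u s (Suc i) \<notin> set (U 0)" if "s \<in> J" for s using no_vertex that .
      show "u t0 (Suc i) \<in> edge (U 0) (e (2 * Suc i))" unfolding ut0 by (rule x_edge)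
    qed
    let ?D = "cross2 (d i) (dir (U 0) (e (2 * Suc i)))"
    define a' where "a' = (cross2 (d i) (vtx (U 0) (e (2 * i)) - vtx (U 0) (e (2 * Suc i))) +
      a * cross2 (d i) (dir (U 0) (e (2 * i)))) / ?D"
    define b' where "b' = b * cross2 (d i) (dir (U 0) (e (2 * i))) / ?D"
    have "u s (Suc i) = edge_pt (U 0) (e (2 * Suc i)) (a' + b' * s)" if "s \<in> J" for s
    proof -
      have "u s (Suc i) \<in> edge (U 0) (e (2 * Suc i))" using new that .
      then obtain t where t: "u s (Suc i) = edge_pt (U 0) (e (2 * Suc i)) t"
        using edgeE[OF P] by metis
      have "chord (U 0) (d i) (edge_pt (U 0) (e (2 * i)) (a + b * s)) (edge_pt (U 0) (e (2 * Suc i)) t)"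
        using step[OF before[OF order_refl that]] by (simp only: t ab[OF that])
      from chord_param[OF this tr'] have "t = a' + b' * s"
        unfolding a'_def b'_def by (simp only: affine_quotient)
      with t show ?thesis by simp
    qed
    moreover have "\<forall>j\<le>Suc i. \<forall>s\<in>J. u s j \<in> edge (U 0) (e (2 * j))"
      using before new le_Suc_eq by metis
    ultimately show ?case by blast
  qed
  define y where "y k = (if even k then u s (k div 2) else x k)" for k
  have "orbit_in U e y"
    unfolding orbit_in_def
  proof (intro allI conjI)
    fix k
    show "e k < length (U k)" using orbit_inD(1)[OF x] .
    show "y k \<in> edge (U k) (e k)"
    proof (cases "even k")
      case True
      then obtain i where "k = 2 * i" by blast
      then show ?thesis using main[of i] s U_even by (simp add: y_def)
    qed (use orbit_inD(2)[OF x] in \<open>simp add: y_def\<close>)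
    show "chord (U k) (dir (U (Suc k)) (e (Suc k))) (y k) (y (Suc (Suc k)))"
    proof (cases "even k")
      case True
      then obtain i where i: "k = 2 * i" by blast
      have "chord (U 0) (d i) (u s i) (u s (Suc i))" using main[of i] s by (intro step) blast
      then show ?thesis using U_even[of i] U_odd[of i] by (simp add: y_def i d_def)
    qed (use orbit_inD(3)[OF x] in \<open>simp add: y_def\<close>)
  qed
  moreover have "y 0 = edge_pt (U 0) (e 0) s" by (simp add: y_def u0)
  ultimately show ?thesis unfolding admissible_def by blast
qed

text \<open>By conservation of the area form, the intervals of admissible parameters along an orbit
  have lengths bounded below; so they all meet a finite grid, and two of them share their grid points.\<close>

lemma itinerary_eventually_periodic:
  assumes U: "alternating U" and x: "orbit_in U e x"
    and t: "\<And>k. 0 < t k" "\<And>k. t k < 1" "\<And>k. x k = edge_pt (U k) (e k) (t k)"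
    and eps: "0 < \<epsilon>"
    and adm0: "\<And>\<theta>. \<bar>\<theta>\<bar> \<le> \<epsilon> \<Longrightarrow> admissible U e (t 0 + \<theta>)"
    and adm1: "\<And>\<theta>. \<bar>\<theta>\<bar> \<le> \<epsilon> \<Longrightarrow> admissible (shift 1 U) (shift 1 e) (t 1 + \<theta>)"
  obtains j n where "0 < n" "even n" "\<And>k. e (j + k + n) = e (j + k)"
proof -
  note P = alternating_polygon[OF U]
  have inj: "edge_pt (U k) i a = edge_pt (U k) i b \<longleftrightarrow> a = b" for k i a b by (rule edge_pt_inj[OF P])
  have ex: "\<exists>y s. orbit_in U e y \<and> (\<forall>k. 0 < s k \<and> s k < 1 \<and> y k = edge_pt (U k) (e k) (s k)) \<and>
      s 0 = t 0 + \<theta> \<and> s 1 = t 1 + \<theta>" if th: "\<bar>\<theta>\<bar> \<le> \<epsilon>" for \<theta>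
  proof -
    obtain y where y: "orbit_in U e y" "y 0 = edge_pt (U 0) (e 0) (t 0 + \<theta>)"
      "y 1 = edge_pt (U 1) (e 1) (t 1 + \<theta>)"
      using orbit_in_combine[OF adm0[OF th] adm1[OF th]] by blast
    obtain s where s: "\<And>k. 0 < s k" "\<And>k. s k < 1" "\<And>k. y k = edge_pt (U k) (e k) (s k)"
      using orbit_in_params[OF U y(1)] by blast
    have "s 0 = t 0 + \<theta>" "s 1 = t 1 + \<theta>" using s(3)[of 0] s(3)[of 1] y inj by auto
    with y s show ?thesis by blast
  qed
  note aw = angle_nonzero[OF U x]
  \<comment> \<open>An orbit displaced by \<epsilon> in both coordinates; its displacement
    \<open>D\<close> is the unit in which all others are measured.\<close>
  obtain y1 s1 where y1: "orbit_in U e y1" "\<And>k. 0 < s1 k \<and> s1 k < 1 \<and> y1 k = edge_pt (U k) (e k) (s1 k)"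
    "s1 0 = t 0 + \<epsilon>" "s1 1 = t 1 + \<epsilon>"
    using ex[of \<epsilon>] eps by auto
  define D where "D k = s1 k - t k" for k
  have D: "billiard_rec (angle U e) D" unfolding D_def using orbit_diff_rec[OF U x y1(1) t(3)] y1(2) by blast
  have D01: "D 0 = \<epsilon>" "D 1 = \<epsilon>" using y1 by (auto simp: D_def)
  have Dnz: "D k \<noteq> 0" for k using rec_nonzero[OF D _ _ aw] D01 eps by simp
  have D_le: "\<bar>D k\<bar> \<le> 1" for k using y1(2)[of k] t(1,2)[of k] by (auto simp: D_def)
  \<comment> \<open>A maximum over finitely many pairs of edges; the starting times 0 and 1
    represent both orders of the tables.\<close>
  define W where "W = Max ((\<lambda>(k, i, j). \<bar>cross2 (dir (U k) i) (dir (U (Suc k)) j)\<bar>) `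
    ({0, 1} \<times> {..<length (U 0) + length (U 1)} \<times> {..<length (U 0) + length (U 1)}))"
  have par: "\<exists>h\<in>{0, 1}. U k = U h \<and> U (Suc k) = U (Suc h)" for k
  proof (cases "even k")
    case True
    then show ?thesis using alternating_add_even[OF U True, of 0] alternating_add_even[OF U True, of 1] by simp
  next
    case False
    then obtain m where m: "k = 1 + 2 * m" by (auto elim!: oddE)
    have "U k = U 1" "U (Suc k) = U (Suc 1)"
      unfolding m using alternating_add_even[OF U, of "2 * m" 1] alternating_add_even[OF U, of "2 * m" "Suc 1"]
      by simp_all
    then show ?thesis by blast
  qed
  have e_lt: "e k < length (U 0) + length (U 1)" for k
    using par[of k] orbit_inD(1)[OF x, of k] by auto
  have "\<bar>angle U e k\<bar> \<le> W" for k
  proof -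
    obtain h where "h \<in> {0, 1}" "U k = U h" "U (Suc k) = U (Suc h)" using par by blast
    then show ?thesis
      unfolding W_def angle_def using e_lt[of k] e_lt[of "Suc k"]
      by (intro Max_ge) (auto intro!: image_eqI[of _ _ "(h, e k, e (Suc k))"])
  qed
  with D D01 eps aw D_le obtain \<eta> where eta: "0 < \<eta>" "\<And>k. \<eta> \<le> \<bar>D k\<bar>"
    using rec_lower_bound[of "angle U e" D W 1] by (metis less_irrefl)
  \<comment> \<open>A mesh finer than all displacements, so that at every time the grid point just
    left of the orbit is within reach.\<close>
  obtain M where M: "0 < M" "1 / real M < \<eta>"
    using eta(1) reals_Archimedean[of \<eta>] by (metis inverse_eq_divide zero_less_Suc)
  define g where "g k = nat \<lfloor>t k * M\<rfloor>" for k
  have g: "real (g k) \<le> t k * M" "t k * M < real (g k) + 1" for k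
    using t(1)[of k] M(1) unfolding g_def by (auto simp: of_nat_nat)
  have g_le: "g k \<le> M" for k
  proof -
    have "real (g k) \<le> t k * M" by (rule g)
    also have "\<dots> \<le> 1 * real M" using t(2)[of k] by (intro mult_right_mono) auto
    finally show ?thesis by simp
  qed
  have grid: "\<exists>y. orbit_in U e y \<and> y k = edge_pt (U k) (e k) (g k / M)" for k
  proof -
    \<comment> \<open>By proportionality a starting displacement \<theta> in both coordinates has
      grown to \<open>\<theta> / \<epsilon> * D k\<close> at time \<open>k\<close>; this \<theta>
      makes the orbit land on the grid point.\<close>
    define \<theta> where "\<theta> = (g k / M - t k) / D k * \<epsilon>"
    have "g k / M \<le> t k" "t k < (g k + 1) / M"
      using g[of k] M(1) by (simp_all add: pos_divide_le_eq pos_less_divide_eq)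
    then have "\<bar>g k / M - t k\<bar> < 1 / M" by (simp add: add_divide_distrib)
    also have "\<dots> < \<bar>D k\<bar>" using M(2) eta(2)[of k] by linarith
    finally have "\<bar>(g k / M - t k) / D k\<bar> \<le> 1" using Dnz[of k] by (simp add: divide_le_eq)
    then have "\<bar>(g k / M - t k) / D k\<bar> * \<epsilon> \<le> 1 * \<epsilon>"
      using eps by (intro mult_right_mono) auto
    then have "\<bar>\<theta>\<bar> \<le> \<epsilon>" using eps by (simp add: \<theta>_def abs_mult)
    then obtain y s where y: "orbit_in U e y" "\<And>k. y k = edge_pt (U k) (e k) (s k)"
      "s 0 = t 0 + \<theta>" "s 1 = t 1 + \<theta>"
      using ex[of \<theta>] by auto
    have "(s k - t k) / D k = \<theta> / \<epsilon>"
    proof -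
      have r: "(s (Suc (Suc k)) - t (Suc (Suc k))) / D (Suc (Suc k)) = (s k - t k) / D k" for k
        using rec_ratio[OF D orbit_diff_rec[OF U x y(1) t(3) y(2)] Dnz aw] .
      show ?thesis
      proof (induction k rule: induct_nat_012)
        case 0
        then show ?case using y D01 by simp
      next
        case 1
        then show ?case using y D01 by simp
      next
        case (ge2 k)
        then show ?case using r by simp
      qed
    qed
    then have "s k = t k + \<theta> / \<epsilon> * D k" using Dnz[of k] by (simp add: field_simps)
    also have "\<dots> = g k / M" using eps Dnz[of k] by (simp add: \<theta>_def)
    finally show ?thesis using y by metis
  qed
  have adm: "admissible (shift k U) (shift k e) (g k / M)" for k
  proof -
    obtain y where "orbit_in U e y" "y k = edge_pt (U k) (e k) (g k / M)" using grid by blast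
    then show ?thesis unfolding admissible_def using orbit_in_shift[of U e y k] by force
  qed
  \<comment> \<open>Two edges and two grid points identify a rectangle. Sampling even times only
    keeps the tables aligned and makes the resulting period even.\<close>
  define key where "key m = (e (2 * m), e (2 * m + 1), g (2 * m), g (2 * m + 1))" for m
  have "range key \<subseteq> {..<length (U 0) + length (U 1)} \<times> {..<length (U 0) + length (U 1)} \<times> {..M} \<times> {..M}"
    using e_lt g_le by (auto simp: key_def)
  then have "finite (range key)" by (rule finite_subset) auto
  then have "\<not> inj key" using finite_imageD[of key UNIV] by auto
  then obtain a b where ab: "a < b" "key a = key b" unfolding inj_def by (metis linorder_neqE_nat)
  define j n where "j = 2 * a" and "n = 2 * b - 2 * a"
  have Uj: "shift (2 * m) U = U" for m using alternating_shift_even[OF U] by simp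
  have Uj1: "shift (2 * m + 1) U = shift 1 U" for m using Uj[of m] by (auto simp: fun_eq_iff add_ac) (metis add.commute add_Suc)
  have "e (2 * a + k) = e (2 * b + k)" for k
  proof (rule itinerary_eq[OF U, where e = "shift (2 * a) e" and f = "shift (2 * b) e"
        and \<tau> = "g (2 * a) / M" and \<sigma> = "g (2 * a + 1) / M"])
    show "admissible U (shift (2 * a) e) (g (2 * a) / M)" using adm[of "2 * a"] unfolding Uj .
    show "admissible U (shift (2 * b) e) (g (2 * a) / M)"
      using adm[of "2 * b"] ab(2) unfolding Uj by (simp add: key_def)
    show "admissible (shift 1 U) (shift 1 (shift (2 * a) e)) (g (2 * a + 1) / M)"
      using adm[of "2 * a + 1"] unfolding Uj1 by (simp add: add_ac)
    show "admissible (shift 1 U) (shift 1 (shift (2 * b) e)) (g (2 * a + 1) / M)"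
      using adm[of "2 * b + 1"] ab(2) unfolding Uj1 by (simp add: add_ac key_def)
  qed (use ab(2) in \<open>auto simp: key_def\<close>)
  note same = this
  have "e (j + k + n) = e (j + k)" for k
  proof -
    have eq: "j + k + n = 2 * b + k" using ab(1) by (simp add: j_def n_def)
    show ?thesis unfolding eq using same[of k] by (simp add: j_def)
  qed
  moreover have "0 < n" "even n" using ab(1) by (auto simp: n_def)
  ultimately show ?thesis using that by blast
qed

section \<open>Phase space\<close>

abbreviation sgn_at :: "bool \<Rightarrow> nat \<Rightarrow> bool" where
  "sgn_at s k \<equiv> (if even k then s else \<not> s)"

definition tab :: "table_pair \<Rightarrow> bool \<Rightarrow> nat \<Rightarrow> point list" where
  "tab T s k = T (sgn_at s k)"

lemma tab_simps [simp]: "tab T s 0 = T s" "tab T s (Suc k) = tab T (\<not> s) k"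
  by (auto simp: tab_def)

lemma shift_tab: "shift j (tab T s) = tab T (sgn_at s j)"
  by (auto simp: tab_def fun_eq_iff)

context
  fixes T :: table_pair
  assumes P: "\<And>s. is_polygon (T s)"
begin

lemma alternating_tab: "alternating (tab T s)"
  by (simp add: alternating_def) (simp add: tab_def P)

lemma Pmax_chord:
  assumes "x \<in> edge (T s) i" "i < length (T s)" "y \<in> edge (T (\<not> s)) e" "e < length (T (\<not> s))"
    "chord (T s) (dir (T (\<not> s)) e) x z"
  shows "((s, x), (\<not> s, y)) \<in> Pmax T" "phi T ((s, x), (\<not> s, y)) = ((\<not> s, y), (s, z))"
proof -
  have "condition_A (T s) (T (\<not> s)) x y"
    using condition_A_iff[OF P P assms(1-4)] chord_transversal[OF P assms(5,1,2)] by blast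
  moreover have "((s, x), (\<not> s, y)) \<in> pair_space T"
    using edge_in_curve[OF P assms(1,2)] edge_in_curve[OF P assms(3,4)]
    unfolding pair_space_def table_def by blast
  ultimately show "((s, x), (\<not> s, y)) \<in> Pmax T" unfolding Pmax_def by blast
  show "phi T ((s, x), (\<not> s, y)) = ((\<not> s, y), (s, z))"
    unfolding phi_def using next_point_eq[OF P P assms] by simp
qed

text \<open>A certificate for membership in \<open>N T n\<close>: a chain of \<open>n\<close> chords
  after which the second entry is a vertex. The induction drops the first point and exchanges the
  signs.\<close>

lemma N_chain:
  assumes "\<And>k. k < n \<Longrightarrow> \<exists>i e. x k \<in> edge (tab T s k) i \<and> i < length (tab T s k) \<and>
      x (Suc k) \<in> edge (tab T s (Suc k)) e \<and> e < length (tab T s (Suc k)) \<and>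
      chord (tab T s k) (dir (tab T s (Suc k)) e) (x k) (x (Suc (Suc k)))"
    and "x n \<in> curve (tab T s n)" "x (Suc n) \<in> set (tab T s (Suc n))"
  shows "((s, x 0), (\<not> s, x 1)) \<in> N T n"
  using assms
proof (induction n arbitrary: x s)
  case 0
  then show ?case
    using vertex_in_curve[OF P] by (auto simp: pair_space_def table_def vertices_def)
next
  case (Suc n)
  obtain i e where ie: "x 0 \<in> edge (T s) i" "i < length (T s)" "x 1 \<in> edge (T (\<not> s)) e"
    "e < length (T (\<not> s))" "chord (T s) (dir (T (\<not> s)) e) (x 0) (x 2)"
    using Suc.prems(1)[of 0] by (auto simp: numeral_2_eq_2)
  have "((\<not> s, x (Suc 0)), (\<not> \<not> s, x (Suc 1))) \<in> N T n"
  proof (rule Suc.IH[where x = "\<lambda>k. x (Suc k)" and s = "\<not> s"])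
    fix k assume "k < n"
    then show "\<exists>i e. x (Suc k) \<in> edge (tab T (\<not> s) k) i \<and> i < length (tab T (\<not> s) k) \<and>
      x (Suc (Suc k)) \<in> edge (tab T (\<not> s) (Suc k)) e \<and> e < length (tab T (\<not> s) (Suc k)) \<and>
      chord (tab T (\<not> s) k) (dir (tab T (\<not> s) (Suc k)) e) (x (Suc k)) (x (Suc (Suc (Suc k))))"
      using Suc.prems(1)[of "Suc k"] unfolding tab_simps by simp
  qed (use Suc.prems in auto)
  then show ?case using Pmax_chord[OF ie] by (simp add: numeral_2_eq_2)
qed

text \<open>No vertex occurs among the three points: at \<open>x\<close> it would put the swapped
  pair into \<open>N T 0\<close>, at \<open>y\<close> it violates condition A, and at
  \<open>z\<close> it would put \<open>r\<close> into \<open>N T 1\<close>.\<close>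

lemma phase_spaceE:
  assumes "r \<in> phase_space T"
  obtains s x y z i e where "r = ((s, x), (\<not> s, y))" "x \<in> edge (T s) i" "i < length (T s)"
    "y \<in> edge (T (\<not> s)) e" "e < length (T (\<not> s))" "chord (T s) (dir (T (\<not> s)) e) x z"
    "phi T r = ((\<not> s, y), (s, z))" "z \<in> curve (T s)" "z \<notin> set (T s)"
proof -
  have ns: "r \<notin> singular T" and r: "r \<in> Pmax T" using assms by (auto simp: phase_space_def)
  from r obtain s x s' y where rr: "r = ((s, x), (s', y))" "((s, x), (s', y)) \<in> pair_space T"
    "condition_A (T s) (T s') x y" unfolding Pmax_def by blast
  then have s': "s' = (\<not> s)" and xy: "x \<in> curve (T s)" "y \<in> curve (T s')"
    by (auto simp: pair_space_def table_def)
  have y: "y \<notin> set (T s')" using rr(3) by (simp add: condition_A_def)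
  have x: "x \<notin> set (T s)"
  proof
    assume "x \<in> set (T s)"
    then have "((s', y), (s, x)) \<in> N T 0"
      using xy s' by (auto simp: pair_space_def table_def vertices_def)
    then have "((s', y), (s, x)) \<in> (\<Union>i. N T i)" by blast
    then have "r \<in> prod.swap ` (\<Union>i. N T i)"
      by (rule image_eqI[rotated]) (simp add: rr(1))
    with ns show False by (simp add: singular_def)
  qed
  obtain i where i: "i < length (T s)" "x \<in> edge (T s) i" using curve_edgeE[OF P xy(1) x] by blast
  obtain e where e: "e < length (T s')" "y \<in> edge (T s') e" using curve_edgeE[OF P xy(2) y] by blast
  define z where "z = next_point (T s) (T s') x y"
  have ch: "chord (T s) (dir (T s') e) x z"
    unfolding z_def using chord_next_point[OF P rr(3) xy(1) e(2,1)] .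
  have phi: "phi T r = ((\<not> s, y), (s, z))" by (simp add: phi_def rr(1) z_def s')
  have z: "z \<in> curve (T s)" using chord_curve(2)[OF ch] .
  have "z \<notin> set (T s)"
  proof
    assume "z \<in> set (T s)"
    then have "phi T r \<in> N T 0"
      using xy(2) z s' by (auto simp: phi pair_space_def table_def vertices_def)
    then have "r \<in> N T (Suc 0)" using r by simp
    with ns show False unfolding singular_def by blast
  qed
  then show ?thesis using that[of s x y i e z] rr(1) i e ch phi z s' by simp
qed

text \<open>Time reversal: the chord is traversed backwards, so swapping conjugates the billiard map
  to its inverse.\<close>

lemma swap_phi_swap_phi:
  assumes "r \<in> phase_space T"
  shows "prod.swap (phi T r) \<in> Pmax T" "phi T (prod.swap (phi T r)) = prod.swap r"
proof -
  from assms obtain s x y z i e where r: "r = ((s, x), (\<not> s, y))" "x \<in> edge (T s) i" "i < length (T s)"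
    "y \<in> edge (T (\<not> s)) e" "e < length (T (\<not> s))" "chord (T s) (dir (T (\<not> s)) e) x z"
    "phi T r = ((\<not> s, y), (s, z))" "z \<in> curve (T s)" "z \<notin> set (T s)" by (rule phase_spaceE)
  obtain j where j: "j < length (T s)" "z \<in> edge (T s) j" using curve_edgeE[OF P r(8,9)] by blast
  show "prod.swap (phi T r) \<in> Pmax T" "phi T (prod.swap (phi T r)) = prod.swap r"
    using Pmax_chord[OF j(2,1) r(4,5) chord_sym[OF r(6)]] unfolding r(7) unfolding r(1) by simp_all
qed

lemma swap_singular: "prod.swap r \<in> singular T \<longleftrightarrow> r \<in> singular T"
  by (cases r) (force simp: singular_def)

text \<open>If the image lay in some \<open>N T i\<close>, its preimage would lie in the next one;
  if the swapped image did, time reversal would put the swapped preimage into the one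
  before.\<close>

lemma phi_phase_space:
  assumes "r \<in> phase_space T"
  shows "phi T r \<in> phase_space T"
proof -
  from assms obtain s x y z i e where r: "r = ((s, x), (\<not> s, y))" "x \<in> edge (T s) i" "i < length (T s)"
    "y \<in> edge (T (\<not> s)) e" "e < length (T (\<not> s))" "chord (T s) (dir (T (\<not> s)) e) x z"
    "phi T r = ((\<not> s, y), (s, z))" "z \<in> curve (T s)" "z \<notin> set (T s)" by (rule phase_spaceE)
  have ns: "r \<notin> singular T" "r \<in> Pmax T" using assms by (auto simp: phase_space_def)
  obtain j where j: "j < length (T s)" "z \<in> edge (T s) j" using curve_edgeE[OF P r(8,9)] by blast
  have "cross2 (dir (T s) j) (dir (T (\<not> s)) e) \<noteq> 0"
    using chord_transversal[OF P chord_sym[OF r(6)] j(2,1)] cross2_commute[of "dir (T s) j"] by simp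
  then have "condition_A (T (\<not> s)) (T (\<not> \<not> s)) y z"
    using condition_A_iff[OF P P r(4,5) j(2,1)] by simp
  moreover have "phi T r \<in> pair_space T"
    unfolding r(7) pair_space_def table_def
    using edge_in_curve[OF P r(4,5)] r(8) by (auto intro: exI[of _ "\<not> s"])
  ultimately have 1: "phi T r \<in> Pmax T" unfolding r(7) Pmax_def by auto
  have 2: "phi T r \<notin> N T i" for i
  proof
    assume "phi T r \<in> N T i"
    then have "r \<in> N T (Suc i)" using ns by simp
    with ns show False unfolding singular_def by blast
  qed
  have 3: "prod.swap (phi T r) \<notin> N T i" for i
  proof
    assume *: "prod.swap (phi T r) \<in> N T i"
    show False
    proof (cases i)
      case 0
      with * have "y \<in> set (T (\<not> s))" by (simp add: r(7) vertices_def)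
      with edge_not_vertex[OF P r(4,5)] show False by blast
    next
      case (Suc k)
      with * swap_phi_swap_phi(2)[OF assms] have "prod.swap r \<in> N T k" by simp
      then have "prod.swap r \<in> singular T" unfolding singular_def by blast
      with ns show False using swap_singular by blast
    qed
  qed
  have "phi T r \<notin> singular T"
  proof
    assume "phi T r \<in> singular T"
    with 2 obtain q i where "q \<in> N T i" "phi T r = prod.swap q" unfolding singular_def by blast
    then have "prod.swap (phi T r) \<in> N T i" by simp
    with 3 show False by blast
  qed
  with 1 show ?thesis by (simp add: phase_space_def)
qed

text \<open>For edge points condition A is transversality of the two edges, which is symmetric, and
  the singular set is invariant under swapping.\<close>

lemma swap_phase_space:
  assumes "r \<in> phase_space T"
  shows "prod.swap r \<in> phase_space T"
proof -
  from assms obtain s x y z i e where r: "r = ((s, x), (\<not> s, y))" "x \<in> edge (T s) i" "i < length (T s)"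
    "y \<in> edge (T (\<not> s)) e" "e < length (T (\<not> s))" "chord (T s) (dir (T (\<not> s)) e) x z"
    "phi T r = ((\<not> s, y), (s, z))" "z \<in> curve (T s)" "z \<notin> set (T s)" by (rule phase_spaceE)
  have tr: "cross2 (dir (T s) i) (dir (T (\<not> s)) e) \<noteq> 0"
    using chord_transversal[OF P r(6,2,3)] cross2_commute[of "dir (T s) i"] by simp
  obtain w where w: "chord (T (\<not> s)) (dir (T (\<not> \<not> s)) i) y w"
    using chord_ex[OF P r(4,5) tr] by auto
  have "prod.swap r \<in> Pmax T"
    using Pmax_chord(1)[OF r(4,5) _ _ w, of x] r(2,3) by (simp add: r(1))
  then show ?thesis using assms swap_singular by (simp add: phase_space_def)
qed

lemma phi_pow_phase_space: "r \<in> phase_space T \<Longrightarrow> (phi T ^^ n) r \<in> phase_space T"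
  by (induction n) (auto intro: phi_phase_space)

lemma phi_inj:
  assumes "r \<in> phase_space T" "q \<in> phase_space T" "phi T r = phi T q"
  shows "r = q"
proof -
  have "prod.swap r = prod.swap q"
    using swap_phi_swap_phi(2)[OF assms(1)] swap_phi_swap_phi(2)[OF assms(2)] assms(3) by simp
  then show ?thesis by (simp add: prod_eq_iff)
qed

text \<open>Injectivity turns eventual periodicity into periodicity.\<close>

lemma phi_pow_cancel:
  assumes "r \<in> phase_space T" "(phi T ^^ (j + n)) r = (phi T ^^ j) r"
  shows "(phi T ^^ n) r = r"
  using assms(2)
proof (induction j)
  case (Suc j)
  then show ?case using phi_inj phi_pow_phase_space assms(1) by auto
qed simp

section \<open>Orbits of phase points, and chains ending in a vertex\<close>

definition orbit_pt :: "tagged \<times> tagged \<Rightarrow> nat \<Rightarrow> point" where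
  "orbit_pt r k = snd (fst ((phi T ^^ k) r))"

text \<open>The point \<open>p\<close> precedes the orbit. It is needed to see points near \<open>orbit_pt r 0\<close>
  as second entries of elements of some \<open>N T (2 * i)\<close>, that is, as critical points.\<close>

lemma orbit_of_phase_point:
  assumes "r \<in> phase_space T"
  obtains s e p h where "orbit_in (tab T s) e (orbit_pt r)"
    "\<And>k. (phi T ^^ k) r = ((sgn_at s k, orbit_pt r k), (sgn_at s (Suc k), orbit_pt r (Suc k)))"
    "h < length (T (\<not> s))" "p \<in> edge (T (\<not> s)) h" "chord (T (\<not> s)) (dir (T s) (e 0)) p (orbit_pt r 1)"
proof -
  obtain s where s: "fst (fst r) = s" by blast
  let ?x = "orbit_pt r"
  have form: "(phi T ^^ k) r = ((sgn_at s k, ?x k), (sgn_at s (Suc k), ?x (Suc k)))" for k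
  proof (induction k)
    case 0
    show ?case using assms s by (auto elim!: phase_spaceE simp: orbit_pt_def)
  next
    case (Suc k)
    have "(phi T ^^ k) r \<in> phase_space T" using phi_pow_phase_space assms by blast
    then obtain s' x y z where q: "(phi T ^^ k) r = ((s', x), (\<not> s', y))"
      "phi T ((phi T ^^ k) r) = ((\<not> s', y), (s', z))"
      by (rule phase_spaceE)
    have "s' = sgn_at s k" using q(1) Suc by auto
    then show ?case using q(2) unfolding orbit_pt_def by (simp add: phi_def)
  qed
  have ex: "\<exists>i e. ?x k \<in> edge (tab T s k) i \<and> i < length (tab T s k) \<and>
      ?x (Suc k) \<in> edge (tab T s (Suc k)) e \<and> e < length (tab T s (Suc k)) \<and>
      chord (tab T s k) (dir (tab T s (Suc k)) e) (?x k) (?x (Suc (Suc k)))" for k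
  proof -
    have "(phi T ^^ k) r \<in> phase_space T" using phi_pow_phase_space assms by blast
    then obtain s' x y z i e where q: "(phi T ^^ k) r = ((s', x), (\<not> s', y))" "x \<in> edge (T s') i"
      "i < length (T s')" "y \<in> edge (T (\<not> s')) e" "e < length (T (\<not> s'))"
      "chord (T s') (dir (T (\<not> s')) e) x z" "phi T ((phi T ^^ k) r) = ((\<not> s', y), (s', z))"
      by (rule phase_spaceE)
    have eqs: "?x k = x" "?x (Suc k) = y" "s' = sgn_at s k" using q(1) form[of k] by auto
    moreover have "?x (Suc (Suc k)) = z" using q(7) form[of "Suc k"] by simp
    moreover have "tab T s k = T s'" "tab T s (Suc k) = T (\<not> s')" using eqs(3) by (auto simp: tab_def)
    ultimately show ?thesis
      using q(2-6) by (intro exI[of _ i] exI[of _ e]) (simp only: simp_thms)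
  qed
  then obtain e where e: "\<And>k. ?x k \<in> edge (tab T s k) (e k) \<and> e k < length (tab T s k)" by metis
  have orb: "orbit_in (tab T s) e ?x"
    unfolding orbit_in_def
  proof (intro allI conjI)
    fix k
    obtain i f where "?x (Suc k) \<in> edge (tab T s (Suc k)) f \<and> f < length (tab T s (Suc k)) \<and>
      chord (tab T s k) (dir (tab T s (Suc k)) f) (?x k) (?x (Suc (Suc k)))" using ex by blast
    moreover from this have "f = e (Suc k)"
      using edge_unique[of "tab T s (Suc k)"] e[of "Suc k"] P by (auto simp: tab_def)
    ultimately show "chord (tab T s k) (dir (tab T s (Suc k)) (e (Suc k))) (?x k) (?x (Suc (Suc k)))" by blast
  qed (use e in auto)
  have "prod.swap r \<in> phase_space T" using swap_phase_space assms .
  then obtain s' x y z i f where q: "prod.swap r = ((s', x), (\<not> s', y))" "x \<in> edge (T s') i"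
    "i < length (T s')" "y \<in> edge (T (\<not> s')) f" "f < length (T (\<not> s'))"
    "chord (T s') (dir (T (\<not> s')) f) x z" "z \<in> curve (T s')" "z \<notin> set (T s')"
    by (rule phase_spaceE)
  have q': "s' = (\<not> s)" "x = ?x 1" "y = ?x 0" using q(1) form[of 0] by (auto simp: prod_eq_iff)
  obtain h where h: "h < length (T s')" "z \<in> edge (T s') h" using curve_edgeE[OF P q(7,8)] by blast
  have "f = e 0" using edge_unique[OF P, of y "\<not> s'" f "e 0"] q(4,5) e[of 0] q' by simp
  then show ?thesis
    using that[OF orb form, of h z] h chord_sym[OF q(6)] q' by simp
qed

text \<open>The chain \<open>p, u 0, x 1, u 1, x 3, ...\<close> ends in the vertex
  \<open>u (Suc m)\<close> after an even number of steps. The prefix \<open>p\<close> turns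
  \<open>u 0\<close> into the second entry of its starting pair, as the definition of
  \<open>critical\<close> requires.\<close>

lemma critical_of_chain:
  assumes x: "orbit_in (tab T s) e x"
    and p: "h < length (T (\<not> s))" "p \<in> edge (T (\<not> s)) h" "chord (T (\<not> s)) (dir (T s) (e 0)) p (x 1)"
    and u: "\<And>i. i \<le> m \<Longrightarrow> u i \<in> edge (T s) (e (2 * i)) \<and>
         chord (T s) (dir (T (\<not> s)) (e (2 * i + 1))) (u i) (u (Suc i))"
    and v: "u (Suc m) \<in> set (T s)"
  shows "(s, u 0) \<in> critical T"
proof -
  define q where "q k = (if k = 0 then p else if odd k then u (k div 2) else x (k - 1))" for k
  have q_odd: "q (Suc (2 * i)) = u i" and q_even: "q (Suc (Suc (2 * i))) = x (Suc (2 * i))"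
    and q0: "q 0 = p" for i by (auto simp: q_def)
  have t_even: "tab T s' (2 * i) = T s'" for i s' by (simp add: tab_def)
  have e_even: "e (2 * i) < length (T s)" and e_odd: "e (Suc (2 * i)) < length (T (\<not> s))"
    and x_odd: "x (Suc (2 * i)) \<in> edge (T (\<not> s)) (e (Suc (2 * i)))"
    and x_ch: "chord (T (\<not> s)) (dir (T s) (e (Suc (Suc (2 * i))))) (x (Suc (2 * i))) (x (Suc (Suc (Suc (2 * i)))))" for i
    using orbit_inD[OF x, of "2 * i"] orbit_inD[OF x, of "Suc (2 * i)"] by (simp_all add: t_even)
  have "((\<not> s, q 0), (\<not> \<not> s, q 1)) \<in> N T (2 * Suc m)"
  proof (rule N_chain)
    fix k assume k: "k < 2 * Suc m"
    let ?P = "\<lambda>i e. q k \<in> edge (tab T (\<not> s) k) i \<and> i < length (tab T (\<not> s) k) \<and>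
      q (Suc k) \<in> edge (tab T (\<not> s) (Suc k)) e \<and> e < length (tab T (\<not> s) (Suc k)) \<and>
      chord (tab T (\<not> s) k) (dir (tab T (\<not> s) (Suc k)) e) (q k) (q (Suc (Suc k)))"
    consider "k = 0" | i where "k = Suc (2 * i)" | i where "k = Suc (Suc (2 * i))"
    proof (cases "even k")
      case True
      then obtain i where "k = 2 * i" by blast
      then show ?thesis using that by (cases i) auto
    next
      case False
      then show ?thesis using that by (auto elim!: oddE)
    qed
    then show "\<exists>i e. ?P i e"
    proof cases
      case 1
      have "?P h (e 0)"
        using p u[of 0] e_even[of 0] q_odd[of 0] q_even[of 0] by (simp add: 1 q0)
      then show ?thesis by blast
    next
      case (2 i)
      then have "i \<le> m" using k by simp
      then have "?P (e (2 * i)) (e (Suc (2 * i)))"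
        using u[of i] e_even[of i] e_odd[of i] x_odd[of i] q_odd[of i] q_odd[of "Suc i"] q_even[of i]
        by (simp add: 2 t_even)
      then show ?thesis by blast
    next
      case (3 i)
      then have "Suc i \<le> m" using k by simp
      then have "?P (e (Suc (2 * i))) (e (2 * Suc i))"
        using u[of "Suc i"] e_even[of "Suc i"] e_odd[of i] x_odd[of i] x_ch[of i]
          q_odd[of "Suc i"] q_even[of i] q_even[of "Suc i"]
        by (simp add: 3 t_even)
      then show ?thesis by blast
    qed
  next
    show "q (2 * Suc m) \<in> curve (tab T (\<not> s) (2 * Suc m))"
      using edge_in_curve[OF P x_odd e_odd, of m] q_even[of m] by (simp add: t_even)
    show "q (Suc (2 * Suc m)) \<in> set (tab T (\<not> s) (Suc (2 * Suc m)))"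
      using v q_odd[of "Suc m"] by (simp add: t_even)
  qed
  then have "(s, u 0) \<in> snd ` N T (2 * Suc m)" using q_odd[of 0] by force
  then show ?thesis unfolding critical_def by blast
qed

end

context
  fixes T :: table_pair
  assumes P: "\<And>s. is_polygon (T s)"
begin

section \<open>Periodicity where critical points do not accumulate\<close>

lemma orbit_pt_phi_pow: "orbit_pt T ((phi T ^^ j) r) k = orbit_pt T r (j + k)"
proof -
  have "(phi T ^^ k) ((phi T ^^ j) r) = (phi T ^^ (j + k)) r"
    by (simp only: add.commute[of j k] funpow_add comp_apply)
  then show ?thesis by (simp only: orbit_pt_def[OF P])
qed

definition itinerary_of :: "tagged \<times> tagged \<Rightarrow> bool \<Rightarrow> (nat \<Rightarrow> nat) \<Rightarrow> bool" where
  "itinerary_of r s e \<longleftrightarrow> r \<in> phase_space T \<and> orbit_in (tab T s) e (orbit_pt T r) \<and>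
    (\<forall>k. (phi T ^^ k) r = ((sgn_at s k, orbit_pt T r k), (sgn_at s (Suc k), orbit_pt T r (Suc k))))"

lemma itinerary_ex:
  assumes "r \<in> phase_space T"
  obtains s e where "itinerary_of r s e"
  using orbit_of_phase_point[OF P assms] assms unfolding itinerary_of_def by metis

lemma itinerary_ofD:
  assumes "itinerary_of r s e"
  shows "r \<in> phase_space T" "orbit_in (tab T s) e (orbit_pt T r)"
    "(phi T ^^ k) r = ((sgn_at s k, orbit_pt T r k), (sgn_at s (Suc k), orbit_pt T r (Suc k)))"
  using assms by (auto simp: itinerary_of_def)

text \<open>A parameter whose chain ran into a vertex would start at a critical point. The orbit is
  restarted at time \<open>j\<close>, so that the point under consideration becomes its first
  one.\<close>

lemma admissible_of_avoids_critical:
  assumes r: "itinerary_of r s e"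
    and J: "connected J" "J \<subseteq> {0<..<1}" "t0 \<in> J" "orbit_pt T r j = edge_pt (tab T s j) (e j) t0"
    and avoid: "\<And>\<tau>. \<tau> \<in> J \<Longrightarrow> \<tau> \<noteq> t0 \<Longrightarrow> (sgn_at s j, edge_pt (tab T s j) (e j) \<tau>) \<notin> critical T"
    and \<tau>: "\<tau> \<in> J"
  shows "admissible (shift j (tab T s)) (shift j e) \<tau>"
proof -
  define q where "q = (phi T ^^ j) r"
  note rD = itinerary_ofD[OF r]
  have q: "q \<in> phase_space T" unfolding q_def using phi_pow_phase_space[OF P rD(1)] .
  obtain s' e' p h where o: "orbit_in (tab T s') e' (orbit_pt T q)"
    "\<And>k. (phi T ^^ k) q = ((sgn_at s' k, orbit_pt T q k), (sgn_at s' (Suc k), orbit_pt T q (Suc k)))"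
    and p: "h < length (T (\<not> s'))" "p \<in> edge (T (\<not> s')) h" "chord (T (\<not> s')) (dir (T s') (e' 0)) p (orbit_pt T q 1)"
    using orbit_of_phase_point[OF P q] by metis
  have s': "s' = sgn_at s j" using o(2)[of 0] rD(3)[of j] by (simp add: q_def)
  have tab: "shift j (tab T s) = tab T s'" unfolding s' by (rule shift_tab)
  have tabj: "tab T s j = T s'" by (simp add: tab_def s')
  have x: "orbit_pt T q = shift j (orbit_pt T r)" unfolding q_def by (rule ext) (rule orbit_pt_phi_pow)
  have "orbit_in (tab T s') (shift j e) (orbit_pt T q)"
    using orbit_in_shift[OF rD(2), of j] unfolding tab x .
  \<comment> \<open>The edges found for the restarted orbit belong to the same points, hence
    coincide with the shifted ones.\<close>
  from orbit_in_agree(2)[OF alternating_tab[OF P] o(1) this refl refl]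
  have e': "e' = shift j e" by (rule ext)
  have "admissible (tab T s') e' \<tau>"
  proof (rule admissible_of_no_vertex[OF alternating_tab[OF P] o(1) J(1-3) _ _ \<tau>])
    show "orbit_pt T q 0 = edge_pt (tab T s' 0) (e' 0) t0" using J(4) by (simp add: x e' tabj)
    fix \<sigma> m u
    assume \<sigma>: "\<sigma> \<in> J" "\<sigma> \<noteq> t0" "u 0 = edge_pt (tab T s' 0) (e' 0) \<sigma>"
      and u: "\<And>i. i \<le> m \<Longrightarrow> u i \<in> edge (tab T s' 0) (e' (2 * i)) \<and>
         chord (tab T s' 0) (dir (tab T s' 1) (e' (2 * i + 1))) (u i) (u (Suc i))"
    show "u (Suc m) \<notin> set (tab T s' 0)"
    proof
      assume "u (Suc m) \<in> set (tab T s' 0)"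
      then have "(s', u 0) \<in> critical T"
        using critical_of_chain[OF P o(1) p, of m u] u by simp
      moreover have "u 0 = edge_pt (tab T s j) (e j) \<sigma>" using \<sigma>(3) by (simp add: e' tabj)
      ultimately show False using avoid[OF \<sigma>(1,2)] s' by simp
    qed
  qed
  then show ?thesis unfolding tab e' .
qed

lemma phi_pow_eq_of_itinerary:
  assumes r: "itinerary_of r s e"
    and t: "orbit_pt T r 0 = edge_pt (tab T s 0) (e 0) t0" "orbit_pt T r 1 = edge_pt (tab T s 1) (e 1) t1"
    and adm: "admissible (tab T s) e \<tau>0" "admissible (shift 1 (tab T s)) (shift 1 e) \<tau>1"
      "\<tau>0 \<noteq> t0" "\<tau>1 \<noteq> t1"
    and n: "even n" and e: "\<And>k. e (j + k + n) = e (j + k)"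
  shows "(phi T ^^ (2 * n)) r = r" "orbit_pt T r (k + 2 * n) = orbit_pt T r k"
proof -
  note rD = itinerary_ofD[OF r]
  have U: "alternating (tab T s)" by (rule alternating_tab[OF P])
  obtain y where y: "orbit_in (tab T s) e y" "y 0 = edge_pt (tab T s 0) (e 0) \<tau>0"
    "y 1 = edge_pt (tab T s 1) (e 1) \<tau>1"
    using orbit_in_combine[OF adm(1,2)] by blast
  have ne: "orbit_pt T r 0 \<noteq> y 0" "orbit_pt T r 1 \<noteq> y 1"
    using t y adm(3,4) edge_pt_inj[OF alternating_polygon[OF U]] by metis+
  have per: "orbit_pt T r (j + k + 2 * n) = orbit_pt T r (j + k)" for k
    using orbit_periodic_of_itinerary_periodic[OF U rD(2) y(1) ne n e] .
  \<comment> \<open>A phase point consists of two consecutive orbit points, so two values of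
    \<open>k\<close> suffice; the signs agree because the return time is even.\<close>
  have "(phi T ^^ (j + 2 * n)) r = (phi T ^^ j) r"
    using rD(3)[of "j + 2 * n"] rD(3)[of j] per[of 0] per[of 1] by simp
  then show eq: "(phi T ^^ (2 * n)) r = r" using phi_pow_cancel[OF P rD(1)] by blast
  show "orbit_pt T r (k + 2 * n) = orbit_pt T r k"
    using orbit_pt_phi_pow[of "2 * n" r k] eq by (simp add: add.commute)
qed

lemma isolated_param:
  assumes "\<not> (s, edge_pt vs i t) islimpt C" "is_polygon vs" "0 < t" "t < 1"
  obtains \<epsilon> where "0 < \<epsilon>" "{t - \<epsilon>..t + \<epsilon>} \<subseteq> {0<..<1}"
    "\<And>\<tau>. \<tau> \<in> {t - \<epsilon>..t + \<epsilon>} \<Longrightarrow> \<tau> \<noteq> t \<Longrightarrow> (s, edge_pt vs i \<tau>) \<notin> C"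
proof -
  obtain V where V: "open V" "(s, edge_pt vs i t) \<in> V"
    "\<And>p. p \<in> C \<Longrightarrow> p \<in> V \<Longrightarrow> p = (s, edge_pt vs i t)"
    using assms(1) unfolding islimpt_def by blast
  define W where "W = (\<lambda>\<tau>. (s, edge_pt vs i \<tau>)) -` V \<inter> {0<..<1}"
  have "open ((\<lambda>\<tau>. (s, edge_pt vs i \<tau>)) -` V)"
    unfolding edge_pt_def using V(1) by (intro open_vimage continuous_intros)
  then have "open W" unfolding W_def by auto
  moreover have "t \<in> W" using V assms by (simp add: W_def)
  ultimately obtain \<epsilon> where \<epsilon>: "0 < \<epsilon>" "cball t \<epsilon> \<subseteq> W" unfolding open_contains_cball by blast
  have sub: "{t - \<epsilon>..t + \<epsilon>} \<subseteq> W" using \<epsilon>(2) by (simp add: cball_eq_atLeastAtMost)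
  show ?thesis
  proof (rule that[OF \<epsilon>(1)])
    show "{t - \<epsilon>..t + \<epsilon>} \<subseteq> {0<..<1}" using sub by (auto simp: W_def)
    fix \<tau> assume \<tau>: "\<tau> \<in> {t - \<epsilon>..t + \<epsilon>}" "\<tau> \<noteq> t"
    then have "(s, edge_pt vs i \<tau>) \<in> V" using sub by (auto simp: W_def)
    moreover have "edge_pt vs i \<tau> \<noteq> edge_pt vs i t" using \<tau>(2) edge_pt_inj[OF assms(2)] by simp
    ultimately show "(s, edge_pt vs i \<tau>) \<notin> C" using V(3) by blast
  qed
qed

lemma admissible_near:
  assumes r: "itinerary_of r s e" and t: "\<And>k. 0 < t k" "\<And>k. t k < 1"
      "\<And>k. orbit_pt T r k = edge_pt (tab T s k) (e k) (t k)"
    and iso: "\<not> fst r islimpt critical T" "\<not> snd r islimpt critical T"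
  shows "\<exists>\<epsilon>>0. (\<forall>\<theta>. \<bar>\<theta>\<bar> \<le> \<epsilon> \<longrightarrow> admissible (tab T s) e (t 0 + \<theta>)) \<and>
    (\<forall>\<theta>. \<bar>\<theta>\<bar> \<le> \<epsilon> \<longrightarrow> admissible (shift 1 (tab T s)) (shift 1 e) (t 1 + \<theta>))"
proof -
  have U: "alternating (tab T s)" by (rule alternating_tab[OF P])
  have adm: "\<exists>\<epsilon>>0. \<forall>\<theta>. \<bar>\<theta>\<bar> \<le> \<epsilon> \<longrightarrow> admissible (shift j (tab T s)) (shift j e) (t j + \<theta>)"
    if lim: "\<not> (sgn_at s j, orbit_pt T r j) islimpt critical T" for j
  proof -
    obtain \<epsilon> where \<epsilon>: "0 < \<epsilon>" "{t j - \<epsilon>..t j + \<epsilon>} \<subseteq> {0<..<1}"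
      "\<And>\<tau>. \<tau> \<in> {t j - \<epsilon>..t j + \<epsilon>} \<Longrightarrow> \<tau> \<noteq> t j \<Longrightarrow> (sgn_at s j, edge_pt (tab T s j) (e j) \<tau>) \<notin> critical T"
      using isolated_param[OF lim[unfolded t(3)] alternating_polygon[OF U] t(1,2)] by metis
    have "admissible (shift j (tab T s)) (shift j e) (t j + \<theta>)" if "\<bar>\<theta>\<bar> \<le> \<epsilon>" for \<theta>
      by (rule admissible_of_avoids_critical[OF r _ \<epsilon>(2) _ t(3) \<epsilon>(3)]) (use \<epsilon>(1) that in auto)
    with \<epsilon>(1) show ?thesis by blast
  qed
  have "fst r = (sgn_at s 0, orbit_pt T r 0)" "snd r = (sgn_at s 1, orbit_pt T r 1)"
    using itinerary_ofD(3)[OF r, of 0] by (auto simp: prod_eq_iff)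
  with adm[of 0] adm[of 1] iso obtain \<epsilon>0 \<epsilon>1 where "0 < \<epsilon>0" "0 < \<epsilon>1"
    "\<forall>\<theta>. \<bar>\<theta>\<bar> \<le> \<epsilon>0 \<longrightarrow> admissible (tab T s) e (t 0 + \<theta>)"
    "\<forall>\<theta>. \<bar>\<theta>\<bar> \<le> \<epsilon>1 \<longrightarrow> admissible (shift 1 (tab T s)) (shift 1 e) (t 1 + \<theta>)"
    by auto
  then show ?thesis by (intro exI[of _ "min \<epsilon>0 \<epsilon>1"]) auto
qed

text \<open>Serves both hypotheses on accumulation: entries of phase points are never vertices, and
  off the grid they are not in the critical set, which contains its limit points when
  closed.\<close>

lemma periodic_of_not_islimpt:
  assumes r: "r \<in> phase_space T"
    and iso: "\<not> fst r islimpt critical T" "\<not> snd r islimpt critical T"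
  shows "periodic_at (phi T) r"
proof -
  have U: "alternating (tab T s)" for s by (rule alternating_tab[OF P])
  obtain s e where se: "itinerary_of r s e" using itinerary_ex r by blast
  obtain t where t: "\<And>k. 0 < t k" "\<And>k. t k < 1" "\<And>k. orbit_pt T r k = edge_pt (tab T s k) (e k) (t k)"
    using orbit_in_params[OF U itinerary_ofD(2)[OF se]] by blast
  from admissible_near[OF se t iso] obtain \<epsilon> where
    near: "0 < \<epsilon> \<and> (\<forall>\<theta>. \<bar>\<theta>\<bar> \<le> \<epsilon> \<longrightarrow> admissible (tab T s) e (t 0 + \<theta>)) \<and>
      (\<forall>\<theta>. \<bar>\<theta>\<bar> \<le> \<epsilon> \<longrightarrow> admissible (shift 1 (tab T s)) (shift 1 e) (t 1 + \<theta>))" ..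
  then have \<epsilon>: "0 < \<epsilon>" by (rule conjunct1)
  have adm: "\<And>\<theta>. \<bar>\<theta>\<bar> \<le> \<epsilon> \<Longrightarrow> admissible (tab T s) e (t 0 + \<theta>)"
    "\<And>\<theta>. \<bar>\<theta>\<bar> \<le> \<epsilon> \<Longrightarrow> admissible (shift 1 (tab T s)) (shift 1 e) (t 1 + \<theta>)"
    using near by simp_all
  have "\<exists>j n. 0 < n \<and> even n \<and> (\<forall>k. e (j + k + n) = e (j + k))"
    by (rule itinerary_eventually_periodic[OF U itinerary_ofD(2)[OF se] t \<epsilon> adm]) blast+
  then obtain j n where n: "0 < n" "even n" "\<And>k. e (j + k + n) = e (j + k)" by metis
  have "admissible (tab T s) e (t 0 + \<epsilon>)" "admissible (shift 1 (tab T s)) (shift 1 e) (t 1 + \<epsilon>)"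
    "t 0 + \<epsilon> \<noteq> t 0" "t 1 + \<epsilon> \<noteq> t 1"
    using adm[of \<epsilon>] \<epsilon> by simp_all
  from phi_pow_eq_of_itinerary(1)[OF se t(3) t(3) this n(2,3)]
  have "(phi T ^^ (2 * n)) r = r" .
  then show ?thesis unfolding periodic_at_def using n(1) by (intro exI[of _ "2 * n"]) auto
qed

section \<open>Critical points, tables and vertices\<close>

lemma critical_subset_tables: "critical T \<subseteq> tables T"
proof -
  have "N T i \<subseteq> pair_space T" for i
    by (cases i) (auto simp: Pmax_def)
  moreover have "snd r \<in> tables T" if "r \<in> pair_space T" for r
    using that unfolding pair_space_def tables_def by auto
  ultimately show ?thesis unfolding critical_def by blast
qed

text \<open>Ensures that to the left of any point its edge offers at least one critical parameter,
  namely 0.\<close>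

lemma vertex_critical:
  assumes "v \<in> set (T s)"
  shows "(s, v) \<in> critical T"
proof -
  have "vtx (T (\<not> s)) 0 \<in> curve (T (\<not> s))" using vertex_in_curve[OF P vtx_in[OF P]] .
  then have "((\<not> s, vtx (T (\<not> s)) 0), (s, v)) \<in> N T (2 * 0)"
    using assms vertex_in_curve[OF P assms] by (auto simp: pair_space_def table_def vertices_def)
  then have "(s, v) \<in> snd ` N T (2 * 0)" by (rule image_eqI[rotated]) simp
  then show ?thesis unfolding critical_def by blast
qed

lemma phase_space_not_vertex:
  assumes "r \<in> phase_space T"
  shows "fst r \<notin> vertices T" "snd r \<notin> vertices T"
proof -
  from assms obtain s x y z i e where r: "r = ((s, x), (\<not> s, y))" "x \<in> edge (T s) i" "i < length (T s)"
    "y \<in> edge (T (\<not> s)) e" "e < length (T (\<not> s))" by (rule phase_spaceE[OF P])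
  show "fst r \<notin> vertices T" "snd r \<notin> vertices T"
    using edge_not_vertex[OF P r(2,3)] edge_not_vertex[OF P r(4,5)] by (auto simp: r(1) vertices_def)
qed

end

section \<open>Exceptional pairs\<close>

text \<open>Points that can be driven into a vertex by at most \<open>n\<close> chords when the
  directions are chosen freely among the edges of the other table. Ranging over edges instead of
  partner points is what keeps this countable.\<close>

primrec hits :: "table_pair \<Rightarrow> nat \<Rightarrow> bool \<Rightarrow> point set" where
  "hits T 0 s = set (T s)"
| "hits T (Suc n) s = hits T n s \<union>
     (\<Union>i<length (T s). \<Union>e<length (T (\<not> s)). \<Union>z\<in>hits T n s.
        {x \<in> edge (T s) i. chord (T s) (dir (T (\<not> s)) e) x z})"

context
  fixes T :: table_pair
  assumes P: "\<And>s. is_polygon (T s)"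
begin

lemma countable_hits: "countable (hits T n s)"
proof (induction n)
  case 0
  show ?case by (simp add: countable_finite)
next
  case (Suc n)
  have "finite {x \<in> edge (T s) i. chord (T s) d x z}" if i: "i < length (T s)" for i d z
  proof (cases "{x \<in> edge (T s) i. chord (T s) d x z} = {}")
    case False
    then obtain x where x: "x \<in> edge (T s) i" "chord (T s) d x z" by blast
    \<comment> \<open>Both points lie on the line through \<open>z\<close> in direction
      \<open>d\<close>, which crosses the transversal edge once.\<close>
    have "y = x" if y: "y \<in> edge (T s) i" "chord (T s) d y z" for y
    proof -
      obtain a b where ab: "x = edge_pt (T s) i a" "y = edge_pt (T s) i b"
        using edgeE[OF P x(1)] edgeE[OF P y(1)] by metis
      have "cross2 d (y - x) = 0"
        using chord_cross[OF x(2)] chord_cross[OF y(2)] by simp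
      then have "(b - a) * cross2 d (dir (T s) i) = 0" by (simp only: ab edge_pt_diff cross2_simps)
      then show ?thesis using chord_transversal[OF P x(2,1) i] ab by simp
    qed
    then have "{x \<in> edge (T s) i. chord (T s) d x z} \<subseteq> {x}" by blast
    then show ?thesis by (rule finite_subset) simp
  next
    case True
    then show ?thesis by (simp only: finite.emptyI)
  qed
  then have "countable {x \<in> edge (T s) i. chord (T s) d x z}" if "i < length (T s)" for i d z
    using that by (intro countable_finite) blast
  then show ?case using Suc unfolding hits.simps by (intro countable_Un countable_UN) auto
qed

lemma hits_vertex: "x \<in> set (T s) \<Longrightarrow> x \<in> hits T n s"
  by (induction n) auto

text \<open>After \<open>n\<close> steps the vertex is orbit point \<open>n + 1\<close>. It
  therefore continues the chain of \<open>y\<close> when \<open>n\<close> is even and that of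
  \<open>x\<close> when \<open>n\<close> is odd.\<close>

lemma N_subset_hits:
  "((s, x), (s', y)) \<in> N T n \<Longrightarrow> (even n \<longrightarrow> y \<in> hits T n s') \<and> (odd n \<longrightarrow> x \<in> hits T n s)"
proof (induction n arbitrary: s x s' y)
  case 0
  then show ?case by (simp add: vertices_def)
next
  case (Suc n)
  then have A: "((s, x), (s', y)) \<in> pair_space T" "condition_A (T s) (T s') x y"
    and *: "((s', y), (s, next_point (T s) (T s') x y)) \<in> N T n"
    by (auto simp: Pmax_def phi_def)
  then have s': "s' = (\<not> s)" and xy: "x \<in> curve (T s)" "y \<in> curve (T s')"
    by (auto simp: pair_space_def table_def)
  have "y \<notin> set (T s')" using A(2) by (simp add: condition_A_def)
  then obtain e where e: "e < length (T s')" "y \<in> edge (T s') e" using curve_edgeE[OF P xy(2)] by blast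
  have ch: "chord (T s) (dir (T s') e) x (next_point (T s) (T s') x y)"
    using chord_next_point[OF P A(2) xy(1) e(2,1)] .
  show ?case
  proof (cases "even n")
    case True
    then have z: "next_point (T s) (T s') x y \<in> hits T n s" using Suc.IH[OF *] by blast
    have "x \<in> hits T (Suc n) s"
    proof (cases "x \<in> set (T s)")
      case False
      then obtain i where i: "i < length (T s)" "x \<in> edge (T s) i" using curve_edgeE[OF P xy(1)] by blast
      have "x \<in> (\<Union>i<length (T s). \<Union>e<length (T (\<not> s)). \<Union>z\<in>hits T n s.
        {x \<in> edge (T s) i. chord (T s) (dir (T (\<not> s)) e) x z})"
        using i e(1) z ch unfolding s' by blast
      then show ?thesis by simp
    qed (rule hits_vertex)
    with True show ?thesis by simp
  next
    case False
    then show ?thesis using Suc.IH[OF *] by simp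
  qed
qed

text \<open>The parity inclusion is applied to the pair and to its swap, which covers both halves of
  the singular set; its even case also excludes critical entries.\<close>

lemma not_hits_good:
  assumes r: "((s, x), (\<not> s, y)) \<in> Pmax T" and x: "\<And>n. x \<notin> hits T n s" and y: "\<And>n. y \<notin> hits T n (\<not> s)"
  shows "((s, x), (\<not> s, y)) \<in> phase_space T - C_grid T"
proof -
  have N: "((s, x), (\<not> s, y)) \<notin> N T n" "((\<not> s, y), (s, x)) \<notin> N T n" for n
    using N_subset_hits[of s x "\<not> s" y n] N_subset_hits[of "\<not> s" y s x n] x y by auto
  have "((s, x), (\<not> s, y)) \<notin> singular T"
    using N by (auto simp: singular_def)
  moreover have crit: "v \<in> hits T (2 * i) b" if "(b, v) \<in> snd ` N T (2 * i)" for b v i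
    using that by (auto dest!: N_subset_hits)
  then have "(s, x) \<notin> critical T" "(\<not> s, y) \<notin> critical T"
    unfolding critical_def using x y by blast+
  then have "((s, x), (\<not> s, y)) \<notin> C_grid T" by (auto simp: C_grid_def)
  ultimately show ?thesis using r by (simp add: phase_space_def)
qed

section \<open>Null sets for the product of arc lengths\<close>

lemma emeasure_arc_length_countable:
  assumes "countable A"
  shows "emeasure (arc_length (T s)) A = 0"
proof -
  let ?g = "\<lambda>i t. (1 - t) *\<^sub>R vtx (T s) i + t *\<^sub>R vtx (T s) (Suc i)"
  have "A \<in> sets borel" using assms by (rule sets.countable[rotated]) simp
  moreover have "emeasure lborel {t \<in> {0..1}. ?g i t \<in> A} = 0" for i
  proof -
    have "?g i t = edge_pt (T s) i t" for t by (simp add: edge_pt_def dir_def algebra_simps)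
    then have "inj_on (?g i) {t \<in> {0..1}. ?g i t \<in> A}"
      by (auto intro!: inj_onI simp: edge_pt_inj[OF P])
    moreover have "countable (?g i ` {t \<in> {0..1}. ?g i t \<in> A})"
      by (rule countable_subset[OF _ assms]) auto
    ultimately have "countable {t \<in> {0..1}. ?g i t \<in> A}" using countable_image_inj_on by blast
    then show ?thesis by (rule emeasure_lborel_countable)
  qed
  ultimately show ?thesis by (simp add: emeasure_arc_length)
qed

lemma sets_arc_length: "sets (arc_length vs) = sets borel"
  and space_arc_length: "space (arc_length vs) = UNIV"
  by (simp_all add: arc_length_def)

lemma finite_measure_arc_length: "finite_measure (arc_length vs)"
proof
  have "emeasure (arc_length vs) UNIV < \<infinity>"
    by (subst emeasure_arc_length)
      (auto simp: ennreal_mult_less_top emeasure_lborel_Icc_eq simp flip: atLeastAtMost_def atLeastAtMost_iff)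
  then show "emeasure (arc_length vs) (space (arc_length vs)) \<noteq> \<infinity>"
    by (simp add: space_arc_length)
qed

text \<open>The exceptional pairs may be uncountably many, but each has an entry in a countable set,
  so they are covered by two null families of lines.\<close>

lemma AE_phase_space:
  "AE (x, y) in arc_length (T s) \<Otimes>\<^sub>M arc_length (T (\<not> s)).
     ((s, x), (\<not> s, y)) \<in> Pmax T \<longrightarrow> ((s, x), (\<not> s, y)) \<in> phase_space T - C_grid T"
proof -
  interpret M1: finite_measure "arc_length (T s)" by (rule finite_measure_arc_length)
  interpret M2: finite_measure "arc_length (T (\<not> s))" by (rule finite_measure_arc_length)
  interpret pair_sigma_finite "arc_length (T s)" "arc_length (T (\<not> s))" ..
  define E where "E b = (\<Union>n. hits T n b)" for b
  have E: "countable (E b)" for b unfolding E_def using countable_hits by blast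
  have Eb: "E b \<in> sets borel" for b using E by (rule sets.countable[rotated]) simp
  have AE: "AE x in arc_length (T b). x \<notin> E b" for b
    by (rule AE_I'[of "E b"]) (auto simp: null_sets_def sets_arc_length Eb emeasure_arc_length_countable[OF E])
  have "AE p in arc_length (T s) \<Otimes>\<^sub>M arc_length (T (\<not> s)). fst p \<notin> E s \<and> snd p \<notin> E (\<not> s)"
  proof (rule AE_pair_measure)
    have "{p \<in> space (arc_length (T s) \<Otimes>\<^sub>M arc_length (T (\<not> s))). fst p \<notin> E s \<and> snd p \<notin> E (\<not> s)} =
        (- E s) \<times> (- E (\<not> s))"
      by (auto simp: space_pair_measure space_arc_length)
    also have "\<dots> \<in> sets (arc_length (T s) \<Otimes>\<^sub>M arc_length (T (\<not> s)))"
      using Eb by (intro pair_measureI) (auto simp: sets_arc_length)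
    finally show "{p \<in> space (arc_length (T s) \<Otimes>\<^sub>M arc_length (T (\<not> s))). fst p \<notin> E s \<and> snd p \<notin> E (\<not> s)}
      \<in> sets (arc_length (T s) \<Otimes>\<^sub>M arc_length (T (\<not> s)))" .
    show "AE x in arc_length (T s). AE y in arc_length (T (\<not> s)). fst (x, y) \<notin> E s \<and> snd (x, y) \<notin> E (\<not> s)"
      using AE[of s]
    proof eventually_elim
      case (elim x)
      show ?case using AE[of "\<not> s"] elim by simp
    qed
  qed
  then show ?thesis
    by (rule AE_mp) (auto intro!: AE_I2 simp: E_def dest!: not_hits_good)
qed

end

section \<open>Period bounds for finitely many critical points\<close>

lemma alternating_shift_eq:
  assumes "alternating U" "U j = U k" "U (Suc j) = U (Suc k)"
  shows "U (j + i) = U (k + i)"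
proof -
  have "U (j + i) = U (k + i) \<and> U (j + Suc i) = U (k + Suc i)"
    by (induction i) (use assms in \<open>auto simp: alternating_def\<close>)
  then show ?thesis ..
qed

text \<open>Half-open edges tile the polygon, each vertex belonging to the edge that starts there.
  So a left end determines its edge even when it is a vertex.\<close>

lemma half_open_edge_unique:
  assumes P: "is_polygon vs" and "edge_pt vs i a = edge_pt vs j b"
    and a: "0 \<le> a" "a < 1" and b: "0 \<le> b" "b < 1" and ij: "i < length vs" "j < length vs"
  shows "i = j" "a = b"
proof -
  have "i = j \<and> a = b"
  proof (cases "a = 0")
    case a0: True
    then have v: "edge_pt vs j b \<in> set vs" using assms(2) vtx_in[OF P, of i] by simp
    have "b = 0"
    proof (rule ccontr)
      assume "b \<noteq> 0"
      then have "edge_pt vs j b \<in> edge vs j" using b by (simp add: edge_pt_in_edge[OF P])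
      then show False using edge_not_vertex[OF P _ ij(2)] v by blast
    qed
    then show ?thesis using assms(2) a0 vtx_eq_iff[OF P ij] by simp
  next
    case False
    then have ai: "edge_pt vs i a \<in> edge vs i" using a by (simp add: edge_pt_in_edge[OF P])
    have "b \<noteq> 0"
    proof
      assume "b = 0"
      then have "edge_pt vs i a \<in> set vs" using assms(2) vtx_in[OF P, of j] by simp
      then show False using edge_not_vertex[OF P ai ij(1)] by blast
    qed
    then have "edge_pt vs i a \<in> edge vs j" using b assms(2) by (simp add: edge_pt_in_edge[OF P])
    then have "i = j" using edge_unique[OF P ai _ ij] by blast
    then show ?thesis using assms(2) edge_pt_inj[OF P] by simp
  qed
  then show "i = j" "a = b" by auto
qed

lemma period_le:
  assumes "1 \<le> n" "(f ^^ n) p = p" "n \<le> m"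
  shows "periodic_at f p \<and> period f p \<le> m"
proof
  show "periodic_at f p" using assms unfolding periodic_at_def by blast
  have "period f p \<le> n" unfolding period_def by (rule Least_le) (use assms in simp)
  with assms(3) show "period f p \<le> m" by simp
qed

lemma pigeonhole_nat:
  assumes "finite S" "\<And>k. K k \<in> S"
  obtains i j :: nat where "i < j" "j \<le> card S" "K i = K j"
proof -
  have "card (K ` {..card S}) \<le> card S" using assms by (intro card_mono) auto
  then have "\<not> inj_on K {..card S}" using pigeonhole[of K "{..card S}"] by simp
  then obtain i j where "i \<le> card S" "j \<le> card S" "K i = K j" "i \<noteq> j" by (auto simp: inj_on_def)
  then show ?thesis using that[of i j] that[of j i] by (cases "i < j") auto
qed

text \<open>Two consecutive left ends form the corner of a rectangle. The interval contains
  \<open>t k\<close>, which may itself be critical, but not \<open>a k\<close>, which may be a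
  vertex.\<close>

definition left_ends :: "table_pair \<Rightarrow> bool \<Rightarrow> (nat \<Rightarrow> nat) \<Rightarrow> (nat \<Rightarrow> real) \<Rightarrow> (nat \<Rightarrow> real) \<Rightarrow> bool" where
  "left_ends T s e t a \<longleftrightarrow> (\<forall>k. 0 \<le> a k \<and> a k < t k \<and> t k < 1 \<and> e k < length (tab T s k) \<and>
     (sgn_at s k, edge_pt (tab T s k) (e k) (a k)) \<in> critical T \<and>
     (\<forall>\<tau>\<in>{a k<..t k}. admissible (shift k (tab T s)) (shift k e) \<tau>))"

abbreviation left_end :: "table_pair \<Rightarrow> bool \<Rightarrow> (nat \<Rightarrow> nat) \<Rightarrow> (nat \<Rightarrow> real) \<Rightarrow> nat \<Rightarrow> point" where
  "left_end T s e a k \<equiv> edge_pt (tab T s k) (e k) (a k)"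

context
  fixes T :: table_pair
  assumes P: "\<And>s. is_polygon (T s)"
begin

lemma left_ends_ex:
  assumes fin: "finite (critical T)" and r: "itinerary_of T r s e"
    and t: "\<And>k. 0 < t k" "\<And>k. t k < 1" "\<And>k. orbit_pt T r k = edge_pt (tab T s k) (e k) (t k)"
  shows "\<exists>a. left_ends T s e t a"
proof -
  have poly: "is_polygon (tab T s k)" for k by (simp add: tab_def P)
  have "\<exists>a. 0 \<le> a \<and> a < t k \<and> (sgn_at s k, edge_pt (tab T s k) (e k) a) \<in> critical T \<and>
      (\<forall>\<tau>\<in>{a<..t k}. admissible (shift k (tab T s)) (shift k e) \<tau>)" for k
  proof -
    let ?f = "\<lambda>a. (sgn_at s k, edge_pt (tab T s k) (e k) a)"
    \<comment> \<open>Strictly left of \<open>t k\<close>, so that the interval has positive length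
      even if the orbit point is critical; the largest element is the left end.\<close>
    define A where "A = {a \<in> {0..<t k}. ?f a \<in> critical T}"
    have "finite (?f -` critical T)"
      by (rule finite_vimageI[OF fin]) (auto intro!: injI simp: edge_pt_inj[OF poly])
    then have A: "finite A" by (rule finite_subset[rotated]) (auto simp: A_def)
    have "vtx (tab T s k) (e k) \<in> set (T (sgn_at s k))" using vtx_in[OF poly, of k] by (simp add: tab_def)
    then have "?f 0 \<in> critical T" using vertex_critical[OF P] by simp
    then have "0 \<in> A" using t(1)[of k] by (simp add: A_def)
    then have "Max A \<in> A" using A by (intro Max_in) auto
    then have a: "0 \<le> Max A" "Max A < t k" "?f (Max A) \<in> critical T" by (auto simp: A_def)
    have "admissible (shift k (tab T s)) (shift k e) \<tau>" if "\<tau> \<in> {Max A<..t k}" for \<tau>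
    proof (rule admissible_of_avoids_critical[OF P r _ _ _ t(3) _ that])
      show "{Max A<..t k} \<subseteq> {0<..<1}" using a(1) t(2)[of k] by auto
      show "t k \<in> {Max A<..t k}" using a(2) by simp
      fix \<sigma> assume \<sigma>: "\<sigma> \<in> {Max A<..t k}" "\<sigma> \<noteq> t k"
      show "?f \<sigma> \<notin> critical T"
      proof
        assume "?f \<sigma> \<in> critical T"
        then have "\<sigma> \<in> A" using \<sigma> a(1) by (simp add: A_def)
        then have "\<sigma> \<le> Max A" using A by simp
        with \<sigma> show False by simp
      qed
    qed simp
    with a show ?thesis by blast
  qed
  then obtain a where "\<And>k. 0 \<le> a k \<and> a k < t k \<and> (sgn_at s k, edge_pt (tab T s k) (e k) (a k)) \<in> critical T \<and>
      (\<forall>\<tau>\<in>{a k<..t k}. admissible (shift k (tab T s)) (shift k e) \<tau>)" by metis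
  moreover have "e k < length (tab T s k)" for k using orbit_inD(1)[OF itinerary_ofD(2)[OF P r]] .
  ultimately show ?thesis unfolding left_ends_def using t(2) by blast
qed

lemma left_endsD:
  assumes "left_ends T s e t a"
  shows "0 \<le> a k" "a k < t k" "t k < 1" "a k < 1" "e k < length (tab T s k)"
    "(sgn_at s k, left_end T s e a k) \<in> critical T"
    "\<And>\<tau>. a k < \<tau> \<Longrightarrow> \<tau> \<le> t k \<Longrightarrow> admissible (shift k (tab T s)) (shift k e) \<tau>"
  using assms unfolding left_ends_def by (auto intro: less_trans)

lemma left_end_eqD:
  assumes a: "left_ends T s e t a" and "tab T s j = tab T s k" "left_end T s e a j = left_end T s e a k"
  shows "e j = e k" "a j = a k"
proof -
  have "is_polygon (tab T s j)" by (simp add: tab_def P)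
  from half_open_edge_unique[OF this, of "e j" "a j" "e k" "a k"]
  show "e j = e k" "a j = a k"
    using assms(2,3) left_endsD[OF a, of j] left_endsD[OF a, of k] by simp_all
qed

text \<open>Two rectangles extending to the right from the same corner overlap near it, and a common
  point forces a common itinerary.\<close>

lemma itinerary_eq_of_left_ends:
  assumes a: "left_ends T s e t a"
    and U: "tab T s j = tab T s k" "tab T s (Suc j) = tab T s (Suc k)"
    and eq: "left_end T s e a j = left_end T s e a k" "left_end T s e a (Suc j) = left_end T s e a (Suc k)"
  shows "e (j + i) = e (k + i)"
proof -
  note alt = alternating_tab[of T s, OF P]
  have tab: "shift j (tab T s) = shift k (tab T s)"
    by (rule ext) (rule alternating_shift_eq[OF alt U])
  have tab': "shift (Suc j) (tab T s) = shift (Suc k) (tab T s)"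
    using U by (intro ext alternating_shift_eq[OF alt]) (simp_all add: tab_def split: if_splits)
  have Sh: "shift 1 (shift m f) = shift (Suc m) f" for m and f :: "nat \<Rightarrow> 'b" by (simp add: fun_eq_iff)
  \<comment> \<open>The smaller of the two orbit parameters lies in both half-open intervals, since
    these have the same left end.\<close>
  define \<tau> where "\<tau> = min (t j) (t k)"
  define \<sigma> where "\<sigma> = min (t (Suc j)) (t (Suc k))"
  note 0 = left_end_eqD[OF a U(1) eq(1)] and 1 = left_end_eqD[OF a U(2) eq(2)]
  have \<tau>: "a j < \<tau>" "\<tau> \<le> t j" "a k < \<tau>" "\<tau> \<le> t k"
    using left_endsD(2)[OF a, of j] left_endsD(2)[OF a, of k] 0 by (auto simp: \<tau>_def)
  have \<sigma>: "a (Suc j) < \<sigma>" "\<sigma> \<le> t (Suc j)" "a (Suc k) < \<sigma>" "\<sigma> \<le> t (Suc k)"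
    using left_endsD(2)[OF a, of "Suc j"] left_endsD(2)[OF a, of "Suc k"] 1 by (auto simp: \<sigma>_def)
  show ?thesis
  proof (rule itinerary_eq[where U = "shift j (tab T s)" and e = "shift j e" and f = "shift k e"
        and \<tau> = \<tau> and \<sigma> = \<sigma>])
    show "alternating (shift j (tab T s))" using alternating_shift[OF alt] .
    show "admissible (shift j (tab T s)) (shift j e) \<tau>" using left_endsD(7)[OF a \<tau>(1,2)] .
    show "admissible (shift j (tab T s)) (shift k e) \<tau>" using left_endsD(7)[OF a \<tau>(3,4)] unfolding tab .
    show "admissible (shift 1 (shift j (tab T s))) (shift 1 (shift j e)) \<sigma>"
      unfolding Sh using left_endsD(7)[OF a \<sigma>(1,2)] .
    show "admissible (shift 1 (shift j (tab T s))) (shift 1 (shift k e)) \<sigma>"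
      unfolding Sh tab' using left_endsD(7)[OF a \<sigma>(3,4)] .
  qed (use 0 1 in simp_all)
qed

lemma left_ends_period:
  assumes a: "left_ends T s e t a" and r: "itinerary_of T r s e"
    and t: "\<And>k. orbit_pt T r k = edge_pt (tab T s k) (e k) (t k)"
    and n: "even n" "\<And>k. e (j + k + n) = e (j + k)"
  shows "(phi T ^^ (2 * n)) r = r" "orbit_pt T r (k + 2 * n) = orbit_pt T r k"
proof -
  \<comment> \<open>Midpoints provide a second orbit with the same itinerary that differs in both
    coordinates.\<close>
  have mid: "a k < (a k + t k) / 2" "(a k + t k) / 2 \<le> t k" "(a k + t k) / 2 \<noteq> t k" for k
    using left_endsD(2)[OF a, of k] by (auto simp: field_simps)
  have "admissible (tab T s) e ((a 0 + t 0) / 2)"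
    using left_endsD(7)[OF a mid(1,2), of 0] by simp
  note phi_pow_eq_of_itinerary[OF P r t t this left_endsD(7)[OF a mid(1,2)] mid(3,3) n]
  then show "(phi T ^^ (2 * n)) r = r" "orbit_pt T r (k + 2 * n) = orbit_pt T r k" by blast+
qed

lemma critical_in_table: "(b, v) \<in> critical T \<Longrightarrow> (b, v) \<in> table T b"
  using critical_subset_tables[of T, OF P] by (auto simp: tables_def table_def)

lemma period_bound:
  assumes fin: "finite (critical T)" and r: "r \<in> phase_space T"
  shows "periodic_at (phi T) r \<and>
    period (phi T) r \<le> 4 * card (critical T \<inter> table T False) * card (critical T \<inter> table T True)"
proof -
  obtain s e where se: "itinerary_of T r s e" using itinerary_ex[OF P r] by blast
  obtain t where t: "\<And>k. 0 < t k" "\<And>k. t k < 1" "\<And>k. orbit_pt T r k = edge_pt (tab T s k) (e k) (t k)"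
    using orbit_in_params[OF alternating_tab[OF P] itinerary_ofD(2)[OF P se]] by blast
  obtain a where a: "left_ends T s e t a" using left_ends_ex[OF fin se t] by blast
  define C where "C b = critical T \<inter> table T b" for b
  define K where "K k = ((sgn_at s k, left_end T s e a k), (sgn_at s (Suc k), left_end T s e a (Suc k)))" for k
  \<comment> \<open>The possible corners, in both sign orders: this is the first factor 2 of the
    bound, the second turn is the other.\<close>
  define S where "S = C False \<times> C True \<union> C True \<times> C False"
  have finC: "finite (C b)" for b using fin by (simp add: C_def)
  have "card S \<le> card (C False \<times> C True) + card (C True \<times> C False)"
    unfolding S_def by (rule card_Un_le)
  then have card: "card S \<le> 2 * (card (C False) * card (C True))" by (simp add: card_cartesian_product mult.commute)
  have inC: "(sgn_at s k, left_end T s e a k) \<in> C (sgn_at s k)" for k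
    using left_endsD(6)[OF a] critical_in_table by (simp add: C_def)
  have "K k \<in> S" for k
    using inC[of k] inC[of "Suc k"] unfolding K_def S_def
    by (cases "sgn_at s k") (auto split: if_splits)
  then obtain j k where jk: "j < k" "k \<le> card S" "K j = K k"
    using pigeonhole_nat[of S K] finC by (auto simp: S_def)
  \<comment> \<open>The sign is part of the corner, so equal corners occur at times of equal
    parity.\<close>
  have par: "sgn_at s j = sgn_at s k" using jk(3) by (simp add: K_def)
  then have "even j = even k" by (auto split: if_splits)
  then have n: "even (k - j)" using jk(1) by simp
  have U: "tab T s j = tab T s k" "tab T s (Suc j) = tab T s (Suc k)"
    using \<open>even j = even k\<close> by (simp_all add: tab_def)
  have eq: "left_end T s e a j = left_end T s e a k" "left_end T s e a (Suc j) = left_end T s e a (Suc k)"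
    using jk(3) by (simp_all add: K_def)
  have e: "e (j + i + (k - j)) = e (j + i)" for i
    using itinerary_eq_of_left_ends[OF a U eq, of i] jk(1) by (simp add: add.commute)
  have "(phi T ^^ (2 * (k - j))) r = r" using left_ends_period(1)[OF a se t(3) n e] .
  moreover have "2 * (k - j) \<le> 4 * card (C False) * card (C True)" using jk card by simp
  ultimately show ?thesis using jk(1) unfolding C_def by (intro period_le) auto
qed

end

section \<open>The single table\<close>

text \<open>Reading the first orbit backwards gives the second one, so the itinerary is palindromic; since
  its period is odd, the palindrome has a centre \<open>c\<close> with \<open>e (c + 1) = e (c - 1)\<close>.\<close>

lemma no_reversal:
  assumes U: "alternating U" "\<And>k. U (Suc k) = U k"
    and e: "\<And>i. e (i + n) = e i" and n: "odd n" and jk: "j < n" "k < n"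
    and z: "orbit_in U (shift j e) z" and z': "orbit_in U (shift k e) z'"
    and start: "z' 0 = z 1" "z' 1 = z 0" and per: "\<And>i. z (i + 4 * n) = z i"
  shows False
proof -
  define p where "p = 4 * n"
  have Uc: "U k = U 0" for k by (induction k) (simp_all add: U(2))
  note poly = alternating_polygon[OF U(1), of 0]
  have e': "e (i + m * n) = e i" for i m
  proof (induction m)
    case (Suc m)
    then show ?case using e[of "i + m * n"] by (simp add: algebra_simps)
  qed simp
  have same: "e (k + m) = e (j + i)" if "z' m = z i" for m i
    using edge_unique[OF poly, of "z i" "e (k + m)" "e (j + i)"]
      orbit_inD(1,2)[OF z, of i] orbit_inD(1,2)[OF z', of m] that Uc by metis
  have step: "z' (Suc (Suc m)) = z i" if "z' m = z (Suc (Suc i))" "z' (Suc m) = z (Suc i)" for m i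
  proof -
    have "chord (U 0) (dir (U 0) (e (k + Suc m))) (z' m) (z' (Suc (Suc m)))"
      using orbit_inD(3)[OF z', of m] Uc by metis
    moreover have "chord (U 0) (dir (U 0) (e (j + Suc i))) (z (Suc (Suc i))) (z i)"
      using chord_sym[OF orbit_inD(3)[OF z, of i]] Uc by metis
    ultimately show ?thesis
      using chord_unique[OF poly, of _ "z' m" "z' (Suc (Suc m))" "z i" "e (k + m)"]
        same[OF that(2)] that(1) orbit_inD(1,2)[OF z', of m] Uc by metis
  qed
  \<comment> \<open>Chords being symmetric, \<open>z'\<close> retraces \<open>z\<close>; the period
    \<open>p\<close> wraps the backward indices into the naturals.\<close>
  have rev: "m \<le> p \<Longrightarrow> z' m = z (p + 1 - m) \<and> z' (Suc m) = z (p - m)" for m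
  proof (induction m)
    case 0
    then show ?case using start per[of 0] per[of 1] by (simp add: p_def add.commute)
  next
    case (Suc m)
    then have "z' m = z (Suc (Suc (p - Suc m)))" "z' (Suc m) = z (Suc (p - Suc m))"
      by (simp_all add: Suc_diff_le flip: Suc_diff_Suc)
    from step[OF this] Suc show ?case by simp
  qed
  \<comment> \<open>Half of \<open>q\<close> is the time at which the indices \<open>k + m\<close>
    and \<open>j + (p + 1 - m)\<close> matched by \<open>rev\<close> differ by 2, or by 2 plus the
    odd \<open>n\<close> when this is needed to make \<open>q\<close> even.\<close>
  define q where "q = (if even (j + k) then p + 1 + j - k + 2 + n else p + 1 + j - k + 2)"
  have "even q"
    using n jk by (auto simp: q_def p_def)
  then obtain m where m: "q = 2 * m" by blast
  have "m \<le> p" using m jk n by (auto simp: q_def p_def split: if_splits)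
  then have "z' m = z (p + 1 - m)" using rev by blast
  from same[OF this] have eq: "e (k + m) = e (j + (p + 1 - m))" .
  define g where "g = j + (p + 1 - m)"
  have "k + m = g + 2 \<or> k + m = g + 2 + n"
    using m jk \<open>m \<le> p\<close> by (auto simp: q_def g_def p_def split: if_splits)
  then have "e (k + m) = e (g + 2)" by (elim disjE) (simp_all only: e)
  also have "\<dots> = e (g + 2 + j * n)" by (rule e'[symmetric])
  finally have "e (g + 2 + j * n) = e (g + j * n)" using eq e'[of g j] by (simp only: g_def)
  moreover have "j \<le> g + j * n" using n by (cases n) auto
  then obtain c where "g + j * n = j + c" using le_iff_add by blast
  then have "g + 2 + j * n = j + Suc (Suc c)" "g + j * n = j + c" by simp_all
  ultimately show False using orbit_in_edge_neq[OF U(1) z, of c] by simp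
qed

section \<open>Forgetting the signs and counting corners in one table\<close>

lemma map_prod_phi: "map_prod snd snd (phi (\<lambda>_. vs) r) = phi_single vs (map_prod snd snd r)"
  by (cases r) (auto simp: phi_def phi_single_def)

lemma map_prod_phi_pow:
  "map_prod snd snd ((phi (\<lambda>_. vs) ^^ n) r) = (phi_single vs ^^ n) (map_prod snd snd r)"
  by (induction n) (simp_all add: map_prod_phi)

context
  fixes vs :: "point list"
  assumes P: "is_polygon vs"
begin

lemma tab_const: "tab (\<lambda>_. vs) s k = vs"
  by (simp add: tab_def)

text \<open>The corners over one least itinerary period \<open>n\<close> are distinct off-diagonal
  pairs. For even \<open>n\<close> the orbit closes after \<open>2 * n\<close> steps. For odd
  \<open>n\<close> it needs \<open>4 * n\<close>, but then the exchanged corners are new as well, so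
  at most half of the available pairs are used.\<close>

lemma single_return_time:
  assumes fin: "finite (critical (\<lambda>_. vs))" and r: "r \<in> phase_space (\<lambda>_. vs)"
  shows "\<exists>n\<ge>1. n \<le> 2 * ((card (critical_single vs))\<^sup>2 - card (critical_single vs)) \<and>
    (\<forall>k. orbit_pt (\<lambda>_. vs) r (k + n) = orbit_pt (\<lambda>_. vs) r k)"
proof -
  let ?T = "\<lambda>_::bool. vs"
  let ?x = "orbit_pt ?T r"
  have P': "\<And>s. is_polygon (?T s)" using P .
  obtain s e where se: "itinerary_of ?T r s e" using itinerary_ex[of ?T, OF P' r] by blast
  have U: "alternating (tab ?T s)" using alternating_tab[of ?T, OF P'] .
  note orb = itinerary_ofD(2)[of ?T, OF P' se]
  obtain t where t: "\<And>k. 0 < t k" "\<And>k. t k < 1" "\<And>k. ?x k = edge_pt (tab ?T s k) (e k) (t k)"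
    using orbit_in_params[OF U orb] by blast
  obtain a where a: "left_ends ?T s e t a" using left_ends_ex[of ?T, OF P' fin se t] by blast
  note aD = left_endsD[of ?T, OF P' a]
  note shift_eq = itinerary_eq_of_left_ends[of ?T, OF P' a]
  note per = left_ends_period(2)[of ?T, OF P' a se t(3)]
  define X where "X k = edge_pt vs (e k) (a k)" for k
  define C where "C = critical_single vs"
  \<comment> \<open>Consecutive corner entries differ: equal ones would lie on equal edges, making
    the angle vanish.\<close>
  define D where "D = C \<times> C - (\<lambda>p. (p, p)) ` C"
  define K where "K k = (X k, X (Suc k))" for k
  have X: "left_end ?T s e a k = X k" for k by (simp add: X_def tab_const)
  have e_len: "e k < length vs" for k using aD(5)[of k] by (simp add: tab_const)
  have Xeq: "e j = e k \<and> a j = a k" if "X j = X k" for j k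
    using half_open_edge_unique[OF P that[unfolded X_def] aD(1,4) aD(1,4) e_len e_len] by blast
  have finC: "finite C" using fin by (simp add: C_def critical_single_def)
  have finD: "finite D" using finC by (simp add: D_def)
  have "card D = card (C \<times> C) - card ((\<lambda>p. (p, p)) ` C)"
    unfolding D_def by (rule card_Diff_subset) (use finC in auto)
  moreover have "card ((\<lambda>p. (p, p)) ` C) = card C" by (rule card_image) (auto intro: inj_onI)
  ultimately have cardD: "card D = (card C)\<^sup>2 - card C"
    by (simp add: card_cartesian_product power2_eq_square)
  have XC: "X k \<in> C" for k using aD(6)[of k] unfolding X C_def critical_single_def by force
  have X_neq: "X k \<noteq> X (Suc k)" for k
  proof
    assume "X k = X (Suc k)"
    then have "e k = e (Suc k)" using Xeq by blast
    then have "angle (tab ?T s) e k = 0" by (simp add: angle_def tab_const)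
    with angle_nonzero[OF U orb] show False by blast
  qed
  have KD: "K k \<in> D" for k using X_neq[of k] XC[of k] XC[of "Suc k"] by (auto simp: K_def D_def)
  have K_shift: "e (j + i) = e (k + i)" if "K j = K k" for j k i
    by (rule shift_eq) (use that in \<open>simp_all add: K_def X_def tab_const\<close>)
  have e_of_x: "e i = e k" if "?x i = ?x k" for i k
    using edge_unique[OF P, of "?x i" "e i" "e k"] orbit_inD(1,2)[OF orb, of i]
      orbit_inD(1,2)[OF orb, of k] that by (simp add: tab_const)
  have x_per: "?x (k + 4 * m) = ?x k" if "\<And>i. e (j + i + m) = e (j + i)" for j k m
  proof -
    have "e (j + i + 2 * m) = e (j + i)" for i
      using that[of i] that[of "i + m"] by (simp add: add_ac mult_2)
    from per[of "2 * m" j k, OF _ this] show ?thesis by simp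
  qed
  \<comment> \<open>The orbit returns after \<open>4 * m\<close> steps already from time 0, so any
    index can be moved beyond \<open>j\<close>; eventual periodicity of the itinerary becomes
    periodicity with the same \<open>m\<close>.\<close>
  have fully: "e (i + m) = e i" if m: "\<And>i. e (j + i + m) = e (j + i)" "0 < m" for i j m
  proof -
    have p: "e (k + l * (4 * m)) = e k" for k l
    proof (induction l)
      case (Suc l)
      have "e (k + l * (4 * m) + 4 * m) = e (k + l * (4 * m))" using x_per[OF m(1)] by (rule e_of_x)
      with Suc show ?case by (simp add: algebra_simps)
    qed simp
    have "j * 1 \<le> j * (4 * m)" using m(2) by (intro mult_le_mono2) simp
    then have "j \<le> i + j * (4 * m)" by linarith
    then obtain i' where i': "i + j * (4 * m) = j + i'" using le_iff_add by blast
    have "e (i + m) = e (i + m + j * (4 * m))" using p by simp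
    also have "i + m + j * (4 * m) = j + i' + m" using i' by simp
    also have "e (j + i' + m) = e (i + j * (4 * m))" using m(1) i' by simp
    also have "\<dots> = e i" by (rule p)
    finally show ?thesis .
  qed
  have cycle: "e (i + (k - j)) = e i" if "j < k" "K j = K k" for i j k
  proof (rule fully)
    fix i
    show "e (j + i + (k - j)) = e (j + i)" using K_shift[OF that(2), of i] that(1) by (simp add: add.commute)
  qed (use that in simp)
  \<comment> \<open>Minimality is what makes the corners at times below \<open>n\<close>
    distinct.\<close>
  define n where "n = (LEAST n. 0 < n \<and> (\<forall>i. e (i + n) = e i))"
  obtain j k where "j < k" "K j = K k" using pigeonhole_nat[of D K] finD KD by metis
  then have "\<exists>n. 0 < n \<and> (\<forall>i. e (i + n) = e i)" using cycle by (intro exI[of _ "k - j"]) auto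
  then have n: "0 < n \<and> (\<forall>i. e (i + n) = e i)" unfolding n_def by (rule LeastI_ex)
  have "inj_on K {..<n}"
  proof (rule linorder_inj_onI')
    fix j k assume jk: "j \<in> {..<n}" "k \<in> {..<n}" "j < k"
    show "K j \<noteq> K k"
    proof
      assume "K j = K k"
      then have "0 < k - j \<and> (\<forall>i. e (i + (k - j)) = e i)" using cycle jk(3) by simp
      then have "n \<le> k - j" unfolding n_def by (rule Least_le)
      with jk show False by auto
    qed
  qed
  then have card_K: "card (K ` {..<n}) = n" by (simp add: card_image)
  have sub: "K ` {..<n} \<subseteq> D" using KD by blast
  show ?thesis
  proof (cases "even n")
    case True
    have "?x (k + 2 * n) = ?x k" for k using per[of n 0 k] True n by simp
    moreover have "2 * n \<le> 2 * card D" using card_mono[OF finD sub] card_K by simp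
    ultimately show ?thesis using n cardD unfolding C_def by (intro exI[of _ "2 * n"]) auto
  next
    case False
    \<comment> \<open>An exchanged corner gives two rectangles that are mirror images near it, and
      an orbit starting in both would have to retrace itself.\<close>
    have "K ` {..<n} \<inter> prod.swap ` K ` {..<n} = {}"
    proof (rule ccontr)
      assume "K ` {..<n} \<inter> prod.swap ` K ` {..<n} \<noteq> {}"
      then obtain j k where jk: "j < n" "k < n" "X j = X (Suc k)" "X (Suc j) = X k"
        by (auto simp: K_def)
      note 0 = Xeq[OF jk(3)] and 1 = Xeq[OF jk(4)]
      \<comment> \<open>Strictly below the orbit parameters, so that the new orbit differs from the
        given one in both coordinates and its period can be deduced.\<close>
      obtain \<tau> where \<tau>: "a j < \<tau>" "\<tau> < t j" "\<tau> < t (Suc k)"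
        using dense[of "a j" "min (t j) (t (Suc k))"] aD(2)[of j] aD(2)[of "Suc k"] 0 by auto
      obtain \<sigma> where \<sigma>: "a k < \<sigma>" "\<sigma> < t k" "\<sigma> < t (Suc j)"
        using dense[of "a k" "min (t k) (t (Suc j))"] aD(2)[of k] aD(2)[of "Suc j"] 1 by auto
      have adm: "admissible (tab ?T s) (shift i e) \<rho>" if "a i < \<rho>" "\<rho> \<le> t i" for i \<rho>
      proof -
        have "shift i (tab ?T s) = tab ?T s" by (simp add: fun_eq_iff tab_const)
        with aD(7)[OF that] show ?thesis by simp
      qed
      have Sh: "shift 1 (shift i e) = shift (Suc i) e" and tabS: "shift 1 (tab ?T s) = tab ?T s" for i
        by (simp_all add: fun_eq_iff tab_const)
      obtain z where z: "orbit_in (tab ?T s) (shift j e) z" "z 0 = edge_pt vs (e j) \<tau>"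
        "z 1 = edge_pt vs (e (Suc j)) \<sigma>"
      proof (rule orbit_in_combine[of "tab ?T s" "shift j e" \<tau> \<sigma>])
        show "admissible (tab ?T s) (shift j e) \<tau>" using adm \<tau> by simp
        show "admissible (shift 1 (tab ?T s)) (shift 1 (shift j e)) \<sigma>"
          unfolding Sh tabS by (rule adm) (use \<sigma> 1 in simp_all)
      qed (simp add: tab_const)
      obtain z' where z': "orbit_in (tab ?T s) (shift k e) z'" "z' 0 = edge_pt vs (e k) \<sigma>"
        "z' 1 = edge_pt vs (e (Suc k)) \<tau>"
      proof (rule orbit_in_combine[of "tab ?T s" "shift k e" \<sigma> \<tau>])
        show "admissible (tab ?T s) (shift k e) \<sigma>" using adm \<sigma> by simp
        show "admissible (shift 1 (tab ?T s)) (shift 1 (shift k e)) \<tau>"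
          unfolding Sh tabS by (rule adm) (use \<tau> 0 in simp_all)
      qed (simp add: tab_const)
      have y: "orbit_in (tab ?T s) (shift j e) (shift j ?x)"
        using orbit_in_shift[OF orb, of j] by (simp add: tab_const[abs_def])
      have ne: "z 0 \<noteq> ?x (j + 0)" "z 1 \<noteq> ?x (j + 1)"
        using z(2,3) t(3)[of j] t(3)[of "Suc j"] \<tau> \<sigma> by (auto simp: tab_const edge_pt_inj[OF P])
      have "z (0 + i + 2 * (2 * n)) = z (0 + i)" for i
      proof (rule orbit_periodic_of_itinerary_periodic[OF U z(1) y ne])
        show "e (j + (0 + i + 2 * n)) = e (j + (0 + i))" for i
          using n by (simp add: mult_2 flip: add.assoc)
      qed simp
      then have "z (i + 4 * n) = z i" for i by simp
      then show False
        using no_reversal[OF U _ _ False jk(1,2) z(1) z'(1)] n z z' 0 1 by (simp add: tab_const)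
    qed
    moreover have "card (prod.swap ` K ` {..<n}) = n"
      using card_image[OF inj_on_subset[OF inj_swap subset_UNIV], of "K ` {..<n}"] card_K by simp
    ultimately have "2 * n = card (K ` {..<n} \<union> prod.swap ` K ` {..<n})"
      by (subst card_Un_disjoint) (simp_all add: card_K)
    also have "\<dots> \<le> card D"
      using sub by (intro card_mono[OF finD]) (auto simp: D_def)
    finally have "4 * n \<le> 2 * card D" by simp
    moreover have "?x (k + 4 * n) = ?x k" for k using x_per[of 0 n k] n by simp
    ultimately show ?thesis using n cardD unfolding C_def by (intro exI[of _ "4 * n"]) auto
  qed
qed

lemma single_period_bound:
  assumes "finite (critical (\<lambda>_. vs))" "q \<in> phase_single vs"
  shows "periodic_at (phi_single vs) q \<and>
    period (phi_single vs) q \<le> 2 * ((card (critical_single vs))\<^sup>2 - card (critical_single vs))"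
proof -
  let ?T = "\<lambda>_::bool. vs"
  have P': "\<And>s. is_polygon (?T s)" using P .
  obtain r where r: "q = map_prod snd snd r" "r \<in> phase_space ?T"
    using assms(2) unfolding phase_single_def by (rule imageE)
  obtain s e where se: "itinerary_of ?T r s e" using itinerary_ex[of ?T, OF P' r(2)] by blast
  have form: "map_prod snd snd ((phi ?T ^^ k) r) = (orbit_pt ?T r k, orbit_pt ?T r (Suc k))" for k
    by (subst itinerary_ofD(3)[of ?T, OF P' se, of k]) (simp only: map_prod_simp snd_conv)
  from single_return_time[OF assms(1) r(2)] obtain n where
    "1 \<le> n \<and> n \<le> 2 * ((card (critical_single vs))\<^sup>2 - card (critical_single vs)) \<and>
      (\<forall>k. orbit_pt ?T r (k + n) = orbit_pt ?T r k)" ..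
  then have n: "1 \<le> n" "n \<le> 2 * ((card (critical_single vs))\<^sup>2 - card (critical_single vs))"
    "\<And>k. orbit_pt ?T r (k + n) = orbit_pt ?T r k" by simp_all
  have "(phi_single vs ^^ n) q = map_prod snd snd ((phi ?T ^^ n) r)"
    by (simp only: r(1) map_prod_phi_pow)
  also have "\<dots> = (orbit_pt ?T r (0 + n), orbit_pt ?T r (Suc 0 + n))" using form[of n] by simp
  also have "\<dots> = map_prod snd snd ((phi ?T ^^ 0) r)" unfolding n(3) by (rule form[symmetric])
  also have "\<dots> = q" by (simp add: r(1))
  finally have "(phi_single vs ^^ n) q = q" .
  with n(1) show ?thesis using n(2) by (rule period_le)
qed

end

theorem theorem3p4:
  fixes T :: table_pair
  assumes "\<And>s. is_polygon (T s)"
  shows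
    "((\<forall>p. p islimpt critical T \<longrightarrow> p \<in> vertices T) \<longrightarrow>
        (\<forall>r\<in>phase_space T. periodic_at (phi T) r))
     \<and>
     (closedin (top_of_set (tables T)) (critical T) \<longrightarrow>
        (\<forall>r\<in>phase_space T - C_grid T. periodic_at (phi T) r) \<and>
        (\<forall>s. AE (x, y) in arc_length (T s) \<Otimes>\<^sub>M arc_length (T (\<not> s)).
               ((s, x), (\<not> s, y)) \<in> Pmax T \<longrightarrow>
               ((s, x), (\<not> s, y)) \<in> phase_space T \<and> periodic_at (phi T) ((s, x), (\<not> s, y))))
     \<and>
     (finite (critical T) \<longrightarrow>
        (\<forall>r\<in>phase_space T. periodic_at (phi T) r \<and>
           period (phi T) r
             \<le> 4 * card (critical T \<inter> table T False) * card (critical T \<inter> table T True)) \<and>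
        (\<forall>vs. T = (\<lambda>_. vs) \<longrightarrow>
           (\<forall>r\<in>phase_single vs. periodic_at (phi_single vs) r \<and>
              period (phi_single vs) r
                \<le> 2 * ((card (critical_single vs))\<^sup>2 - card (critical_single vs)))))"
proof (intro conjI impI)
  assume lim: "\<forall>p. p islimpt critical T \<longrightarrow> p \<in> vertices T"
  show "\<forall>r\<in>phase_space T. periodic_at (phi T) r"
  proof
    fix r assume r: "r \<in> phase_space T"
    have "\<not> fst r islimpt critical T" "\<not> snd r islimpt critical T"
      using phase_space_not_vertex[of T, OF assms r] lim by blast+
    then show "periodic_at (phi T) r" using periodic_of_not_islimpt[of T, OF assms r] by blast
  qed
next
  assume closed: "closedin (top_of_set (tables T)) (critical T)"
  \<comment> \<open>Relative closedness thereby becomes closedness in the whole space, so the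
    critical set contains all its limit points.\<close>
  have "closed (tables T)"
  proof -
    have "closed (table T s)" for s
      unfolding table_def using closed_curve[OF assms, of s] by (intro closed_Times) auto
    moreover have "tables T = table T False \<union> table T True" by (auto simp: tables_def UNIV_bool)
    ultimately show ?thesis by auto
  qed
  then have C: "closed (critical T)" using closed closedin_closed_trans by blast
  have grid: "periodic_at (phi T) r" if r: "r \<in> phase_space T - C_grid T" for r
  proof -
    from r have "r \<in> phase_space T" by blast
    moreover obtain s x y where sxy: "r = ((s, x), (\<not> s, y))" "x \<in> curve (T s)" "y \<in> curve (T (\<not> s))"
    proof -
      have "r \<in> pair_space T" using r by (auto simp: phase_space_def Pmax_def)
      then show ?thesis using that by (auto simp: pair_space_def table_def)
    qed
    moreover have "(s, x) \<notin> critical T" "(\<not> s, y) \<notin> critical T"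
      using r sxy by (auto simp: C_grid_def table_def)
    ultimately show ?thesis
      using C closed_limpt[of "critical T"] periodic_of_not_islimpt[of T, OF assms, of r] by auto
  qed
  then show "\<forall>r\<in>phase_space T - C_grid T. periodic_at (phi T) r" by blast
  show "\<forall>s. AE (x, y) in arc_length (T s) \<Otimes>\<^sub>M arc_length (T (\<not> s)).
      ((s, x), (\<not> s, y)) \<in> Pmax T \<longrightarrow>
      ((s, x), (\<not> s, y)) \<in> phase_space T \<and> periodic_at (phi T) ((s, x), (\<not> s, y))"
  proof
    fix s
    show "AE (x, y) in arc_length (T s) \<Otimes>\<^sub>M arc_length (T (\<not> s)).
      ((s, x), (\<not> s, y)) \<in> Pmax T \<longrightarrow>
      ((s, x), (\<not> s, y)) \<in> phase_space T \<and> periodic_at (phi T) ((s, x), (\<not> s, y))"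
      using AE_phase_space[of T, OF assms, of s] by (rule AE_mp) (auto intro!: AE_I2 grid)
  qed
next
  assume fin: "finite (critical T)"
  show "\<forall>r\<in>phase_space T. periodic_at (phi T) r \<and> period (phi T) r
      \<le> 4 * card (critical T \<inter> table T False) * card (critical T \<inter> table T True)"
    using period_bound[of T, OF assms fin] by blast
  show "\<forall>vs. T = (\<lambda>_. vs) \<longrightarrow> (\<forall>r\<in>phase_single vs. periodic_at (phi_single vs) r \<and>
      period (phi_single vs) r \<le> 2 * ((card (critical_single vs))\<^sup>2 - card (critical_single vs)))"
  proof (intro allI impI ballI)
    fix vs r assume "T = (\<lambda>_. vs)" "r \<in> phase_single vs"
    then show "periodic_at (phi_single vs) r \<and>
      period (phi_single vs) r \<le> 2 * ((card (critical_single vs))\<^sup>2 - card (critical_single vs))"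
      using single_period_bound[of vs r] assms fin by simp
  qed
qed

end
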